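(* For every (possibly infinite) digraph $D$ there is a reversion sequence $\mathcal{C}\in\mathbb{RS}(D)$ such that, writing $D^{*}:=D\circlearrowleft\mathcal{C}$: (1) the dichromatic number satisfies $\chi(D^{*})\le 2$; (2) for any two distinct vertices $u,v$ in the same strong component of $D^{*}$, the local edge-connectivity $\lambda(u,v;D^{*})$ is finite; (3) every edge of the underlying undirected graph of $D$ is reversed at most twice, i.e. for each such edge $e$ at most two of the cycles in the sequence $\mathcal{C}$ contain an orientation of $e$.
   Context: Graphs may be infinite and may have multiple edges but no loops; an undirected graph is a set of edges and its vertex set is the set of end vertices of its edges. A digraph $D$ is an orientation of an undirected graph $\mathsf{Un}(D)$, and $V(D)$ is the vertex set of $\mathsf{Un}(D)$. For $E\subseteq \mathsf{Un}(D)$, $D(E)$ denotes the set of $D$-oriented elements of $E$. Cycles and paths are finite and directed; a cycle has at least two edges and no repeated vertices. Limit: if $\langle D_\xi:\xi<\alpha\rangle$ is a sequence of orientations of a graph $G$ such that for each $e\in G$ there is $\xi_e<\alpha$ with $D_\xi(e)=D_{\xi_e}(e)$ for all $\xi\ge\xi_e$, its limit is the orientation $D^*$ with $D^*(e)=D_{\xi_e}(e)$; otherwise it has no limit. Reversion sequences: the set $\mathbb{RS}(D)$ of transfinite sequences $\mathcal{C}=\langle C_\xi:\xi<\alpha\rangle$ and the reorientation $D\circlearrowleft\mathcal{C}$ of $D$ are defined by recursion on the ordinal $\alpha$. If $\alpha=0$, then $\mathcal{C}\in\mathbb{RS}(D)$ and $D\circlearrowleft\mathcal{C}=D$. If $\alpha=\beta+1$,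 then $\mathcal{C}\in\mathbb{RS}(D)$ iff $\mathcal{C}\upharpoonright\beta\in\mathbb{RS}(D)$ and $C_\beta$ is a directed cycle in $D\circlearrowleft(\mathcal{C}\upharpoonright\beta)$; then $D\circlearrowleft\mathcal{C}$ is obtained from $D\circlearrowleft(\mathcal{C}\upharpoonright\beta)$ by reversing each edge of $C_\beta$. If $\alpha$ is a limit ordinal, then $\mathcal{C}\in\mathbb{RS}(D)$ iff $\mathcal{C}\upharpoonright\beta\in\mathbb{RS}(D)$ for all $\beta<\alpha$ and $\langle D\circlearrowleft(\mathcal{C}\upharpoonright\beta):\beta<\alpha\rangle$ has a limit, which is then $D\circlearrowleft\mathcal{C}$. The dichromatic number $\chi(D)$ is the smallest cardinal $\kappa$ such that $V(D)$ can be coloured with $\kappa$ many colours without monochromatic directed cycles. The local edge-connectivity $\lambda(u,v;D)$ is the maximal size of a system of pairwise edge-disjoint directed paths from $u$ to $v$ in $D$. Strong components are the classes of vertices mutually reachable by directed paths. *)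

theory Defs
  imports "Graph_Theory.Graph_Theory"
begin

unbundle cardinal_syntax

text \<open>
  A digraph is a \<open>pre_digraph\<close> record whose arcs are the edges of the underlying undirected
  graph; \<open>tail\<close> and \<open>head\<close> encode the orientation. Re-orienting a digraph therefore only changes
  \<open>tail\<close> and \<open>head\<close>. A directed cycle is the list of its arcs.
\<close>

locale oriented_graph = loopfree_digraph +
  assumes verts_eq_ends: "verts G = tail G ` arcs G \<union> head G ` arcs G"

definition reverse_arcs :: "'e set \<Rightarrow> ('v, 'e) pre_digraph \<Rightarrow> ('v, 'e) pre_digraph" where
  "reverse_arcs E G =
     G\<lparr>tail := (\<lambda>e. if e \<in> E then head G e else tail G e),
       head := (\<lambda>e. if e \<in> E then tail G e else head G e)\<rparr>"


subsection \<open>Limits and reversion sequences\<close>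

text \<open>
  A transfinite sequence of length \<open>\<alpha>\<close> is a family indexed by the field of a well-order of type
  \<open>\<alpha>\<close>. Each ordinal \<open>\<beta> < \<alpha>\<close> is an index \<open>i\<close>, and restriction to \<open>\<beta>\<close> is restriction to
  \<open>underS r i\<close>. More generally, restrictions are to order filters (initial segments).

  If every edge lies in at most two (nonempty) cycles of the sequence, then the sequence has at most
  \<open>2 * |arcs D|\<close> members, so indices of type \<open>'e \<times> nat\<close> represent every possible length.
\<close>

text \<open>
  The condition on \<open>tail\<close> and \<open>head\<close> also mentions elements outside \<open>arcs D\<close>. Their (meaningless)
  values are constant along the sequences considered below, so this only makes the limit unique.
\<close>
definition is_limit_orientation ::
  "('v, 'e) pre_digraph \<Rightarrow> 'i rel \<Rightarrow> 'i set \<Rightarrow> ('i \<Rightarrow> ('v, 'e) pre_digraph)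
     \<Rightarrow> ('v, 'e) pre_digraph \<Rightarrow> bool" where
  "is_limit_orientation D r I F H \<longleftrightarrow>
     verts H = verts D \<and> arcs H = arcs D \<and>
     (\<forall>e. \<exists>i\<in>I. \<forall>j\<in>I. (i, j) \<in> r \<longrightarrow> tail (F j) e = tail H e \<and> head (F j) e = head H e)"

text \<open>
  \<open>reorients D r C I H\<close>: the restriction of \<open>C\<close> to the initial segment \<open>I\<close> of \<open>r\<close> is a reversion
  sequence of \<open>D\<close>, and it turns \<open>D\<close> into \<open>H\<close>.
\<close>
inductive reorients ::
  "('v, 'e) pre_digraph \<Rightarrow> 'i rel \<Rightarrow> ('i \<Rightarrow> 'e list) \<Rightarrow> 'i set \<Rightarrow> ('v, 'e) pre_digraph \<Rightarrow> bool"
  for D r C where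
  zero: "reorients D r C {} D"
| successor: "reorients D r C (under r i) (reverse_arcs (set (C i)) H)"
    if "i \<in> Field r" "reorients D r C (underS r i) H" "pre_digraph.cycle H (C i)"
| limit: "reorients D r C I H"
    if "Order_Relation.ofilter r I" "I \<noteq> {}" "\<forall>i\<in>I. \<exists>j\<in>I. j \<noteq> i \<and> (i, j) \<in> r"
       "\<And>i. i \<in> I \<Longrightarrow> reorients D r C (underS r i) (F i)"
       "is_limit_orientation D r I F H"

definition reversion_sequence ::
  "('v, 'e) pre_digraph \<Rightarrow> 'i rel \<Rightarrow> ('i \<Rightarrow> 'e list) \<Rightarrow> bool" where
  "reversion_sequence D r C \<longleftrightarrow> Well_order r \<and> (\<exists>H. reorients D r C (Field r) H)"

definition reorientation ::
  "('v, 'e) pre_digraph \<Rightarrow> 'i rel \<Rightarrow> ('i \<Rightarrow> 'e list) \<Rightarrow> ('v, 'e) pre_digraph" where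
  "reorientation D r C = (THE H. reorients D r C (Field r) H)"

lemma is_limit_orientation_unique:
  assumes wo: "Well_order r" and I: "Order_Relation.ofilter r I"
    and H: "is_limit_orientation D r I F H" and K: "is_limit_orientation D r I F' K"
    and F: "\<And>i. i \<in> I \<Longrightarrow> F i = F' i"
  shows "H = K"
proof -
  have "tail H e = tail K e \<and> head H e = head K e" for e
  proof -
    obtain i where i: "i \<in> I"
      "\<forall>j\<in>I. (i, j) \<in> r \<longrightarrow> tail (F j) e = tail H e \<and> head (F j) e = head H e"
      using H unfolding is_limit_orientation_def by blast
    obtain k where k: "k \<in> I"
      "\<forall>j\<in>I. (k, j) \<in> r \<longrightarrow> tail (F' j) e = tail K e \<and> head (F' j) e = head K e"
      using K unfolding is_limit_orientation_def by blast
    have fld: "i \<in> Field r" "k \<in> Field r"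
      using i(1) k(1) I by (auto simp: Order_Relation.ofilter_def)
    have refl: "(i, i) \<in> r" "(k, k) \<in> r"
      using fld wo by (auto simp: order_on_defs well_order_on_def refl_on_def)
    have "(i, k) \<in> r \<or> (k, i) \<in> r"
      using fld refl wo by (auto simp: order_on_defs well_order_on_def total_on_def)
    then show ?thesis using i k refl F by metis
  qed
  then show ?thesis
    using H K unfolding is_limit_orientation_def by (auto intro!: pre_digraph.equality)
qed

lemma reorients_unique:
  assumes wo: "Well_order r"
  shows "reorients D r C I H \<Longrightarrow> reorients D r C I K \<Longrightarrow> H = K"
proof (induction arbitrary: K rule: reorients.induct)
  case zero
  have "under r i \<noteq> {}" if "i \<in> Field r" for i
    using that wo by (auto simp: under_def order_on_defs well_order_on_def refl_on_def)
  with zero show ?case by (auto elim: reorients.cases)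
next
  case (successor i H)
  have refl: "(j, j) \<in> r" if "j \<in> Field r" for j
    using that wo by (auto simp: order_on_defs well_order_on_def refl_on_def)
  have anti: "j = k" if "(j, k) \<in> r" "(k, j) \<in> r" for j k
    using that wo by (auto simp: order_on_defs well_order_on_def antisym_def)
  have inj: "j = i" if "under r i = under r j" "j \<in> Field r" for j
    using that refl[OF that(2)] refl[OF successor(1)] by (intro anti) (auto simp: under_def)
  have mem: "i \<in> under r i" using refl successor(1) by (auto simp: under_def)
  from successor.prems show ?case
  proof (cases rule: reorients.cases)
    case zero
    with mem show ?thesis by auto
  next
    case (successor j H')
    with inj successor.IH show ?thesis by metis
  next
    case (limit F)
    with mem anti show ?thesis by (auto simp: under_def)
  qed
next
  case (limit I F H)
  have anti: "j = k" if "(j, k) \<in> r" "(k, j) \<in> r" for j k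
    using that wo by (auto simp: order_on_defs well_order_on_def antisym_def)
  from limit.prems show ?case
  proof (cases rule: reorients.cases)
    case zero
    with limit(2) show ?thesis by auto
  next
    case (successor j H')
    have "j \<in> I"
      using successor wo by (auto simp: under_def order_on_defs well_order_on_def refl_on_def)
    with limit(3) successor anti show ?thesis by (auto simp: under_def)
  next
    case (limit F')
    have "\<And>i. i \<in> I \<Longrightarrow> F i = F' i" using limit.IH limit by blast
    with is_limit_orientation_unique[OF wo] limit \<open>is_limit_orientation D r I F H\<close>
    show ?thesis by blast
  qed
qed

lemma reorientation_eq:
  assumes "Well_order r" "reorients D r C (Field r) H"
  shows "reorientation D r C = H"
  unfolding reorientation_def using assms reorients_unique by (blast intro: the_equality)


subsection \<open>Dichromatic number\<close>

text \<open>
  Every vertex of a directed cycle is the tail of exactly one of its arcs.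
\<close>
definition dicolourable :: "('v, 'e) pre_digraph \<Rightarrow> 'c rel \<Rightarrow> bool" where
  "dicolourable G k \<longleftrightarrow>
     (\<exists>c :: 'v \<Rightarrow> 'c. c ` verts G \<subseteq> Field k \<and>
        \<not> (\<exists>p x. pre_digraph.cycle G p \<and> (\<forall>e\<in>set p. c (tail G e) = x)))"

text \<open>
  The minimum is taken over cardinals represented on the type of vertices. They suffice, since
  at most \<open>|verts G|\<close> colours are ever used; see \<open>dichromatic_number_le\<close>.
\<close>
definition dichromatic_number :: "('v, 'e) pre_digraph \<Rightarrow> 'v rel" where
  "dichromatic_number G =
     (SOME k. Card_order k \<and> dicolourable G k \<and>
        (\<forall>k' :: 'v rel. Card_order k' \<and> dicolourable G k' \<longrightarrow> k \<le>o k'))"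

lemma (in loopfree_digraph) dicolourable_card_of_verts: "dicolourable G |verts G|"
proof -
  have False if p: "cycle p" "\<forall>e\<in>set p. tail G e = x" for p x
  proof -
    obtain u where u: "awalk u p u" "p \<noteq> []" "2 \<le> length p"
      using p(1) unfolding cycle_digraph_conv by fastforce
    then obtain a b q where [simp]: "p = a # b # q"
      by (cases p; cases "tl p") auto
    have "a \<in> arcs G" "head G a = tail G b"
      using u by (auto simp: awalk_simps)
    moreover have "tail G a = tail G b" using p(2) by simp
    ultimately show False using no_loops by metis
  qed
  then show ?thesis
    unfolding dicolourable_def by (intro exI[of _ id]) (auto simp: Field_card_of)
qed

lemma (in loopfree_digraph) dichromatic_number_min:
  "Card_order (dichromatic_number G) \<and> dicolourable G (dichromatic_number G) \<and>
     (\<forall>k' :: 'a rel. Card_order k' \<and> dicolourable G k' \<longrightarrow> dichromatic_number G \<le>o k')"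
proof -
  let ?R = "{k :: 'a rel. Card_order k \<and> dicolourable G k}"
  have "?R \<noteq> {}" using dicolourable_card_of_verts card_of_Card_order by blast
  then have "\<exists>k\<in>?R. \<forall>k'\<in>?R. k \<le>o k'"
    by (rule exists_minim_Card_order) auto
  then have "\<exists>k :: 'a rel. Card_order k \<and> dicolourable G k \<and>
      (\<forall>k' :: 'a rel. Card_order k' \<and> dicolourable G k' \<longrightarrow> k \<le>o k')"
    by blast
  then show ?thesis unfolding dichromatic_number_def by (rule someI_ex)
qed

lemma (in loopfree_digraph) dichromatic_number_le:
  fixes k :: "'c rel"
  assumes k: "Card_order k" "dicolourable G k"
  shows "dichromatic_number G \<le>o k"
proof -
  obtain c :: "'a \<Rightarrow> 'c" where c: "c ` verts G \<subseteq> Field k"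
    "\<not> (\<exists>p x. cycle p \<and> (\<forall>e\<in>set p. c (tail G e) = x))"
    using k unfolding dicolourable_def by auto
  define g where "g = inv_into (verts G) c"
  have g: "inj_on g (c ` verts G)" unfolding g_def by (rule inj_on_inv_into) simp
  have bij: "bij_betw g (c ` verts G) (g ` c ` verts G)"
    using g by (simp add: bij_betw_def)
  have "\<not> (\<forall>e\<in>set p. g (c (tail G e)) = x)" if p: "cycle p" for p x
  proof
    assume all: "\<forall>e\<in>set p. g (c (tail G e)) = x"
    have sub: "set p \<subseteq> arcs G" and "p \<noteq> []"
      using p unfolding cycle_def awalk_def by auto
    then obtain a where a: "a \<in> set p" by (cases p) auto
    have "c (tail G e) = c (tail G a)" if "e \<in> set p" for e
      using all a that sub by (intro inj_onD[OF g]) auto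
    with c(2) p show False by blast
  qed
  then have "dicolourable G |g ` c ` verts G|"
    unfolding dicolourable_def by (intro exI[of _ "g \<circ> c"]) (auto simp: Field_card_of)
  then have "dichromatic_number G \<le>o |g ` c ` verts G|"
    using dichromatic_number_min card_of_Card_order by blast
  also have "|g ` c ` verts G| =o |c ` verts G|"
    using bij card_of_ordIso ordIso_symmetric by blast
  also have "|c ` verts G| \<le>o |Field k|" using c(1) by (rule card_of_mono1)
  also have "|Field k| =o k" using k(1) by (rule card_of_Field_ordIso)
  finally show ?thesis .
qed


subsection \<open>Local edge-connectivity\<close>

definition edge_disjoint_paths ::
  "('v, 'e) pre_digraph \<Rightarrow> 'v \<Rightarrow> 'v \<Rightarrow> 'e list set \<Rightarrow> bool" where
  "edge_disjoint_paths G u v P \<longleftrightarrow>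
     (\<forall>p\<in>P. pre_digraph.apath G u p v) \<and>
     (\<forall>p\<in>P. \<forall>q\<in>P. p \<noteq> q \<longrightarrow> set p \<inter> set q = {})"

definition local_edge_connectivity ::
  "('v, 'e) pre_digraph \<Rightarrow> 'v \<Rightarrow> 'v \<Rightarrow> 'e list rel" where
  "local_edge_connectivity G u v =
     (SOME k. Card_order k \<and>
        (\<exists>P. edge_disjoint_paths G u v P \<and> |P| =o k) \<and>
        (\<forall>P. edge_disjoint_paths G u v P \<longrightarrow> |P| \<le>o k))"

text \<open>
  The maximum in the definition of \<open>local_edge_connectivity\<close> is attained, including in the
  infinite case.
\<close>
lemma edge_disjoint_paths_hit:
  assumes Q: "edge_disjoint_paths G u v Q"
    and hit: "\<And>q. q \<in> Q \<Longrightarrow> set q \<inter> E \<noteq> {}"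
  shows "|Q| \<le>o |E|"
proof -
  define f where "f q = (SOME e. e \<in> set q \<inter> E)" for q
  have f: "f q \<in> set q \<inter> E" if "q \<in> Q" for q
    unfolding f_def by (rule someI_ex) (use hit[OF that] in blast)
  have "inj_on f Q"
  proof (rule inj_onI, rule ccontr)
    fix p q assume "p \<in> Q" "q \<in> Q" "f p = f q" "p \<noteq> q"
    with f[of p] f[of q] Q show False unfolding edge_disjoint_paths_def by auto
  qed
  moreover have "f ` Q \<subseteq> E" using f by auto
  ultimately show ?thesis using card_of_ordLeq by blast
qed

lemma local_edge_connectivity_max:
  assumes uv: "u \<noteq> v"
  shows "Card_order (local_edge_connectivity G u v) \<and>
    (\<exists>P. edge_disjoint_paths G u v P \<and> |P| =o local_edge_connectivity G u v) \<and>
    (\<forall>P. edge_disjoint_paths G u v P \<longrightarrow> |P| \<le>o local_edge_connectivity G u v)"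
proof -
  let ?S = "{P. edge_disjoint_paths G u v P}"
  have nonempty: "p \<noteq> []" if "pre_digraph.apath G u p v" for p
    using that uv unfolding pre_digraph.apath_def pre_digraph.awalk_def
    by (auto simp: pre_digraph.cas.simps)
  have "\<exists>M\<in>?S. \<forall>X\<in>?S. M \<subseteq> X \<longrightarrow> X = M"
  proof (rule subset_Zorn')
    fix \<C> assume ch: "subset.chain ?S \<C>"
    then have sub: "\<C> \<subseteq> ?S" and lin: "\<And>X Y. X \<in> \<C> \<Longrightarrow> Y \<in> \<C> \<Longrightarrow> X \<subseteq> Y \<or> Y \<subseteq> X"
      by (auto simp: subset_chain_def)
    have "set p \<inter> set q = {}" if pq: "p \<in> \<Union>\<C>" "q \<in> \<Union>\<C>" "p \<noteq> q" for p q
    proof -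
      obtain X Y where XY: "X \<in> \<C>" "Y \<in> \<C>" "p \<in> X" "q \<in> Y" using pq by blast
      then obtain Z where "Z \<in> \<C>" "p \<in> Z" "q \<in> Z" using lin[of X Y] by blast
      then show ?thesis using pq(3) sub unfolding edge_disjoint_paths_def by blast
    qed
    moreover have "pre_digraph.apath G u p v" if "p \<in> \<Union>\<C>" for p
      using that sub unfolding edge_disjoint_paths_def by blast
    ultimately show "\<Union>\<C> \<in> ?S" unfolding edge_disjoint_paths_def by blast
  qed
  then obtain M where M: "edge_disjoint_paths G u v M"
    and Mmax: "\<And>X. edge_disjoint_paths G u v X \<Longrightarrow> M \<subseteq> X \<Longrightarrow> X = M" by blast
  define E where "E = (\<Union>p\<in>M. set p)"
  have hit: "set q \<inter> E \<noteq> {}" if q: "pre_digraph.apath G u q v" for q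
  proof
    assume e: "set q \<inter> E = {}"
    then have "edge_disjoint_paths G u v (insert q M)"
      using M q unfolding edge_disjoint_paths_def E_def by blast
    then have "q \<in> M" using Mmax by blast
    with e nonempty[OF q] show False unfolding E_def by (cases q) auto
  qed
  have le: "|Q| \<le>o |E|" if "edge_disjoint_paths G u v Q" for Q
    using that hit by (intro edge_disjoint_paths_hit[OF that])
      (auto simp: edge_disjoint_paths_def)
  have "\<exists>P. edge_disjoint_paths G u v P \<and> (\<forall>Q. edge_disjoint_paths G u v Q \<longrightarrow> |Q| \<le>o |P| )"
  proof (cases "finite M")
    case True
    then have finE: "finite E" unfolding E_def by auto
    have fin_card: "finite Q \<and> card Q \<le> card E" if Q: "edge_disjoint_paths G u v Q" for Q
      proof -
      obtain f where f: "inj_on f Q" "f ` Q \<subseteq> E" using le[OF Q] card_of_ordLeq[of Q E] by blast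
      show ?thesis using inj_on_finite[OF f finE] card_inj_on_le[OF f finE] by blast
    qed
    then have fin: "finite Q" and card: "card Q \<le> card E" if "edge_disjoint_paths G u v Q" for Q
      using that by blast+
    have "\<exists>P. edge_disjoint_paths G u v P \<and>
        (\<forall>Q. edge_disjoint_paths G u v Q \<longrightarrow> card Q \<le> card P)"
      by (rule ex_has_greatest_nat[of _ M card "Suc (card E)"])
        (use M card in \<open>auto simp: less_Suc_eq_le\<close>)
    then obtain P where P: "edge_disjoint_paths G u v P"
      "\<And>Q. edge_disjoint_paths G u v Q \<Longrightarrow> card Q \<le> card P" by blast
    have "|Q| \<le>o |P|" if Q: "edge_disjoint_paths G u v Q" for Q
    proof -
      obtain f where "inj_on f Q" "f ` Q \<subseteq> P"
        using card_le_inj[OF fin[OF Q] fin[OF P(1)] P(2)[OF Q]] by blast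
      then show ?thesis using card_of_ordLeq[of Q P] by blast
    qed
    with P(1) show ?thesis by blast
  next
    case False
    have "|E| \<le>o |M|" unfolding E_def
      using False by (intro card_of_UNION_ordLeq_infinite)
        (auto intro!: ordLess_imp_ordLeq finite_ordLess_infinite card_of_Well_order
          simp: Field_card_of card_of_refl ordIso_imp_ordLeq)
    with le M show ?thesis using ordLeq_transitive by blast
  qed
  then obtain P where P: "edge_disjoint_paths G u v P"
    "\<forall>Q. edge_disjoint_paths G u v Q \<longrightarrow> |Q| \<le>o |P|" by blast
  have "\<exists>k :: 'b list rel. Card_order k \<and>
        (\<exists>P. edge_disjoint_paths G u v P \<and> |P| =o k) \<and>
        (\<forall>P. edge_disjoint_paths G u v P \<longrightarrow> |P| \<le>o k)"
    proof (intro exI[of _ "|P|"] conjI)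
    show "Card_order |P|" by (rule card_of_Card_order)
    show "\<exists>Q. edge_disjoint_paths G u v Q \<and> |Q| =o |P|" using P(1) card_of_refl by (intro exI[of _ P] conjI)
    show "\<forall>Q. edge_disjoint_paths G u v Q \<longrightarrow> |Q| \<le>o |P|" by (rule P(2))
  qed
  then show ?thesis unfolding local_edge_connectivity_def by (rule someI_ex)
qed

end

theory Submission
  imports Defs "HOL-Analysis.Function_Topology"
begin

text \<open>
  Fix the arcs and describe an orientation by the set \<open>F\<close> of arcs it flips. Flipping a cycle changes
  no finite cut, so \<open>below E F G\<close>, that no finite out-cut grows in passing from \<open>G\<close> to \<open>F\<close>, is
  necessary for reaching \<open>F\<close> from \<open>G\<close>. If \<open>E\<close> is countable, it also suffices: the arcs are settled
  one after another, each by a cycle avoiding the finitely many arcs that were flipped before and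
  have their final direction, so that no arc is flipped more than twice.

  Two further properties are wanted of \<open>F\<close>. First, given a linear order of the vertices, every cycle
  should have at least as many forward as backward arcs. Minimising the number of backward arcs
  achieves this on finite sets of arcs, and compactness on all sets. The weights of lightest walks
  are then a potential on each strong component, and its parity gives the two colours.
  Secondly, if infinitely many arcs are needed to separate \<open>u\<close> from \<open>w\<close>, then \<open>u\<close> should not be
  reachable from \<open>w\<close>. The relation \<open>\<Gamma>\<close> collects such pairs; they act as additional arcs that lie on
  no closed walk, again by compactness.

  Uncountable arc sets are split along a chain of sets closed under choosing small cuts. Whenever two
  vertices are joined too strongly inside a new part of the chain, the orientation of that part is
  made to forbid one direction, so that each cycle lies in one part; induction on the cardinality
  then leaves countable pieces, each cycle lying in one of them, and their reversion
  sequences are concatenated.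
\<close>

section \<open>Simple paths in a relation\<close>

text \<open>The target orientation is therefore fixed before any flip, and each of its cycles must
  lie in one countable piece. Colouring and edge-connectivity can then be checked piece by piece,
  since both are decided by cycles.

  The obstacle to gluing is that two vertices of an early part may be joined again by a part added
  later, which creates cycles through both parts. \<Gamma> anticipates this: it holds the
  connections that later parts are allowed to make, all in the direction of one fixed linear order,
  and each part is oriented as if they were already present. Such connections arise only where every
  separating cut is large; small cuts are complete at an early stage and block all later
  arcs.\<close>

lemma rtrancl_leaves:
  assumes "(x, y) \<in> R\<^sup>*" "x \<in> X" "y \<notin> X"
  obtains a b where "(x, a) \<in> R\<^sup>*" "(a, b) \<in> R" "(b, y) \<in> R\<^sup>*" "a \<in> X" "b \<notin> X"
proof -
  have "\<exists>a b. (x, a) \<in> R\<^sup>* \<and> (a, b) \<in> R \<and> (b, y) \<in> R\<^sup>* \<and> a \<in> X \<and> b \<notin> X"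
    using assms
  proof (induction rule: converse_rtrancl_induct)
    case (step x z)
    show ?case
    proof (cases "z \<in> X")
      case True
      with step obtain a b where "(z, a) \<in> R\<^sup>*" "(a, b) \<in> R" "(b, y) \<in> R\<^sup>*" "a \<in> X" "b \<notin> X"
        by blast
      with step.hyps(1) show ?thesis by (meson converse_rtrancl_into_rtrancl)
    qed (use step in blast)
  qed simp
  with that show thesis by blast
qed

lemma rtrancl_simple_path:
  assumes "(x, y) \<in> R\<^sup>*"
  shows "\<exists>xs. xs \<noteq> [] \<and> hd xs = x \<and> last xs = y \<and> distinct xs \<and>
    successively (\<lambda>a b. (a, b) \<in> R) xs"
  using assms
proof (induction rule: converse_rtrancl_induct)
  case base
  show ?case by (rule exI[of _ "[y]"]) simp
next
  case (step x z)
  then obtain xs where xs: "xs \<noteq> []" "hd xs = z" "last xs = y" "distinct xs"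
    "successively (\<lambda>a b. (a, b) \<in> R) xs" by blast
  show ?case
  proof (cases "x \<in> set xs")
    case True
    then obtain ys zs where "xs = ys @ x # zs" by (auto simp: in_set_conv_decomp)
    with xs show ?thesis
      by (intro exI[of _ "x # zs"]) (auto simp: successively_append_iff)
  next
    case False
    with xs step show ?thesis
      by (intro exI[of _ "x # xs"]) (auto simp: successively_Cons)
  qed
qed

section \<open>Reorientations as sets of flipped arcs\<close>

locale flips =
  fixes t h :: "'e \<Rightarrow> 'v"
begin

definition ft :: "'e set \<Rightarrow> 'e \<Rightarrow> 'v" where
  "ft F e = (if e \<in> F then h e else t e)"

definition fh :: "'e set \<Rightarrow> 'e \<Rightarrow> 'v" where
  "fh F e = (if e \<in> F then t e else h e)"

definition out :: "'e set \<Rightarrow> 'e set \<Rightarrow> 'v set \<Rightarrow> 'e set" where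
  "out F E X = {e \<in> E. ft F e \<in> X \<and> fh F e \<notin> X}"

definition adj :: "'e set \<Rightarrow> 'e set \<Rightarrow> 'v rel" where
  "adj F E = (\<lambda>e. (ft F e, fh F e)) ` E"

definition ends :: "'e set \<Rightarrow> 'v set" where
  "ends E = t ` E \<union> h ` E"

text \<open>An inequality, because only finitely many flips preserve finite cuts: a limit can push
  an arc of an out-cut off to infinity. Conversely, finitely many arcs that leave \<open>X\<close>
  in the limit all leave it at some earlier stage, so no finite cut grows.\<close>

definition below :: "'e set \<Rightarrow> 'e set \<Rightarrow> 'e set \<Rightarrow> bool" where
  "below E F' F \<longleftrightarrow> (\<forall>X. finite (out F E X) \<longrightarrow>
     finite (out F' E X) \<and> card (out F' E X) \<le> card (out F E X))"

text \<open>No first vertex is singled out, so rotations stay cycles, and a vertex function has the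
  same sum over the heads as over the tails.\<close>

definition cyc :: "'e set \<Rightarrow> 'e list \<Rightarrow> bool" where
  "cyc F p \<longleftrightarrow> p \<noteq> [] \<and> distinct (map (ft F) p) \<and> map (fh F) p = rotate1 (map (ft F) p)"

lemma ft_in_ends: "e \<in> E \<Longrightarrow> ft F e \<in> ends E" and fh_in_ends: "e \<in> E \<Longrightarrow> fh F e \<in> ends E"
  by (auto simp: ft_def fh_def ends_def)

lemma ends_mono: "A \<subseteq> B \<Longrightarrow> ends A \<subseteq> ends B"
  by (auto simp: ends_def)

lemma adj_ends: "(x, y) \<in> adj F E \<Longrightarrow> x \<in> ends E \<and> y \<in> ends E"
  by (auto simp: adj_def ft_in_ends fh_in_ends)

lemma adj_mono: "A \<subseteq> B \<Longrightarrow> adj F A \<subseteq> adj F B"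
  by (auto simp: adj_def)

lemma adjI: "e \<in> E \<Longrightarrow> (ft F e, fh F e) \<in> adj F E"
  by (auto simp: adj_def)

lemma adj_Un: "adj F (A \<union> B) = adj F A \<union> adj F B"
  by (auto simp: adj_def)

lemma adj_cong: "F \<inter> E = F' \<inter> E \<Longrightarrow> adj F E = adj F' E"
  unfolding adj_def by (intro image_cong refl) (auto simp: ft_def fh_def)

lemma out_cong: "F \<inter> E = F' \<inter> E \<Longrightarrow> out F E X = out F' E X"
  unfolding out_def ft_def fh_def by auto

text \<open>Only the flips inside \<open>E\<close> matter, which allows orientations chosen on
  disjoint pieces to be united.\<close>

lemma below_cong:
  assumes "F \<inter> E = G \<inter> E" "F' \<inter> E = G' \<inter> E"
  shows "below E F' F \<longleftrightarrow> below E G' G"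
  unfolding below_def out_cong[OF assms(1)] out_cong[OF assms(2)] by simp

lemma cyc_cong:
  assumes "F \<inter> set p = F' \<inter> set p"
  shows "cyc F p \<longleftrightarrow> cyc F' p"
proof -
  have "map (ft F) p = map (ft F') p" "map (fh F) p = map (fh F') p"
    using assms by (auto simp: ft_def fh_def)
  then show ?thesis unfolding cyc_def by metis
qed

lemma out_mono: "A \<subseteq> B \<Longrightarrow> out F A X \<subseteq> out F B X"
  by (auto simp: out_def)

lemma below_refl: "below E F F"
  by (simp add: below_def)

lemma below_trans: "below E A B \<Longrightarrow> below E B C \<Longrightarrow> below E A C"
  unfolding below_def by (meson order_trans)

lemma adj_closed:
  assumes "(x, y) \<in> (adj F E)\<^sup>*" "out F E X = {}" "x \<in> X"
  shows "y \<in> X"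
  using assms
proof (induction rule: rtrancl_induct)
  case (step y z)
  then show ?case by (auto simp: adj_def out_def)
qed

lemma out_reach: "out F E {z. (x, z) \<in> (adj F E)\<^sup>*} = {}"
  by (auto simp: out_def dest: adjI[of _ E F] intro: rtrancl_into_rtrancl)

lemma below_out_empty:
  assumes "below E F' F" "out F E X = {}"
  shows "out F' E X = {}"
proof -
  have "finite (out F' E X) \<and> card (out F' E X) \<le> card (out F E X)"
    by (rule assms(1)[unfolded below_def, THEN spec, THEN mp]) (simp add: assms(2))
  with assms(2) show ?thesis by (auto simp: card_eq_0_iff)
qed

text \<open>The set reached from \<open>x\<close> under \<open>F\<close> has no outgoing arc, and an
  empty out-cut stays empty. So passing below can only destroy reachability.\<close>

lemma below_reach:
  assumes "below E F' F" "(x, y) \<in> (adj F' E)\<^sup>*"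
  shows "(x, y) \<in> (adj F E)\<^sup>*"
proof -
  let ?X = "{z. (x, z) \<in> (adj F E)\<^sup>*}"
  have "y \<in> ?X"
    by (rule adj_closed[OF assms(2) below_out_empty[OF assms(1) out_reach]]) simp
  then show ?thesis by simp
qed

lemma path_arcs:
  assumes "(x, y) \<in> (adj F E)\<^sup>*"
  obtains xs p where "xs \<noteq> []" "hd xs = x" "last xs = y" "distinct xs" "set p \<subseteq> E"
    "map (ft F) p = butlast xs" "map (fh F) p = tl xs"
proof -
  obtain xs where xs: "xs \<noteq> []" "hd xs = x" "last xs = y" "distinct xs"
    "successively (\<lambda>a b. (a, b) \<in> adj F E) xs"
    using rtrancl_simple_path[OF assms] by blast
  have "\<exists>p. set p \<subseteq> E \<and> map (ft F) p = butlast xs \<and> map (fh F) p = tl xs"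
    using xs(1,5)
  proof (induction xs)
    case (Cons a xs)
    show ?case
    proof (cases xs)
      case Nil
      then show ?thesis by (intro exI[of _ "[]"]) simp
    next
      case (Cons b ys)
      with Cons.IH Cons.prems obtain p where p: "set p \<subseteq> E" "map (ft F) p = butlast xs"
        "map (fh F) p = tl xs" by auto
      from Cons Cons.prems obtain e where "e \<in> E" "ft F e = a" "fh F e = b"
        by (auto simp: adj_def)
      with p Cons show ?thesis by (intro exI[of _ "e # p"]) auto
    qed
  qed simp
  with xs that show thesis by blast
qed

text \<open>The return walk is shortened to a simple path; the tail of \<open>e\<close> is its last
  vertex, the only one that is not a tail of the path.\<close>

lemma cyc_through_arc:
  assumes "e \<in> E" "(fh F e, ft F e) \<in> (adj F E)\<^sup>*"
  obtains p where "cyc F p" "e \<in> set p" "set p \<subseteq> E"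
proof -
  obtain xs p where p: "xs \<noteq> []" "hd xs = fh F e" "last xs = ft F e" "distinct xs" "set p \<subseteq> E"
    "map (ft F) p = butlast xs" "map (fh F) p = tl xs"
    using path_arcs[OF assms(2)] by metis
  have "cyc F (e # p)"
    unfolding cyc_def
  proof (intro conjI)
    have "xs = butlast xs @ [ft F e]" using p(1,3) by (metis append_butlast_last_id)
    then have *: "map (ft F) (e # p) = last xs # butlast xs" using p by simp
    from p(4) have "distinct (butlast xs @ [last xs])" using p(1) by simp
    then show "distinct (map (ft F) (e # p))" unfolding * by auto
    have "rotate1 (map (ft F) (e # p)) = xs" unfolding * using p(1) by simp
    then show "map (fh F) (e # p) = rotate1 (map (ft F) (e # p))"
      using p by (metis hd_Cons_tl list.simps(9))
  qed simp
  with that[of "e # p"] assms(1) p(5) show thesis by auto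
qed

section \<open>Circulations and finite cuts\<close>

lemma sum_cyc:
  fixes g :: "'v \<Rightarrow> 'a :: ab_group_add"
  assumes "cyc F p"
  shows "(\<Sum>e\<in>set p. g (fh F e) - g (ft F e)) = 0"
proof -
  have d: "distinct p" using assms unfolding cyc_def by (auto simp: distinct_map)
  have "(\<Sum>e\<in>set p. g (fh F e)) = sum_list (map g (map (fh F) p))"
    using d by (simp add: sum_list_distinct_conv_sum_set o_def)
  also have "\<dots> = sum_list (map g (rotate1 (map (ft F) p)))" using assms unfolding cyc_def by simp
  also have "\<dots> = sum_list (map g (map (ft F) p))"
    by (cases p) (simp_all add: add.commute)
  also have "\<dots> = (\<Sum>e\<in>set p. g (ft F e))"
    using d by (simp add: sum_list_distinct_conv_sum_set o_def)
  finally show ?thesis by (simp add: sum_subtractf)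
qed

lemma out_flip:
  assumes "Z \<subseteq> E"
  shows "out (sym_diff F Z) E X = (out F E X - out F Z X) \<union> {e \<in> Z. ft F e \<notin> X \<and> fh F e \<in> X}"
  using assms unfolding out_def ft_def fh_def by auto

text \<open>
  The pairs in \<open>M\<close> stand for connections that only infinite cuts separate; together with them, \<open>Z\<close>
  is a circulation.
\<close>

lemma below_flip:
  assumes Z: "finite Z" "Z \<subseteq> E"
    and M: "\<And>a b X. (a, b) \<in> set M \<Longrightarrow> a \<in> X \<Longrightarrow> b \<notin> X \<Longrightarrow> infinite (out F E X)"
    and circ: "\<And>g :: 'v \<Rightarrow> int. (\<Sum>e\<in>Z. g (fh F e) - g (ft F e)) + (\<Sum>(a, b)\<leftarrow>M. g b - g a) = 0"
  shows "below E (sym_diff F Z) F"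
  unfolding below_def
proof (intro allI impI)
  fix X assume fin: "finite (out F E X)"
  let ?in = "{e \<in> Z. ft F e \<notin> X \<and> fh F e \<in> X}"
  \<comment> \<open>For the indicator of \<open>X\<close> the circulation condition balances
    crossings. A pair of \<open>M\<close> may enter \<open>X\<close> but cannot leave it, as the cut
    is finite. Hence \<open>Z\<close> leaves \<open>X\<close> at least as often as it enters, and
    the flip exchanges these two sets of arcs.\<close>
  define g :: "'v \<Rightarrow> int" where "g = (\<lambda>x. of_bool (x \<in> X))"
  have "b \<in> X" if "(a, b) \<in> set M" "a \<in> X" for a b using M[OF that, of] fin by blast
  then have "0 \<le> (\<Sum>(a, b)\<leftarrow>M. g b - g a)"
    by (intro sum_list_nonneg) (auto simp: g_def)
  with circ[of g] have "(\<Sum>e\<in>Z. g (fh F e) - g (ft F e)) \<le> 0" by linarith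
  also have "(\<Sum>e\<in>Z. g (fh F e) - g (ft F e)) =
      (\<Sum>e\<in>Z. of_bool (e \<in> ?in)) - (\<Sum>e\<in>Z. of_bool (e \<in> out F Z X))"
    unfolding sum_subtractf[symmetric] by (rule sum.cong) (auto simp: g_def out_def)
  also have "\<dots> = int (card ?in) - int (card (out F Z X))"
  proof -
    have "Z \<inter> {e. e \<in> ?in} = ?in" "Z \<inter> {e. e \<in> out F Z X} = out F Z X" by (auto simp: out_def)
    then show ?thesis using Z(1) by (simp add: sum_of_bool_eq del: mem_Collect_eq)
  qed
  finally have le: "card ?in \<le> card (out F Z X)" by simp
  have sub: "out F Z X \<subseteq> out F E X" using Z(2) by (rule out_mono)
  have fo: "finite (out F Z X)" using fin sub finite_subset by blast
  have eq: "out (sym_diff F Z) E X = (out F E X - out F Z X) \<union> ?in"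
    by (rule out_flip[OF Z(2)])
  have "card (out (sym_diff F Z) E X) \<le> card (out F E X - out F Z X) + card ?in"
    unfolding eq by (rule card_Un_le)
  also have "card (out F E X - out F Z X) = card (out F E X) - card (out F Z X)"
    by (rule card_Diff_subset[OF fo sub])
  finally have "card (out (sym_diff F Z) E X) \<le> card (out F E X)"
    using le card_mono[OF fin sub] by linarith
  then show "finite (out (sym_diff F Z) E X) \<and>
      card (out (sym_diff F Z) E X) \<le> card (out F E X)"
    unfolding eq using fin Z(1) by auto
qed

lemma below_cyc:
  assumes "cyc F p" "set p \<subseteq> E"
  shows "below E (sym_diff F (set p)) F"
  by (rule below_flip[where M = "[]"]) (use assms sum_cyc in auto)

lemma cyc_rev:
  assumes "cyc F p"
  shows "\<And>g :: 'v \<Rightarrow> int. (\<Sum>e\<in>set p. g (fh (sym_diff F (set p)) e) - g (ft (sym_diff F (set p)) e)) = 0"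
proof -
  fix g :: "'v \<Rightarrow> int"
  have "(\<Sum>e\<in>set p. g (fh (sym_diff F (set p)) e) - g (ft (sym_diff F (set p)) e)) =
      (\<Sum>e\<in>set p. - (g (fh F e) - g (ft F e)))"
    by (rule sum.cong) (auto simp: ft_def fh_def)
  also have "\<dots> = 0" unfolding sum_negf using sum_cyc[OF assms, of g] by simp
  finally show "(\<Sum>e\<in>set p. g (fh (sym_diff F (set p)) e) - g (ft (sym_diff F (set p)) e)) = 0" .
qed

text \<open>The reversed cycle is a circulation as well, so flipping it back is also a step below.
  This direction carries \<open>below q F\<close> from one stage of a flip sequence to the
  next.\<close>

lemma below_cyc_rev:
  assumes "cyc F p" "set p \<subseteq> E"
  shows "below E F (sym_diff F (set p))"
proof -
  let ?G = "sym_diff F (set p)"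
  have "below E (sym_diff ?G (set p)) ?G"
    by (rule below_flip[where M = "[]"]) (use assms(2) cyc_rev[OF assms(1)] in auto)
  moreover have "sym_diff ?G (set p) = F" by auto
  ultimately show ?thesis by simp
qed

end

section \<open>Flipping a countable set of arcs\<close>

context flips
begin

text \<open>
  The arcs that must no longer be touched form a finite set on which the current orientation
  already agrees with the target, so a cut crossed outwards by frozen arcs only is finite, and
  an arc entering it that still has to be flipped would violate \<open>below q F\<close>.
\<close>

lemma unsettled_arc_on_cycle:
  assumes below: "below q F G" and e: "e \<in> q" "e \<in> F \<longleftrightarrow> e \<notin> G"
    and K: "finite K" "\<And>x. x \<in> K \<Longrightarrow> x \<in> F \<longleftrightarrow> x \<in> G"
  obtains p where "cyc G p" "e \<in> set p" "set p \<subseteq> q - K"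
proof -
  have eK: "e \<in> q - K" using e K(2) by blast
  define X where "X = {z. (fh G e, z) \<in> (adj G (q - K))\<^sup>*}"
  have "ft G e \<in> X"
  proof (rule ccontr)
    assume n: "ft G e \<notin> X"
    have "out G (q - K) X = {}" unfolding X_def by (rule out_reach)
    then have sub: "out G q X \<subseteq> K" by (auto simp: out_def)
    have fin: "finite (out G q X)" using sub K(1) finite_subset by blast
    have "out G q X \<subseteq> out F q X"
      using sub K(2) by (auto simp: out_def ft_def fh_def)
    moreover have "e \<in> out F q X" "e \<notin> out G q X"
      using n e by (auto simp: out_def ft_def fh_def X_def)
    ultimately have "out G q X \<subset> out F q X" by blast
    with below fin have "card (out G q X) < card (out F q X)" unfolding below_def by (blast intro: psubset_card_mono)
    with below fin show False unfolding below_def by (meson not_less)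
  qed
  then show thesis using cyc_through_arc[OF eK] that unfolding X_def by blast
qed

text \<open>An arc is frozen once it has been flipped into its target direction. So an arc of
  \<open>F\<close> is flipped once, and any other arc at most twice, away and back. An empty
  \<open>C n\<close> marks a stage at which nothing has to be done.\<close>

lemma countable_flip_sequence:
  assumes q: "countable q" "F \<subseteq> q" "below q F {}"
  obtains C :: "nat \<Rightarrow> 'e list" where
    "\<And>n. C n \<noteq> [] \<Longrightarrow> cyc {e. odd (card {m. m < n \<and> e \<in> set (C m)})} (C n)"
    "\<And>n. set (C n) \<subseteq> q"
    "\<And>e. finite {m. e \<in> set (C m)}" "\<And>e. card {m. e \<in> set (C m)} \<le> 2"
    "\<And>e. odd (card {m. e \<in> set (C m)}) \<longleftrightarrow> e \<in> F"
proof -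
  \<comment> \<open>For empty \<open>q\<close> this enumeration has values outside \<open>q\<close>,
    hence the guards \<open>en m \<in> q\<close> below.\<close>
  define en where "en = from_nat_into q"
  define odds where "odds c = {e. odd (c e)}" for c :: "'e \<Rightarrow> nat"
  \<comment> \<open>Dependent choice does not prescribe the first element, so the conjunct for
    \<open>n = 0\<close> pins the start to the unflipped state.\<close>
  define inv where "inv n c \<longleftrightarrow> finite {e. c e > 0} \<and> {e. c e > 0} \<subseteq> q \<and>
      (n = 0 \<longrightarrow> c = (\<lambda>_. 0)) \<and> (\<forall>e. c e \<le> (if e \<in> F then 1 else 2)) \<and> below q F (odds c) \<and>
      (\<forall>m<n. en m \<in> q \<longrightarrow> (odd (c (en m)) \<longleftrightarrow> en m \<in> F))" for n :: nat and c :: "'e \<Rightarrow> nat"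
  define frozen where "frozen n c = {e. (odd (c e) \<longleftrightarrow> e \<in> F) \<and> (c e > 0 \<or> e \<in> en ` {..<n})}"
    for n :: nat and c :: "'e \<Rightarrow> nat"
  define nxt where "nxt n c c' p \<longleftrightarrow> (p = [] \<or> cyc (odds c) p) \<and> set p \<subseteq> q \<and>
      c' = (\<lambda>e. c e + of_bool (e \<in> set p)) \<and> set p \<inter> frozen n c = {}"
    for n :: nat and c c' :: "'e \<Rightarrow> nat" and p
  have step: "\<exists>c'. inv (Suc n) c' \<and> (\<exists>p. nxt n c c' p)" if I: "inv n c" for n c
  proof -
    have "\<exists>p. (p = [] \<or> cyc (odds c) p) \<and> set p \<subseteq> q \<and> set p \<inter> frozen n c = {} \<and>
        (en n \<in> q \<longrightarrow> ((odd (c (en n)) \<longleftrightarrow> en n \<in> F) \<longleftrightarrow> en n \<notin> set p))"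
    proof (cases "en n \<in> q \<and> \<not> (odd (c (en n)) \<longleftrightarrow> en n \<in> F)")
      case True
      have "finite (frozen n c)"
        by (rule finite_subset[of _ "{e. c e > 0} \<union> en ` {..<n}"])
          (use I in \<open>auto simp: frozen_def inv_def\<close>)
      then obtain p where "cyc (odds c) p" "en n \<in> set p" "set p \<subseteq> q - frozen n c"
        using True I by (elim unsettled_arc_on_cycle[of q F "odds c" "en n" "frozen n c", rotated 3])
          (auto simp: inv_def odds_def frozen_def)
      with True show ?thesis by (intro exI[of _ p]) auto
    qed (intro exI[of _ "[]"], auto)
    then obtain p where p: "p = [] \<or> cyc (odds c) p" "set p \<subseteq> q" "set p \<inter> frozen n c = {}"
      "en n \<in> q \<longrightarrow> ((odd (c (en n)) \<longleftrightarrow> en n \<in> F) \<longleftrightarrow> en n \<notin> set p)" by blast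
    define c' where "c' = (\<lambda>e. c e + of_bool (e \<in> set p))"
    have unf: "c e = 0 \<or> (odd (c e) \<longleftrightarrow> e \<notin> F)" if "e \<in> set p" for e
      using that p(3) unfolding frozen_def by auto
    have nfr: "en m \<notin> set p" if "m < n" "en m \<in> q" for m
      using that p(3) I unfolding frozen_def inv_def by auto
    have le: "c e \<le> (if e \<in> F then 1 else 2)" for e using I unfolding inv_def by blast
    have odds': "odds c' = sym_diff (odds c) (set p)" by (auto simp: odds_def c'_def)
    have "inv (Suc n) c'"
      unfolding inv_def
    proof (intro conjI allI impI)
      have sub: "{e. c' e > 0} \<subseteq> {e. c e > 0} \<union> set p" by (auto simp: c'_def)
      then show "finite {e. c' e > 0}" "{e. c' e > 0} \<subseteq> q"
        using I p(2) unfolding inv_def by (auto intro: finite_subset)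
      show "c' e \<le> (if e \<in> F then 1 else 2)" for e
      proof (cases "e \<in> set p")
        case True
        with unf[OF this] le[of e] show ?thesis
          by (cases "e \<in> F"; cases "c e = 2"; cases "c e = 0") (auto simp: c'_def le_Suc_eq)
      qed (use le[of e] in \<open>auto simp: c'_def\<close>)
      have "below q (odds c) (odds c')"
        using p(1,2) below_cyc_rev[of "odds c" p q] unfolding odds' by (auto simp: below_refl)
      then show "below q F (odds c')" using I below_trans unfolding inv_def by blast
      show "odd (c' (en m)) \<longleftrightarrow> en m \<in> F" if m: "m < Suc n" "en m \<in> q" for m
      proof (cases "m < n")
        case True
        with nfr[OF this m(2)] I m show ?thesis by (auto simp: c'_def inv_def)
      next
        case False
        then have "m = n" using m by simp
        then show ?thesis using p(4) m by (auto simp: c'_def)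
      qed
    qed simp
    with p show ?thesis unfolding nxt_def c'_def by blast
  qed
  have "inv 0 (\<lambda>_. 0)" using q(3) by (simp add: inv_def odds_def)
  then have "\<exists>f. \<forall>n. inv n (f n) \<and> (\<exists>p. nxt n (f n) (f (Suc n)) p)"
    using dependent_nat_choice[of inv "\<lambda>n c c'. \<exists>p. nxt n c c' p"] step by blast
  then obtain f where f: "\<And>n. inv n (f n)" "\<And>n. \<exists>p. nxt n (f n) (f (Suc n)) p" by blast
  from f(2) obtain C where C: "\<And>n. nxt n (f n) (f (Suc n)) (C n)" by metis
  have f0: "f 0 = (\<lambda>_. 0)" using f(1)[of 0] unfolding inv_def by blast
  have cnt: "f n e = card {m. m < n \<and> e \<in> set (C m)}" for n e
  proof (induction n)
    case (Suc n)
    have "{m. m < Suc n \<and> e \<in> set (C m)} =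
        (if e \<in> set (C n) then insert n {m. m < n \<and> e \<in> set (C m)} else {m. m < n \<and> e \<in> set (C m)})"
      by (auto simp: less_Suc_eq)
    with Suc C[of n] show ?case by (auto simp: nxt_def)
  qed (simp add: f0)
  \<comment> \<open>After stage \<open>n\<close> the \<open>n\<close>-th arc is frozen for good and
    no further cycle uses it, so its limit count is already its count at a finite stage.\<close>
  have settled: "\<exists>k. {m. e \<in> set (C m)} = {m. m < k \<and> e \<in> set (C m)} \<and> (odd (f k e) \<longleftrightarrow> e \<in> F)" for e
  proof (cases "e \<in> q")
    case True
    then obtain n where n: "en n = e" unfolding en_def using q(1) from_nat_into_surj by metis
    have odd: "odd (f k e) \<longleftrightarrow> e \<in> F" if "n < k" for k
      using f(1)[of k] that True n unfolding inv_def by blast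
    have "e \<notin> set (C m)" if "n < m" for m
      using C[of m] odd[OF that] n that unfolding nxt_def frozen_def by blast
    then have "{m. e \<in> set (C m)} = {m. m < Suc n \<and> e \<in> set (C m)}"
      by (auto simp: less_Suc_eq_le not_less[symmetric])
    with odd[of "Suc n"] show ?thesis by blast
  next
    case False
    then have "e \<notin> set (C m)" for m using C[of m] unfolding nxt_def by blast
    with False q(2) show ?thesis by (intro exI[of _ 0]) (auto simp: f0)
  qed
  show thesis
  proof (rule that)
    show "cyc {e. odd (card {m. m < n \<and> e \<in> set (C m)})} (C n)" if "C n \<noteq> []" for n
      using C[of n] that unfolding nxt_def odds_def cnt by blast
    show "set (C n) \<subseteq> q" for n using C[of n] unfolding nxt_def by blast
    fix e
    obtain k where k: "{m. e \<in> set (C m)} = {m. m < k \<and> e \<in> set (C m)}" "odd (f k e) \<longleftrightarrow> e \<in> F"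
      using settled by blast
    then show "finite {m. e \<in> set (C m)}" "odd (card {m. e \<in> set (C m)}) \<longleftrightarrow> e \<in> F"
      unfolding cnt k(1) by auto
    have "f k e \<le> 2" using f(1)[of k] unfolding inv_def by (metis le_SucI numeral_2_eq_2 One_nat_def order.refl)
    then show "card {m. e \<in> set (C m)} \<le> 2" unfolding cnt k(1) .
  qed
qed

end

section \<open>Compactness\<close>

text \<open>Sets are points of the Cantor cube over \<open>'e\<close>, which is compact by
  Tychonoff. A condition that inspects finitely many elements defines a clopen subset.\<close>

lemma set_compactness:
  fixes c :: "'i \<Rightarrow> 'e set \<Rightarrow> bool"
  assumes supp: "\<And>i. i \<in> I \<Longrightarrow> \<exists>T. finite T \<and> (\<forall>F F'. F \<inter> T = F' \<inter> T \<longrightarrow> c i F = c i F')"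
    and fin: "\<And>J. finite J \<Longrightarrow> J \<subseteq> I \<Longrightarrow> \<exists>F. \<forall>i\<in>J. c i F"
  shows "\<exists>F. \<forall>i\<in>I. c i F"
proof -
  define X :: "('e \<Rightarrow> bool) topology" where "X = product_topology (\<lambda>_. discrete_topology UNIV) UNIV"
  have top: "topspace X = UNIV" by (simp add: X_def)
  have comp: "compact_space X"
    unfolding X_def compact_space_product_topology by (simp add: compact_space_discrete_topology)
  define S where "S i = {f. c i (Collect f)}" for i
  have op: "openin X {f. P (Collect f)}"
    if T: "finite T" "\<forall>F F'. F \<inter> T = F' \<inter> T \<longrightarrow> P F = P F'" for P :: "'e set \<Rightarrow> bool" and T
  proof -
    have "\<exists>U. openin X U \<and> f \<in> U \<and> U \<subseteq> {f. P (Collect f)}" if "P (Collect f)" for f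
    proof (intro exI conjI)
      let ?U = "\<Pi>\<^sub>E i\<in>UNIV. if i \<in> T then {f i} else UNIV"
      show "openin X ?U" unfolding X_def
      proof (rule product_topology_basis)
        show "finite {i. (if i \<in> T then {f i} else UNIV) \<noteq> topspace (discrete_topology UNIV)}"
          by (rule finite_subset[OF _ T(1)]) auto
      qed simp
      show "f \<in> ?U" by auto
      show "?U \<subseteq> {f. P (Collect f)}"
      proof
        fix g assume "g \<in> ?U"
        then have "g i \<in> (if i \<in> T then {f i} else UNIV)" for i by (rule PiE_mem) simp
        then have "g i = f i" if "i \<in> T" for i using that by (metis singletonD)
        then have "Collect g \<inter> T = Collect f \<inter> T" by auto
        then have "P (Collect g) = P (Collect f)" by (rule T(2)[rule_format])
        with \<open>P (Collect f)\<close> show "g \<in> {f. P (Collect f)}" by simp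
      qed
    qed
    then show ?thesis unfolding openin_subopen[of X "{f. P (Collect f)}"] by simp
  qed
  have cl: "closedin X (S i)" if "i \<in> I" for i
  proof -
    obtain T where T: "finite T" "\<forall>F F'. F \<inter> T = F' \<inter> T \<longrightarrow> c i F = c i F'"
      using supp[OF \<open>i \<in> I\<close>] by (elim exE conjE)
    have "\<forall>F F'. F \<inter> T = F' \<inter> T \<longrightarrow> (\<not> c i F) = (\<not> c i F')"
      by (intro allI impI arg_cong[where f = Not] T(2)[rule_format])
    then have "openin X {f. \<not> c i (Collect f)}" by (rule op[OF T(1), of "\<lambda>F. \<not> c i F"])
    moreover have "topspace X - S i = {f. \<not> c i (Collect f)}" by (auto simp: S_def top)
    ultimately show ?thesis by (simp add: closedin_def top)
  qed
  have "\<Inter>G \<noteq> {}" if G: "finite G" "G \<subseteq> S ` I" for G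
  proof -
    obtain J where J: "finite J" "J \<subseteq> I" "G = S ` J" using G by (meson finite_subset_image)
    obtain F where "\<forall>i\<in>J. c i F" using fin[OF J(1,2)] by blast
    then have "(\<lambda>e. e \<in> F) \<in> \<Inter>G" unfolding J(3) S_def by simp
    then show ?thesis by blast
  qed
  then have "\<forall>G. finite G \<and> G \<subseteq> S ` I \<longrightarrow> \<Inter>G \<noteq> {}" by simp
  moreover have "\<forall>C\<in>S ` I. closedin X C" using cl by simp
  ultimately have "\<Inter> (S ` I) \<noteq> {}"
    by (intro comp[unfolded compact_space_fip, THEN spec, of "S ` I", THEN mp] conjI)
  then show ?thesis unfolding S_def by blast
qed

context flips
begin

text \<open>A cut that grew would contain a finite set \<open>A\<close> with one arc more than the
  old cut. This splits \<open>below\<close> into conditions on \<open>F'\<close> that inspect one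
  finite set each, the form to which compactness applies.\<close>

lemma below_iff_finite:
  "below E F' F \<longleftrightarrow> (\<forall>X A. finite (out F E X) \<longrightarrow> finite A \<longrightarrow>
     card A = Suc (card (out F E X)) \<longrightarrow> \<not> A \<subseteq> out F' E X)"
proof
  assume "below E F' F"
  then show "\<forall>X A. finite (out F E X) \<longrightarrow> finite A \<longrightarrow>
     card A = Suc (card (out F E X)) \<longrightarrow> \<not> A \<subseteq> out F' E X"
    unfolding below_def by (metis card_mono not_less_eq_eq order_trans)
next
  assume *: "\<forall>X A. finite (out F E X) \<longrightarrow> finite A \<longrightarrow>
     card A = Suc (card (out F E X)) \<longrightarrow> \<not> A \<subseteq> out F' E X"
  show "below E F' F"
    unfolding below_def
  proof (intro allI impI)
    fix X assume fin: "finite (out F E X)"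
    have "\<not> (infinite (out F' E X) \<or> card (out F' E X) > card (out F E X))"
    proof
      assume "infinite (out F' E X) \<or> card (out F' E X) > card (out F E X)"
      then obtain A where "finite A" "card A = Suc (card (out F E X))" "A \<subseteq> out F' E X"
        by (metis Suc_leI infinite_arbitrarily_large obtain_subset_with_card_n)
      with * fin show False by blast
    qed
    then show "finite (out F' E X) \<and> card (out F' E X) \<le> card (out F E X)" by auto
  qed
qed

text \<open>The index set is a sum: \<open>Inl\<close> for the given conditions, \<open>Inr\<close>
  for the tests by finite sets \<open>A\<close> into which each upper bound from \<G> is
  split.\<close>

lemma below_compactness:
  fixes c :: "'i \<Rightarrow> 'e set \<Rightarrow> bool"
  assumes supp: "\<And>i. i \<in> I \<Longrightarrow> \<exists>T. finite T \<and> (\<forall>F F'. F \<inter> T = F' \<inter> T \<longrightarrow> c i F = c i F')"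
    and fin: "\<And>J \<G>'. finite J \<Longrightarrow> J \<subseteq> I \<Longrightarrow> finite \<G>' \<Longrightarrow> \<G>' \<subseteq> \<G> \<Longrightarrow>
      \<exists>F. (\<forall>G\<in>\<G>'. below E F G) \<and> (\<forall>i\<in>J. c i F)"
  shows "\<exists>F. (\<forall>G\<in>\<G>. below E F G) \<and> (\<forall>i\<in>I. c i F)"
proof -
  define C where "C = case_sum c (\<lambda>(G :: 'e set, X, A) F. \<not> A \<subseteq> out F E X)"
  define B where "B = {(G, X, A :: 'e set). G \<in> \<G> \<and> finite (out G E X) \<and> finite A \<and> card A = Suc (card (out G E X))}"
  have "\<exists>F. \<forall>i\<in>Inl ` I \<union> Inr ` B. C i F"
  proof (rule set_compactness)
    fix i assume "i \<in> Inl ` I \<union> Inr ` B"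
    then show "\<exists>T. finite T \<and> (\<forall>F F'. F \<inter> T = F' \<inter> T \<longrightarrow> C i F = C i F')"
    proof
      assume "i \<in> Inl ` I"
      then show ?thesis using supp unfolding C_def by auto
    next
      assume "i \<in> Inr ` B"
      then obtain G X A where i: "i = Inr (G, X, A)" "finite A" unfolding B_def by blast
      have "C i F = C i F'" if "F \<inter> A = F' \<inter> A" for F F'
      proof -
        have "ft F e = ft F' e" "fh F e = fh F' e" if "e \<in> A" for e
          using that \<open>F \<inter> A = F' \<inter> A\<close> by (auto simp: ft_def fh_def)
        then show ?thesis unfolding i(1) C_def out_def by (auto simp: subset_iff)
      qed
      with i(2) show ?thesis by (intro exI[of _ A] conjI allI impI)
    qed
  next
    fix J assume J: "finite J" "J \<subseteq> Inl ` I \<union> Inr ` B"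
    have fins: "finite (Inl -` J)" "finite (fst ` (Inr -` J))"
      using J(1) by (auto intro!: finite_vimageI finite_imageI)
    have subs: "Inl -` J \<subseteq> I" "fst ` (Inr -` J) \<subseteq> \<G>" using J(2) by (auto simp: B_def)
    obtain F where F: "\<forall>G\<in>fst ` (Inr -` J). below E F G" "\<forall>i\<in>Inl -` J. c i F"
      using fin[OF fins(1) subs(1) fins(2) subs(2)] by (elim exE conjE)
    have "C i F" if i: "i \<in> J" for i
    proof (cases i)
      case (Inl j)
      with F(2) i show ?thesis by (simp add: C_def)
    next
      case (Inr b)
      then obtain G X A where b: "i = Inr (G, X, A)" by (cases b) auto
      have "below E F G" using F(1) i b by force
      moreover have "finite (out G E X)" "finite A" "card A = Suc (card (out G E X))"
        using J(2) i b by (auto simp: B_def)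
      ultimately show ?thesis unfolding b C_def below_iff_finite by simp
    qed
    then show "\<exists>F. \<forall>i\<in>J. C i F" by blast
  qed
  then obtain F where F: "\<forall>i\<in>Inl ` I \<union> Inr ` B. C i F" by blast
  have "below E F G" if "G \<in> \<G>" for G
    unfolding below_iff_finite
  proof (intro allI impI)
    fix X and A :: "'e set" assume "finite (out G E X)" "finite A" "card A = Suc (card (out G E X))"
    with that have "(G, X, A) \<in> B" unfolding B_def by blast
    with F have "C (Inr (G, X, A)) F" by blast
    then show "\<not> A \<subseteq> out F E X" by (simp add: C_def)
  qed
  moreover have "c i F" if "i \<in> I" for i
  proof -
    have "C (Inl i) F" using F that by blast
    then show ?thesis by (simp add: C_def)
  qed
  ultimately show ?thesis by blast
qed

section \<open>Destroying closed walks through inseparable pairs\<close>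

text \<open>On a simple path no arc is repeated, so the arcs can be collected in a set
  \<open>Z\<close>, and vertex functions telescope over \<open>Z\<close> and
  \<open>M\<close>.\<close>

lemma circulation:
  assumes "(x, y) \<in> (adj F E \<union> \<Gamma>)\<^sup>*"
  shows "\<exists>Z M. finite Z \<and> Z \<subseteq> E \<and> set M \<subseteq> \<Gamma> \<and> (\<forall>g :: 'v \<Rightarrow> int.
    (\<Sum>e\<in>Z. g (fh F e) - g (ft F e)) + (\<Sum>(a, b)\<leftarrow>M. g b - g a) = g y - g x)"
proof -
  obtain xs where xs: "xs \<noteq> []" "hd xs = x" "last xs = y" "distinct xs"
    "successively (\<lambda>a b. (a, b) \<in> adj F E \<union> \<Gamma>) xs"
    using rtrancl_simple_path[OF assms] by blast
  \<comment> \<open>The clause on the tails of \<open>Z\<close> ensures that an arc prepended at a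
    new vertex is not yet in \<open>Z\<close>.\<close>
  have "\<exists>Z M. finite Z \<and> Z \<subseteq> E \<and> set M \<subseteq> \<Gamma> \<and> ft F ` Z \<subseteq> set xs \<and>
    (\<forall>g :: 'v \<Rightarrow> int. (\<Sum>e\<in>Z. g (fh F e) - g (ft F e)) + (\<Sum>(a, b)\<leftarrow>M. g b - g a) = g (last xs) - g (hd xs))"
    using xs(1,4,5)
  proof (induction xs)
    case (Cons a xs)
    show ?case
    proof (cases xs)
      case Nil
      then show ?thesis by (intro exI[of _ "{}"] exI[of _ "[]"]) simp
    next
      case (Cons b ys)
      with Cons.IH Cons.prems obtain Z M where ZM: "finite Z" "Z \<subseteq> E" "set M \<subseteq> \<Gamma>" "ft F ` Z \<subseteq> set xs"
        "\<And>g :: 'v \<Rightarrow> int. (\<Sum>e\<in>Z. g (fh F e) - g (ft F e)) + (\<Sum>(a, b)\<leftarrow>M. g b - g a) = g (last xs) - g b"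
        by auto
      have "(a, b) \<in> adj F E \<or> (a, b) \<in> \<Gamma>" using Cons.prems Cons by auto
      then show ?thesis
      proof
        assume "(a, b) \<in> adj F E"
        then obtain e where e: "e \<in> E" "ft F e = a" "fh F e = b" by (auto simp: adj_def)
        then have "e \<notin> Z" using ZM(4) Cons.prems by auto
        with ZM e Cons show ?thesis by (intro exI[of _ "insert e Z"] exI[of _ M]) (auto simp: add.assoc)
      next
        assume "(a, b) \<in> \<Gamma>"
        with ZM Cons show ?thesis by (intro exI[of _ Z] exI[of _ "(a, b) # M"]) (auto simp: algebra_simps)
      qed
    qed
  qed simp
  then show ?thesis unfolding xs(2,3) by blast
qed

lemma adj_rtrancl_finite:
  assumes "(x, y) \<in> (adj F E \<union> \<Gamma>)\<^sup>*"
  obtains T where "finite T" "T \<subseteq> E" "(x, y) \<in> (adj F T \<union> \<Gamma>)\<^sup>*"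
proof -
  have "\<exists>T. finite T \<and> T \<subseteq> E \<and> (x, y) \<in> (adj F T \<union> \<Gamma>)\<^sup>*"
    using assms
  proof (induction rule: rtrancl_induct)
    case (step y z)
    then obtain T where T: "finite T" "T \<subseteq> E" "(x, y) \<in> (adj F T \<union> \<Gamma>)\<^sup>*" by blast
    from step(2) show ?case
    proof
      assume "(y, z) \<in> adj F E"
      then obtain e where e: "e \<in> E" "(y, z) = (ft F e, fh F e)" by (auto simp: adj_def)
      have "(x, y) \<in> (adj F (insert e T) \<union> \<Gamma>)\<^sup>*"
        using T(3) rtrancl_mono[of "adj F T \<union> \<Gamma>" "adj F (insert e T) \<union> \<Gamma>"] by (auto simp: adj_def)
      moreover have "(y, z) \<in> adj F (insert e T)" using e by (auto simp: adj_def)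
      ultimately show ?thesis using T e by (intro exI[of _ "insert e T"]) (auto intro: rtrancl_into_rtrancl)
    qed (use T in \<open>meson UnI2 rtrancl_into_rtrancl\<close>)
  qed (auto intro: exI[of _ "{}"])
  with that show thesis by blast
qed

text \<open>
  Among the orientations obtained by finitely many flips, one that minimises the sum of \<open>\<rho>\<close> over
  the tails of \<open>T\<close> contains no forbidden closed walk inside \<open>T\<close>: reversing its arcs would
  decrease that sum, because \<open>\<rho>\<close> increases along \<open>\<Gamma>\<close>.
\<close>

lemma destroy_closed_walks_finite:
  assumes \<Gamma>: "trans \<Gamma>" "irrefl \<Gamma>"
    and inf: "\<And>a b X. (a, b) \<in> \<Gamma> \<Longrightarrow> a \<in> X \<Longrightarrow> b \<notin> X \<Longrightarrow> infinite (out F0 E X)"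
    and T: "finite T" "T \<subseteq> E"
  shows "\<exists>F. below E F F0 \<and> (\<forall>(a, b)\<in>\<Gamma>. (b, a) \<notin> (adj F T \<union> \<Gamma>)\<^sup>*)"
proof -
  \<comment> \<open>The number of predecessors in a finite \<open>W\<close> is the rank in question.
    Transitivity makes it weakly increasing along \<Gamma>; it increases strictly from points of
    \<open>W\<close>, which precede \<open>b\<close> but not themselves.\<close>
  have mono: "card {y \<in> W. (y, a) \<in> \<Gamma>} \<le> card {y \<in> W. (y, b) \<in> \<Gamma>}"
    and strict: "a \<in> W \<Longrightarrow> card {y \<in> W. (y, a) \<in> \<Gamma>} < card {y \<in> W. (y, b) \<in> \<Gamma>}"
    if "finite W" "(a, b) \<in> \<Gamma>" for W a b
  proof -
    have sub: "{y \<in> W. (y, a) \<in> \<Gamma>} \<subseteq> {y \<in> W. (y, b) \<in> \<Gamma>}"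
      using that(2) \<Gamma>(1) by (auto dest: transD)
    show "card {y \<in> W. (y, a) \<in> \<Gamma>} \<le> card {y \<in> W. (y, b) \<in> \<Gamma>}"
      using that(1) sub by (intro card_mono) auto
    assume "a \<in> W"
    then have "{y \<in> W. (y, a) \<in> \<Gamma>} \<subset> {y \<in> W. (y, b) \<in> \<Gamma>}"
      using sub that(2) \<Gamma>(2) by (auto simp: irrefl_def)
    then show "card {y \<in> W. (y, a) \<in> \<Gamma>} < card {y \<in> W. (y, b) \<in> \<Gamma>}"
      using that(1) by (intro psubset_card_mono) auto
  qed
  define W where "W = ends T"
  have W: "finite W" using T(1) by (simp add: W_def ends_def)
  define \<rho> where "\<rho> x = card {y \<in> W. (y, x) \<in> \<Gamma>}" for x
  \<comment> \<open>The cuts of \<Gamma> are kept infinite, as \<open>below_flip\<close> requires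
    for the flip of the minimal orientation; flips of finite sets respect this.\<close>
  define P where "P F \<longleftrightarrow> below E F F0 \<and>
    (\<forall>a b X. (a, b) \<in> \<Gamma> \<longrightarrow> a \<in> X \<longrightarrow> b \<notin> X \<longrightarrow> infinite (out F E X))" for F
  define \<Phi> where "\<Phi> F = (\<Sum>e\<in>T. \<rho> (ft F e))" for F
  have "P F0" using inf by (simp add: P_def below_refl)
  then obtain F where F: "P F" and min: "\<And>F'. P F' \<Longrightarrow> \<Phi> F \<le> \<Phi> F'"
    using ex_has_least_nat[of P F0 \<Phi>] by blast
  have "(b, a) \<notin> (adj F T \<union> \<Gamma>)\<^sup>*" if ab: "(a, b) \<in> \<Gamma>" for a b
  proof
    assume "(b, a) \<in> (adj F T \<union> \<Gamma>)\<^sup>*"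
    then obtain Z M' where Z: "finite Z" "Z \<subseteq> T" "set M' \<subseteq> \<Gamma>"
      and circ': "\<And>g :: 'v \<Rightarrow> int. (\<Sum>e\<in>Z. g (fh F e) - g (ft F e)) + (\<Sum>(a, b)\<leftarrow>M'. g b - g a) = g a - g b"
      by (elim circulation[THEN exE] exE conjE) simp
    \<comment> \<open>Adding the pair \<open>(a, b)\<close> closes the walk.\<close>
    define M where "M = (a, b) # M'"
    have M: "set M \<subseteq> \<Gamma>" "M \<noteq> []" using Z(3) ab by (auto simp: M_def)
    have circ: "(\<Sum>e\<in>Z. g (fh F e) - g (ft F e)) + (\<Sum>(a, b)\<leftarrow>M. g b - g a) = 0" for g :: "'v \<Rightarrow> int"
      using circ'[of g] by (simp add: M_def)
    have ZW: "ft F e \<in> W" "fh F e \<in> W" if "e \<in> Z" for e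
      using that Z(2) ft_in_ends fh_in_ends unfolding W_def by blast+
    have pos: "0 < (\<Sum>(a, b)\<leftarrow>M. g b - g a)"
      if "\<And>a b. (a, b) \<in> set M \<Longrightarrow> g a \<le> g b" "\<exists>(a, b)\<in>set M. g a < g b" for g :: "'v \<Rightarrow> int"
    proof -
      let ?l = "map (\<lambda>(a, b). g b - g a) M"
      have nn: "\<And>x. x \<in> set ?l \<Longrightarrow> 0 \<le> x" using that(1) by auto
      have "\<exists>x\<in>set ?l. x \<noteq> 0" using that(2) by force
      then have "sum_list ?l \<noteq> 0" using sum_list_nonneg_eq_0_iff[OF nn] by blast
      with sum_list_nonneg[of ?l] nn show ?thesis by force
    qed
    \<comment> \<open>If no pair started in \<open>W\<close>, then by balance over \<open>W\<close>
      none would end there either. A rank that vanishes on \<open>W\<close> would grow strictly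
      along every pair of \<open>M\<close> while \<open>Z\<close> contributes nothing, which the
      circulation forbids.\<close>
    have "\<exists>(a, b)\<in>set M. a \<in> W"
    proof (rule ccontr)
      assume "\<not> (\<exists>(a, b)\<in>set M. a \<in> W)"
      then have na: "a \<notin> W" if "(a, b) \<in> set M" for a b using that by blast
      have "(\<Sum>(a, b)\<leftarrow>M. of_bool (b \<in> W) - of_bool (a \<in> W)) = (0 :: int)"
        using circ[of "\<lambda>x. of_bool (x \<in> W)"] ZW by simp
      then have nb: "b \<notin> W" if "(a, b) \<in> set M" for a b
        using pos[of "\<lambda>x. of_bool (x \<in> W)"] that na by fastforce
      define W' where "W' = fst ` set M"
      define g :: "'v \<Rightarrow> int" where "g x = (if x \<in> W then 0 else int (card {y \<in> W'. (y, x) \<in> \<Gamma>}))" for x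
      have "g a < g b" if "(a, b) \<in> set M" for a b
        using strict[of W' a b] that M(1) na[OF that] nb[OF that] by (force simp: g_def W'_def)
      then have "0 < (\<Sum>(a, b)\<leftarrow>M. g b - g a)"
        using M(2) by (intro pos) (auto intro: less_imp_le simp: neq_Nil_conv)
      moreover have "(\<Sum>e\<in>Z. g (fh F e) - g (ft F e)) = 0" using ZW by (simp add: g_def)
      ultimately show False using circ[of g] by simp
    qed
    then have "0 < (\<Sum>(a, b)\<leftarrow>M. int (\<rho> b) - int (\<rho> a))"
      using M(1) mono[OF W] strict[OF W] by (intro pos) (auto simp: \<rho>_def, blast)
    with circ[of "\<lambda>x. int (\<rho> x)"] have neg: "(\<Sum>e\<in>Z. int (\<rho> (fh F e)) - int (\<rho> (ft F e))) < 0" by simp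
    define F' where "F' = sym_diff F Z"
    have "P F'"
      unfolding P_def
    proof (intro conjI allI impI)
      have "below E F' F" unfolding F'_def
        by (rule below_flip[OF Z(1) _ _ circ]) (use Z(2) T(2) M(1) F in \<open>auto simp: P_def\<close>)
      then show "below E F' F0" using F below_trans unfolding P_def by blast
      fix a b X assume "(a, b) \<in> \<Gamma>" "a \<in> X" "b \<notin> X"
      then have "infinite (out F E X)" using F unfolding P_def by blast
      moreover have "out F E X \<subseteq> out F' E X \<union> Z" by (auto simp: F'_def out_def ft_def fh_def)
      ultimately show "infinite (out F' E X)" using Z(1) finite_subset by (metis finite_Un)
    qed
    have "int (\<Phi> F') - int (\<Phi> F) = (\<Sum>e\<in>T. int (\<rho> (ft F' e)) - int (\<rho> (ft F e)))"
      by (simp add: \<Phi>_def sum_subtractf)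
    also have "\<dots> = (\<Sum>e\<in>Z. int (\<rho> (ft F' e)) - int (\<rho> (ft F e)))"
      by (rule sum.mono_neutral_right) (use T Z(2) in \<open>auto simp: F'_def ft_def\<close>)
    also have "\<dots> = (\<Sum>e\<in>Z. int (\<rho> (fh F e)) - int (\<rho> (ft F e)))"
      by (rule sum.cong) (auto simp: F'_def ft_def fh_def)
    finally show False using neg min[OF \<open>P F'\<close>] by simp
  qed
  with F show ?thesis unfolding P_def by blast
qed

text \<open>A closed walk uses finitely many arcs, so excluding it is a condition on a finite set
  \<open>T\<close>. Finitely many such conditions are met together by treating the union of their
  sets \<open>T\<close>.\<close>

lemma destroy_closed_walks:
  assumes \<Gamma>: "trans \<Gamma>" "irrefl \<Gamma>"
    and inf: "\<And>a b X. (a, b) \<in> \<Gamma> \<Longrightarrow> a \<in> X \<Longrightarrow> b \<notin> X \<Longrightarrow> infinite (out F0 E X)"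
  shows "\<exists>F. below E F F0 \<and> (\<forall>(a, b)\<in>\<Gamma>. (b, a) \<notin> (adj F E \<union> \<Gamma>)\<^sup>*)"
proof -
  define V where "V = (\<lambda>(a, b, T) F. (b, a) \<notin> (adj F T \<union> \<Gamma>)\<^sup>*)"
  define I where "I = {(a, b, T). (a, b) \<in> \<Gamma> \<and> finite T \<and> T \<subseteq> E}"
  have "\<exists>F. (\<forall>G\<in>{F0}. below E F G) \<and> (\<forall>i\<in>I. V i F)"
  proof (rule below_compactness)
    fix i assume "i \<in> I"
    then obtain a b T where i: "i = (a, b, T)" "finite T" unfolding I_def by blast
    have "V i F = V i F'" if "F \<inter> T = F' \<inter> T" for F F'
      by (simp add: i(1) V_def adj_cong[OF that])
    with i(2) show "\<exists>T. finite T \<and> (\<forall>F F'. F \<inter> T = F' \<inter> T \<longrightarrow> V i F = V i F')"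
      by (intro exI[of _ T] conjI allI impI)
  next
    fix J \<G>' assume J: "finite J" "J \<subseteq> I" and \<G>': "\<G>' \<subseteq> {F0}"
    define T where "T = (\<Union>(a, b, T)\<in>J. T)"
    have T: "finite T" "T \<subseteq> E" using J unfolding T_def I_def by auto
    obtain F where F: "below E F F0" "\<forall>(a, b)\<in>\<Gamma>. (b, a) \<notin> (adj F T \<union> \<Gamma>)\<^sup>*"
      using destroy_closed_walks_finite[OF \<Gamma> _ T, of F0] inf by metis
    have "V i F" if i: "i \<in> J" for i
    proof -
      obtain a b T' where ab: "i = (a, b, T')" by (cases i) auto
      with i have "T' \<subseteq> T" by (auto simp: T_def)
      then have "(adj F T' \<union> \<Gamma>)\<^sup>* \<subseteq> (adj F T \<union> \<Gamma>)\<^sup>*"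
        by (intro rtrancl_mono) (auto simp: adj_def)
      moreover have "(a, b) \<in> \<Gamma>" using i ab J(2) by (auto simp: I_def)
      ultimately show ?thesis using F(2) unfolding ab V_def by auto
    qed
    with F(1) \<G>' show "\<exists>F. (\<forall>G\<in>\<G>'. below E F G) \<and> (\<forall>i\<in>J. V i F)" by blast
  qed
  then obtain F where F: "below E F F0" "\<And>i. i \<in> I \<Longrightarrow> V i F" by blast
  have "(b, a) \<notin> (adj F E \<union> \<Gamma>)\<^sup>*" if "(a, b) \<in> \<Gamma>" for a b
  proof
    assume "(b, a) \<in> (adj F E \<union> \<Gamma>)\<^sup>*"
    then obtain T where T: "finite T" "T \<subseteq> E" "(b, a) \<in> (adj F T \<union> \<Gamma>)\<^sup>*"
      by (rule adj_rtrancl_finite)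
    then have "(a, b, T) \<in> I" using that unfolding I_def by blast
    from F(2)[OF this] T(3) show False unfolding V_def by simp
  qed
  with F(1) show ?thesis by blast
qed

section \<open>Cycles without excess of backward arcs\<close>

text \<open>For a strict linear order this is 1 on forward and -1 on backward arcs. The upper bound
  1 is what the parity argument for the colouring relies on.\<close>

definition sg :: "'v rel \<Rightarrow> 'v \<Rightarrow> 'v \<Rightarrow> int" where
  "sg lt x y = of_bool ((x, y) \<in> lt) - of_bool ((y, x) \<in> lt)"

definition wt :: "'v rel \<Rightarrow> 'e set \<Rightarrow> 'e list \<Rightarrow> int" where
  "wt lt F p = (\<Sum>e\<leftarrow>p. sg lt (ft F e) (fh F e))"

lemma sg_flip: "e \<in> Z \<Longrightarrow> sg lt (ft (sym_diff F Z) e) (fh (sym_diff F Z) e) = - sg lt (ft F e) (fh F e)"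
  by (auto simp: sg_def ft_def fh_def)

lemma wt_cong: "F \<inter> set p = F' \<inter> set p \<Longrightarrow> wt lt F p = wt lt F' p"
  unfolding wt_def by (intro arg_cong[where f = sum_list] map_cong refl) (auto simp: ft_def fh_def)

lemma cyc_distinct: "cyc F p \<Longrightarrow> distinct p"
  unfolding cyc_def by (auto simp: distinct_map)

text \<open>A flip negates the signs on a cycle, so flipping one of negative weight would lower the
  minimised sum. Each summand \<open>1 - sg\<close> is nonnegative: 2 on backward arcs and 0 on
  forward ones.\<close>

lemma no_negative_cycles_finite:
  assumes T: "finite T" "T \<subseteq> E"
  shows "\<exists>F. below E F F0 \<and> (\<forall>p. cyc F p \<longrightarrow> set p \<subseteq> T \<longrightarrow> 0 \<le> wt lt F p)"
proof -
  define \<Phi> where "\<Phi> F = (\<Sum>e\<in>T. 1 - sg lt (ft F e) (fh F e))" for F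
  have nonneg: "0 \<le> \<Phi> F" for F unfolding \<Phi>_def by (rule sum_nonneg) (auto simp: sg_def)
  obtain F where F: "below E F F0" and min: "\<And>F'. below E F' F0 \<Longrightarrow> nat (\<Phi> F) \<le> nat (\<Phi> F')"
    using ex_has_least_nat[of "\<lambda>F. below E F F0" F0 "\<lambda>F. nat (\<Phi> F)"] below_refl by blast
  have "0 \<le> wt lt F p" if p: "cyc F p" "set p \<subseteq> T" for p
  proof (rule ccontr)
    assume neg: "\<not> 0 \<le> wt lt F p"
    let ?F' = "sym_diff F (set p)"
    have "below E ?F' F0"
      using below_cyc[OF p(1), of E] p(2) T(2) F below_trans by blast
    then have "nat (\<Phi> F) \<le> nat (\<Phi> ?F')" by (rule min)
    then have le: "\<Phi> F \<le> \<Phi> ?F'" using nonneg[of F] nonneg[of ?F'] by simp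
    have "\<Phi> ?F' - \<Phi> F =
        (\<Sum>e\<in>T. sg lt (ft F e) (fh F e) - sg lt (ft ?F' e) (fh ?F' e))"
      by (simp add: \<Phi>_def sum_subtractf)
    also have "\<dots> = (\<Sum>e\<in>set p. sg lt (ft F e) (fh F e) - sg lt (ft ?F' e) (fh ?F' e))"
      by (rule sum.mono_neutral_right) (use T p(2) in \<open>auto simp: ft_def fh_def\<close>)
    also have "\<dots> = (\<Sum>e\<in>set p. 2 * sg lt (ft F e) (fh F e))"
      by (rule sum.cong) (simp_all add: sg_flip)
    also have "\<dots> = 2 * wt lt F p"
      unfolding wt_def using cyc_distinct[OF p(1)]
      by (simp add: sum_list_distinct_conv_sum_set sum_distrib_left)
    finally show False using neg le by linarith
  qed
  with F show ?thesis by blast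
qed

lemma no_negative_cycles:
  "\<exists>F. below E F F0 \<and> (\<forall>p. cyc F p \<longrightarrow> set p \<subseteq> E \<longrightarrow> 0 \<le> wt lt F p)"
proof -
  define V where "V p F \<longleftrightarrow> (cyc F p \<longrightarrow> 0 \<le> wt lt F p)" for p F
  have "\<exists>F. (\<forall>G\<in>{F0}. below E F G) \<and> (\<forall>p\<in>{p. set p \<subseteq> E}. V p F)"
  proof (rule below_compactness)
    fix p :: "'e list"
    have "V p F = V p F'" if "F \<inter> set p = F' \<inter> set p" for F F'
      unfolding V_def cyc_cong[OF that] wt_cong[OF that] ..
    then show "\<exists>T. finite T \<and> (\<forall>F F'. F \<inter> T = F' \<inter> T \<longrightarrow> V p F = V p F')"
      by (intro exI[of _ "set p"] conjI allI impI) simp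
  next
    fix J \<G>' assume J: "finite J" "J \<subseteq> {p. set p \<subseteq> E}" and \<G>': "\<G>' \<subseteq> {F0}"
    define T where "T = (\<Union>p\<in>J. set p)"
    have T: "finite T" "T \<subseteq> E" using J unfolding T_def by auto
    obtain F where F: "below E F F0" "\<forall>p. cyc F p \<longrightarrow> set p \<subseteq> T \<longrightarrow> 0 \<le> wt lt F p"
      using no_negative_cycles_finite[OF T] by blast
    then have "\<forall>p\<in>J. V p F" unfolding V_def T_def by blast
    with F(1) \<G>' show "\<exists>F. (\<forall>G\<in>\<G>'. below E F G) \<and> (\<forall>p\<in>J. V p F)" by blast
  qed
  then show ?thesis unfolding V_def by blast
qed

section \<open>The countable case\<close>

text \<open>The first half serves the colouring, the second the edge-connectivity. The second half
  is inherited by orientations below, the first in general is not.\<close>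

definition settled :: "'v rel \<Rightarrow> 'e set \<Rightarrow> 'e set \<Rightarrow> bool" where
  "settled lt F q \<longleftrightarrow> (\<forall>p. set p \<subseteq> q \<longrightarrow> cyc F p \<longrightarrow> 0 \<le> wt lt F p) \<and>
     (\<forall>u w. u \<noteq> w \<longrightarrow> (w, u) \<in> (adj F q)\<^sup>* \<longrightarrow> (\<exists>X. u \<in> X \<and> w \<notin> X \<and> finite (out F q X)))"

lemma settled_cong:
  assumes "F \<inter> q = F' \<inter> q"
  shows "settled lt F q \<longleftrightarrow> settled lt F' q"
proof -
  have "F \<inter> set p = F' \<inter> set p" if "set p \<subseteq> q" for p using assms that by blast
  then have "cyc F p = cyc F' p" "wt lt F p = wt lt F' p" if "set p \<subseteq> q" for p
    using that cyc_cong[of F p F'] wt_cong[of F p F'] by blast+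
  then show ?thesis
    unfolding settled_def adj_cong[OF assms] out_cong[OF assms] by (simp cong: imp_cong)
qed

text \<open>Each arc of the lower orientation can be replaced by a walk of the upper one, while the
  pairs of \<Gamma> are kept.\<close>

lemma below_closed_walks:
  assumes "below E F' F" "(b, a) \<in> (adj F' E \<union> \<Gamma>)\<^sup>*"
  shows "(b, a) \<in> (adj F E \<union> \<Gamma>)\<^sup>*"
proof -
  have "adj F' E \<subseteq> (adj F E)\<^sup>*" using below_reach[OF assms(1)] by auto
  then have "adj F' E \<union> \<Gamma> \<subseteq> (adj F E \<union> \<Gamma>)\<^sup>*"
    using rtrancl_mono[of "adj F E" "adj F E \<union> \<Gamma>"] by blast
  then show ?thesis using assms(2) rtrancl_subset_rtrancl by blast
qed

lemma adj_rtrancl_ends: "(x, y) \<in> (adj F E)\<^sup>* \<Longrightarrow> x \<noteq> y \<Longrightarrow> x \<in> ends E \<and> y \<in> ends E"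
  by (metis adj_ends converse_rtranclE rtranclE)

text \<open>The countably many vertex pairs are treated in turn. A pair once treated stays in order
  under every orientation below, and compactness gives an orientation below the whole descending
  sequence.\<close>

lemma separate_pairs:
  assumes "countable E"
  shows "\<exists>F. below E F F0 \<and> (\<forall>u w. u \<noteq> w \<longrightarrow> (w, u) \<in> (adj F E)\<^sup>* \<longrightarrow>
    (\<exists>X. u \<in> X \<and> w \<notin> X \<and> finite (out F E X)))"
proof -
  define ok where "ok x F \<longleftrightarrow> (case x of (u, w) \<Rightarrow> u \<noteq> w \<longrightarrow> (w, u) \<in> (adj F E)\<^sup>* \<longrightarrow>
    (\<exists>X. u \<in> X \<and> w \<notin> X \<and> finite (out F E X)))" for x F
  have ok_below: "ok x F'" if "below E F' F" "ok x F" for x F F'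
    using that below_reach[OF that(1)] unfolding ok_def below_def by (auto split: prod.splits)
  define pr where "pr = from_nat_into (ends E \<times> ends E)"
  have step: "\<exists>F'. below E F' F0 \<and> (below E F' F \<and> ok (pr n) F')" if "below E F F0" for F n
  proof (cases "ok (pr n) F")
    case True
    with that below_refl show ?thesis by blast
  next
    case False
    obtain u w where uw: "pr n = (u, w)" by fastforce
    with False have "u \<noteq> w" "\<And>X. u \<in> X \<Longrightarrow> w \<notin> X \<Longrightarrow> infinite (out F E X)"
      by (auto simp: ok_def)
    then obtain F' where F': "below E F' F" "\<forall>(a, b)\<in>{(u, w)}. (b, a) \<notin> (adj F' E \<union> {(u, w)})\<^sup>*"
      using destroy_closed_walks[of "{(u, w)}" F E] by (auto simp: trans_def irrefl_def)
    have "(w, u) \<notin> (adj F' E)\<^sup>*"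
      using F'(2) rtrancl_mono[of "adj F' E" "adj F' E \<union> {(u, w)}"] by blast
    then have "ok (pr n) F'" unfolding uw ok_def by simp
    with F'(1) below_trans[OF F'(1) that] show ?thesis by blast
  qed
  have "\<exists>f. \<forall>n. below E (f n) F0 \<and> below E (f (Suc n)) (f n) \<and> ok (pr n) (f (Suc n))"
    using dependent_nat_choice[of "\<lambda>_ F. below E F F0" "\<lambda>n F F'. below E F' F \<and> ok (pr n) F'"]
      below_refl step by blast
  then obtain f where f: "\<And>n. below E (f n) F0" "\<And>n. below E (f (Suc n)) (f n)"
    "\<And>n. ok (pr n) (f (Suc n))" by blast
  have dec: "below E (f n) (f m)" if "m \<le> n" for m n
    using that
  proof (induction rule: dec_induct)
    case (step n)
    then show ?case using below_trans[OF f(2)] by blast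
  qed (rule below_refl)
  \<comment> \<open>The extra conditions are vacuous; only a lower bound of the sequence is
    wanted.\<close>
  have "\<exists>F. (\<forall>G\<in>range f. below E F G) \<and> (\<forall>i\<in>({} :: 'e set). True)"
  proof (rule below_compactness[where c = "\<lambda>_ _. True"])
    fix J :: "'e set" and \<G>' assume "finite \<G>'" "\<G>' \<subseteq> range f"
    then obtain N where N: "finite N" "\<G>' = f ` N" by (meson finite_subset_image)
    then have "below E (f (Max (insert 0 N))) G" if "G \<in> \<G>'" for G
      using that by (auto intro!: dec)
    then show "\<exists>F. (\<forall>G\<in>\<G>'. below E F G) \<and> (\<forall>i\<in>J. True)" by blast
  qed simp
  then obtain F where F: "\<And>n. below E F (f n)" by blast
  have "ok (u, w) F" for u w
  proof (cases "u \<noteq> w \<and> (w, u) \<in> (adj F E)\<^sup>*")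
    case True
    then have "(u, w) \<in> ends E \<times> ends E" using adj_rtrancl_ends by blast
    moreover have "countable (ends E \<times> ends E)" using assms by (simp add: ends_def)
    ultimately obtain n where "pr n = (u, w)" unfolding pr_def by (metis from_nat_into_surj)
    with ok_below[OF F f(3)[of n]] show ?thesis by simp
  qed (auto simp: ok_def)
  with below_trans[OF F[of 0] f(1)] show ?thesis unfolding ok_def by auto
qed

text \<open>The order of the three constructions matters: absence of closed walks and separation
  pass to orientations below, whereas nonnegative cycle weights do not and therefore come
  last.\<close>

lemma countable_settled:
  assumes "countable E" "trans \<Gamma>" "irrefl \<Gamma>"
    and "\<And>a b X. (a, b) \<in> \<Gamma> \<Longrightarrow> a \<in> X \<Longrightarrow> b \<notin> X \<Longrightarrow> infinite (out F0 E X)"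
  shows "\<exists>F. below E F F0 \<and> settled lt F E \<and> (\<forall>(a, b)\<in>\<Gamma>. (b, a) \<notin> (adj F E \<union> \<Gamma>)\<^sup>*)"
proof -
  obtain F1 where F1: "below E F1 F0" "\<forall>(a, b)\<in>\<Gamma>. (b, a) \<notin> (adj F1 E \<union> \<Gamma>)\<^sup>*"
    using destroy_closed_walks[OF assms(2,3), of F0 E] assms(4) by metis
  obtain F2 where F2: "below E F2 F1" "\<And>u w. u \<noteq> w \<Longrightarrow> (w, u) \<in> (adj F2 E)\<^sup>* \<Longrightarrow>
    \<exists>X. u \<in> X \<and> w \<notin> X \<and> finite (out F2 E X)"
    using separate_pairs[OF assms(1), of F1] by blast
  obtain F3 where F3: "below E F3 F2" "\<forall>p. cyc F3 p \<longrightarrow> set p \<subseteq> E \<longrightarrow> 0 \<le> wt lt F3 p"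
    using no_negative_cycles by blast
  have "\<exists>X. u \<in> X \<and> w \<notin> X \<and> finite (out F3 E X)" if "u \<noteq> w" "(w, u) \<in> (adj F3 E)\<^sup>*" for u w
    using F2(2)[OF that(1) below_reach[OF F3(1) that(2)]] F3(1) unfolding below_def by blast
  with F3(2) have "settled lt F3 E" unfolding settled_def by blast
  moreover have F31: "below E F3 F1" using F3(1) F2(1) by (rule below_trans)
  moreover have "below E F3 F0" using F31 F1(1) by (rule below_trans)
  moreover have "\<forall>(a, b)\<in>\<Gamma>. (b, a) \<notin> (adj F3 E \<union> \<Gamma>)\<^sup>*"
    using F1(2) below_closed_walks[OF F31] by blast
  ultimately show ?thesis by blast
qed

end

section \<open>Cardinals and linear extensions\<close>

text \<open>\<Delta> records the \<open>A\<close>-segments between distinct points of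
  \<open>U\<close>. Hence the middle of the walk can be rewritten in \<open>B\<close> and \<Delta>,
  and only the segments before its first and after its last step in \<open>B\<close> remain in
  \<open>A\<close>.\<close>

lemma rtrancl_Un_segments:
  assumes "(b, z) \<in> (B \<union> A)\<^sup>*" "B \<subseteq> U \<times> U"
    and seg: "\<And>x y. x \<in> U \<Longrightarrow> y \<in> U \<Longrightarrow> x \<noteq> y \<Longrightarrow> (x, y) \<in> A\<^sup>* \<Longrightarrow> (x, y) \<in> \<Delta>"
  shows "(b, z) \<in> A\<^sup>* \<or> (\<exists>u\<in>U. \<exists>v\<in>U. (b, u) \<in> A\<^sup>* \<and> (u, v) \<in> (B \<union> \<Delta>)\<^sup>* \<and> (v, z) \<in> A\<^sup>*)"
  using assms(1)
proof (induction rule: rtrancl_induct)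
  case (step y z)
  from step(2) show ?case
  proof
    assume "(y, z) \<in> A"
    with step.IH show ?thesis by (meson rtrancl_into_rtrancl)
  next
    assume yz: "(y, z) \<in> B"
    then have U: "y \<in> U" "z \<in> U" using assms(2) by auto
    from step.IH show ?thesis
    proof
      assume "(b, y) \<in> A\<^sup>*"
      with yz U show ?thesis by blast
    next
      assume "\<exists>u\<in>U. \<exists>v\<in>U. (b, u) \<in> A\<^sup>* \<and> (u, v) \<in> (B \<union> \<Delta>)\<^sup>* \<and> (v, y) \<in> A\<^sup>*"
      then obtain u v where uv: "u \<in> U" "v \<in> U" "(b, u) \<in> A\<^sup>*" "(u, v) \<in> (B \<union> \<Delta>)\<^sup>*" "(v, y) \<in> A\<^sup>*"
        by blast
      have "(u, y) \<in> (B \<union> \<Delta>)\<^sup>*"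
      proof (cases "v = y")
        case False
        with seg[OF uv(2) U(1)] uv(5) have "(v, y) \<in> B \<union> \<Delta>" by blast
        with uv(4) show ?thesis by (rule rtrancl_into_rtrancl)
      qed (use uv in simp)
      then have "(u, z) \<in> (B \<union> \<Delta>)\<^sup>*" using yz by (meson UnI1 rtrancl_into_rtrancl)
      with uv U show ?thesis by blast
    qed
  qed
qed simp

lemma rtrancl_chain_Union:
  assumes "(x, y) \<in> (\<Union>j\<in>J. R j)\<^sup>*" "x \<noteq> y"
    and chain: "\<And>j k. j \<in> J \<Longrightarrow> k \<in> J \<Longrightarrow> R j \<subseteq> R k \<or> R k \<subseteq> R j"
  shows "\<exists>j\<in>J. (x, y) \<in> (R j)\<^sup>*"
proof -
  have "x = y \<or> (\<exists>j\<in>J. (x, y) \<in> (R j)\<^sup>*)"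
    using assms(1)
  proof (induction rule: rtrancl_induct)
    case (step y z)
    then obtain k where k: "k \<in> J" "(y, z) \<in> R k" by blast
    from step.IH show ?case
    proof
      assume "\<exists>j\<in>J. (x, y) \<in> (R j)\<^sup>*"
      then obtain j where j: "j \<in> J" "(x, y) \<in> (R j)\<^sup>*" by blast
      from chain[OF j(1) k(1)] show ?thesis
      proof
        assume "R j \<subseteq> R k"
        with j have "(x, y) \<in> (R k)\<^sup>*" using rtrancl_mono by blast
        with k show ?thesis by (meson rtrancl_into_rtrancl)
      next
        assume "R k \<subseteq> R j"
        with j k show ?thesis by (meson rtrancl_into_rtrancl subsetD)
      qed
    qed (use k in auto)
  qed simp
  with assms(2) show ?thesis by blast
qed

lemma acyclic_linear_extension:
  assumes "acyclic r"
  obtains L where "r \<subseteq> L" "trans L" "irrefl L" "\<And>x y. x \<noteq> y \<Longrightarrow> (x, y) \<in> L \<or> (y, x) \<in> L"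
proof -
  let ?S = "{s. r \<subseteq> s \<and> trans s \<and> irrefl s}"
  have "r\<^sup>+ \<in> ?S" using assms by (auto simp: acyclic_def irrefl_def)
  then have "\<exists>M\<in>?S. \<forall>X\<in>?S. M \<subseteq> X \<longrightarrow> X = M"
  proof (intro subset_Zorn_nonempty)
    fix \<C> assume "\<C> \<noteq> {}" and ch: "subset.chain ?S \<C>"
    then obtain C where C: "C \<in> \<C>" by blast
    have sub: "\<C> \<subseteq> ?S" using ch by (simp add: subset_chain_def)
    have "r \<subseteq> \<Union>\<C>" using C sub by blast
    moreover have "irrefl (\<Union>\<C>)" using sub by (auto simp: irrefl_def)
    moreover have "trans (\<Union>\<C>)"
    proof (rule transI)
      fix x y z assume "(x, y) \<in> \<Union>\<C>" "(y, z) \<in> \<Union>\<C>"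
      then obtain A B where AB: "A \<in> \<C>" "B \<in> \<C>" "(x, y) \<in> A" "(y, z) \<in> B" by blast
      then have "A \<subseteq> B \<or> B \<subseteq> A" using ch by (simp add: subset_chain_def)
      then obtain D where "D \<in> \<C>" "(x, y) \<in> D" "(y, z) \<in> D" using AB by blast
      moreover from this have "trans D" using sub by blast
      ultimately show "(x, z) \<in> \<Union>\<C>" by (meson UnionI transD)
    qed
    ultimately show "\<Union>\<C> \<in> ?S" by blast
  qed blast
  then obtain M where MS: "M \<in> ?S" and mx: "\<forall>X\<in>?S. M \<subseteq> X \<longrightarrow> X = M" by (rule bexE)
  have M: "r \<subseteq> M" "trans M" "irrefl M" using MS by simp_all
  have max: "X = M" if "r \<subseteq> X" "trans X" "irrefl X" "M \<subseteq> X" for X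
    using bspec[OF mx, of X] that by simp
  have "(x, y) \<in> M \<or> (y, x) \<in> M" if "x \<noteq> y" for x y
  proof (rule ccontr)
    assume n: "\<not> ((x, y) \<in> M \<or> (y, x) \<in> M)"
    \<comment> \<open>An incomparable pair is added with everything that transitivity forces; a loop
      in the result would already compare \<open>y\<close> with \<open>x\<close>.\<close>
    let ?M = "{(a, b). (a, b) \<in> M \<or> (a = x \<or> (a, x) \<in> M) \<and> (b = y \<or> (y, b) \<in> M)}"
    have tr: "(a, b) \<in> M \<Longrightarrow> (b, c) \<in> M \<Longrightarrow> (a, c) \<in> M" for a b c using M(2) by (rule transD)
    have "(a, a) \<notin> ?M" for a using M(3) n that tr[of y a x] unfolding irrefl_def by blast
    then have "irrefl ?M" by (simp add: irrefl_def)
    moreover have "trans ?M"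
    proof (rule transI)
      fix a b c assume "(a, b) \<in> ?M" "(b, c) \<in> ?M"
      then show "(a, c) \<in> ?M" using n that tr[of a b c] tr[of a b x] tr[of y b c] tr[of y b x] by blast
    qed
    ultimately have "?M = M" using M(1) by (intro max) auto
    moreover have "(x, y) \<in> ?M" by simp
    ultimately show False using n by blast
  qed
  with M that show thesis by blast
qed

lemma card_of_Un_le:
  assumes "infinite C" "|A| \<le>o |C|" "|B| \<le>o |C|"
  shows "|A \<union> B| \<le>o |C|"
  using card_of_Un_ordLeq_infinite_Field[of "|C|" A B] assms by (simp add: Field_card_of card_of_card_order_on)

lemma card_of_less_iff: "|A| <o |B| \<longleftrightarrow> \<not> |B| \<le>o |A|"
  by (simp add: not_ordLeq_iff_ordLess card_of_Well_order)

lemma finite_le_infinite: "finite A \<Longrightarrow> infinite B \<Longrightarrow> |A| \<le>o |B|"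
  using finite_ordLess_infinite[OF card_of_Well_order[of A] card_of_Well_order[of B]]
  by (simp add: Field_card_of ordLess_imp_ordLeq)

lemma exists_minimal_card:
  assumes "P x"
  obtains y where "P y" "\<And>z. P z \<Longrightarrow> |f y| \<le>o |f z|"
proof -
  let ?R = "(\<lambda>x. |f x| ) ` Collect P"
  have "\<exists>r\<in>?R. \<forall>r'\<in>?R. r \<le>o r'"
    by (rule exists_minim_Card_order) (use assms card_of_Card_order in auto)
  with that show thesis by auto
qed

text \<open>\<open>Y\<close> is numbered along an initial segment of the well-order. A number at or
  above \<open>i\<close> would have at least \<open>|underS |E| i|\<close> predecessors among the
  numbers, too many if \<open>|Y| \<le>o |underS |E| i|\<close>. One numbering serves all
  \<open>i\<close>.\<close>

lemma initial_enumeration: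
  assumes "Y \<subseteq> E"
  shows "\<exists>g. inj_on g Y \<and> g ` Y \<subseteq> E \<and> (\<forall>i\<in>E. |Y| \<le>o |underS ( |E| ) i| \<longrightarrow> g ` Y \<subseteq> underS ( |E| ) i)"
proof -
  have "|Y| \<le>o |E|" using assms by (rule card_of_mono1)
  then obtain g where g: "embed |Y| |E| g" unfolding ordLeq_def by blast
  have fld: "Field |Y| = Y" "Field |E| = E" by (simp_all add: Field_card_of)
  have inj: "inj_on g Y" using embed_inj_on[OF card_of_Well_order g] fld by simp
  have im: "g ` Y \<subseteq> E" using embed_Field[OF g] fld by simp
  have "g w \<in> underS |E| i" if i: "i \<in> E" "|Y| \<le>o |underS |E| i|" and w: "w \<in> Y" for i w
  proof (rule ccontr)
    assume n: "g w \<notin> underS |E| i"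
    have wo: "Well_order |E|" by (rule card_of_Well_order)
    have gw: "g w \<in> E" using im w by blast
    have "(i, i) \<in> |E|" using i(1) wo fld(2) unfolding order_on_defs refl_on_def by simp
    moreover have "g w \<noteq> i \<Longrightarrow> (g w, i) \<in> |E| \<or> (i, g w) \<in> |E|"
      using gw i(1) wo fld(2) unfolding order_on_defs total_on_def by simp
    ultimately have "(i, g w) \<in> |E|" using n unfolding underS_def by blast
    then have "underS |E| i \<subseteq> underS |E| (g w)"
      using wo unfolding order_on_defs by (intro underS_incr) auto
    also have "\<dots> = g ` underS |Y| w"
      using embed_underS[OF card_of_Well_order g] w fld by (simp add: bij_betw_def)
    finally have "|underS |E| i| \<le>o |g ` underS |Y| w|" by (rule card_of_mono1)
    also have "|g ` underS |Y| w| \<le>o |underS |Y| w|" by (rule card_of_image)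
    also have "|underS |Y| w| <o |Y|"
      by (rule card_of_underS[OF card_of_Card_order]) (simp add: w fld)
    finally show False using i(2) by (simp add: card_of_less_iff)
  qed
  with inj im show ?thesis by blast
qed

lemma ex_infinite_underS:
  assumes "uncountable E"
  shows "\<exists>i\<in>E. infinite (underS |E| i)"
proof (rule ccontr)
  assume "\<not> ?thesis"
  then have fin: "finite (underS |E| i)" if "i \<in> E" for i using that by blast
  have wo: "Well_order |E|" by (rule card_of_Well_order)
  have fld: "Field |E| = E" by (simp add: Field_card_of)
  have less: "card (underS |E| i) < card (underS |E| j)" if "i \<in> E" "j \<in> E" "(i, j) \<in> |E|" "i \<noteq> j" for i j
  proof (rule psubset_card_mono[OF fin[OF that(2)]])
    have "underS |E| i \<subseteq> underS |E| j"
      using that(3) wo unfolding order_on_defs by (intro underS_incr) auto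
    moreover have "i \<in> underS |E| j" "i \<notin> underS |E| i" using that by (auto simp: underS_def)
    ultimately show "underS |E| i \<subset> underS |E| j" by blast
  qed
  have "inj_on (\<lambda>i. card (underS |E| i)) E"
  proof (rule inj_onI, rule ccontr)
    fix i j assume ij: "i \<in> E" "j \<in> E" "card (underS |E| i) = card (underS |E| j)" "i \<noteq> j"
    have "(i, j) \<in> |E| \<or> (j, i) \<in> |E|"
      using ij wo fld unfolding order_on_defs total_on_def by auto
    with less[of i j] less[of j i] ij show False by auto
  qed
  then have "countable E" by (rule countableI)
  with assms show False by simp
qed

context flips
begin

section \<open>Disjoint paths, closures and comparison of connectivities\<close>

abbreviation out0 :: "'e set \<Rightarrow> 'v set \<Rightarrow> 'e set" where
  "out0 \<equiv> out {}"

lemma ends_Union: "x \<in> ends (\<Union>j\<in>J. M j) \<Longrightarrow> \<exists>j\<in>J. x \<in> ends (M j)"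
  by (auto simp: ends_def)

lemma out_nonempty:
  assumes "(x, y) \<in> (adj F E)\<^sup>*" "x \<in> X" "y \<notin> X"
  shows "out F E X \<noteq> {}"
  using adj_closed[OF assms(1) _ assms(2)] assms(3) by blast

text \<open>Take a maximal disjoint family of finite arc sets joining \<open>x\<close> to
  \<open>y\<close> outside \<open>B\<close>. If it had fewer than \<open>|A|\<close> members, then
  together with \<open>B\<close> it would comprise at most \<open>|A|\<close> arcs, and the set
  reached without them would be too small a cut. Its members meet every cut in distinct
  arcs.\<close>

lemma many_disjoint_paths:
  assumes A: "infinite A" "|B| \<le>o |A|" and xy: "x \<noteq> y"
    and cuts: "\<And>X. x \<in> X \<Longrightarrow> y \<notin> X \<Longrightarrow> |A| <o |out0 E X|"
  shows "\<exists>W. W \<subseteq> E - B \<and> |W| \<le>o |A| \<and> (\<forall>X. x \<in> X \<longrightarrow> y \<notin> X \<longrightarrow> |A| \<le>o |out0 W X| )"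
proof -
  define good where "good = {P. finite P \<and> P \<subseteq> E - B \<and> (x, y) \<in> (adj {} P)\<^sup>*}"
  let ?S = "{\<P>. \<P> \<subseteq> good \<and> disjoint \<P>}"
  have "\<exists>\<M>\<in>?S. \<forall>\<X>\<in>?S. \<M> \<subseteq> \<X> \<longrightarrow> \<X> = \<M>"
  proof (rule subset_Zorn')
    fix \<C> assume ch: "subset.chain ?S \<C>"
    have "P \<inter> Q = {}" if PQ: "P \<in> \<Union>\<C>" "Q \<in> \<Union>\<C>" "P \<noteq> Q" for P Q
    proof -
      obtain X Y where XY: "X \<in> \<C>" "Y \<in> \<C>" "P \<in> X" "Q \<in> Y" using PQ by blast
      then have "X \<subseteq> Y \<or> Y \<subseteq> X" using ch by (simp add: subset_chain_def)
      then obtain Z where Z: "Z \<in> \<C>" "P \<in> Z" "Q \<in> Z" using XY by blast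
      then have "disjoint Z" using ch by (auto simp: subset_chain_def)
      with Z PQ(3) show ?thesis unfolding disjoint_def by blast
    qed
    then have "disjoint (\<Union>\<C>)" by (intro disjointI)
    moreover have "\<Union>\<C> \<subseteq> good" using ch by (auto simp: subset_chain_def)
    ultimately show "\<Union>\<C> \<in> ?S" by blast
  qed
  then obtain \<M> where MS: "\<M> \<in> ?S" and mx: "\<forall>\<X>\<in>?S. \<M> \<subseteq> \<X> \<longrightarrow> \<X> = \<M>" by (rule bexE)
  have M: "\<M> \<subseteq> good" "disjoint \<M>" using MS by simp_all
  have max: "\<X> = \<M>" if "\<X> \<subseteq> good" "disjoint \<X>" "\<M> \<subseteq> \<X>" for \<X>
    using bspec[OF mx, of \<X>] that by simp
  have le: "|\<Union>\<N>| \<le>o |A|" if "\<N> \<subseteq> good" "|\<N>| \<le>o |A|" for \<N>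
  proof -
    have "|\<Union>P\<in>\<N>. P| \<le>o |A|"
      by (rule card_of_UNION_ordLeq_infinite[OF A(1) that(2)])
        (use that(1) A(1) finite_le_infinite in \<open>auto simp: good_def\<close>)
    then show ?thesis by simp
  qed
  have ne: "P \<noteq> {}" if "P \<in> good" for P
    using that xy by (auto simp: good_def adj_def)
  have "|A| \<le>o |\<M>|"
  proof (rule ccontr)
    assume "\<not> |A| \<le>o |\<M>|"
    then have "|\<M>| \<le>o |A|" by (simp add: card_of_less_iff[symmetric] ordLess_imp_ordLeq)
    then have S: "|B \<union> \<Union>\<M>| \<le>o |A|" using A M(1) by (intro card_of_Un_le le)
    define X where "X = {z. (x, z) \<in> (adj {} (E - (B \<union> \<Union>\<M>)))\<^sup>*}"
    have "out0 (E - (B \<union> \<Union>\<M>)) X = {}" unfolding X_def by (rule out_reach)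
    then have "out0 E X \<subseteq> B \<union> \<Union>\<M>" by (auto simp: out_def)
    then have "|out0 E X| \<le>o |A|" using ordLeq_transitive[OF card_of_mono1 S] by blast
    then have "y \<in> X" using cuts[of X] by (auto simp: X_def card_of_less_iff)
    then have "(x, y) \<in> (adj {} (E - (B \<union> \<Union>\<M>)) \<union> {})\<^sup>*" by (simp add: X_def)
    then obtain P where P: "finite P" "P \<subseteq> E - (B \<union> \<Union>\<M>)" "(x, y) \<in> (adj {} P \<union> {})\<^sup>*"
      by (rule adj_rtrancl_finite)
    then have g: "P \<in> good" by (auto simp: good_def)
    have "disjoint (insert P \<M>)" using M(2) P(2) unfolding disjoint_def by auto
    then have "insert P \<M> = \<M>" using M(1) g by (intro max) auto
    then have "P \<subseteq> \<Union>\<M>" by blast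
    with P(2) ne[OF g] show False by blast
  qed
  then obtain \<N> where N: "\<N> \<subseteq> \<M>" "|A| =o |\<N>|"
    using internalize_card_of_ordLeq[of A "|\<M>|"] by (auto simp: Field_card_of)
  have "|A| \<le>o |out0 (\<Union>\<N>) X|" if X: "x \<in> X" "y \<notin> X" for X
  proof -
    have "\<exists>e. e \<in> P \<and> e \<in> out0 (\<Union>\<N>) X" if P: "P \<in> \<N>" for P
    proof -
      have "(x, y) \<in> (adj {} P)\<^sup>*" using P N(1) M(1) by (auto simp: good_def)
      then have "out0 P X \<noteq> {}" using X by (rule out_nonempty)
      with P show ?thesis by (auto simp: out_def)
    qed
    then obtain f where f: "\<And>P. P \<in> \<N> \<Longrightarrow> f P \<in> P \<and> f P \<in> out0 (\<Union>\<N>) X" by metis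
    have "inj_on f \<N>"
    proof (rule inj_onI, rule ccontr)
      fix P Q assume PQ: "P \<in> \<N>" "Q \<in> \<N>" "f P = f Q" "P \<noteq> Q"
      then have "P \<inter> Q = {}" using N(1) by (intro disjointD[OF M(2)]) auto
      with f[OF PQ(1)] f[OF PQ(2)] PQ(3) show False by auto
    qed
    moreover have "f ` \<N> \<subseteq> out0 (\<Union>\<N>) X" using f by auto
    ultimately have "|\<N>| \<le>o |out0 (\<Union>\<N>) X|"
      by (intro iffD1[OF card_of_ordLeq] exI[of _ f] conjI)
    with N(2) show ?thesis by (rule ordIso_ordLeq_trans)
  qed
  moreover have "|\<Union>\<N>| \<le>o |A|"
    using N(1) M(1) by (intro le ordIso_imp_ordLeq ordIso_symmetric[OF N(2)]) auto
  moreover have "\<Union>\<N> \<subseteq> E - B" using N(1) M(1) by (auto simp: good_def)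
  ultimately show ?thesis by blast
qed

text \<open>Countably many rounds suffice, as two end vertices of the union already occur together
  in one round; since \<open>|A|\<close> is infinite, neither a round nor the union exceeds
  it.\<close>

lemma ends_closure:
  fixes g :: "'v \<Rightarrow> 'v \<Rightarrow> 'e set"
  assumes A: "infinite A" and g: "\<And>x y. g x y \<subseteq> E" "\<And>x y. |g x y| \<le>o |A|"
    and Z: "Z \<subseteq> E" "|Z| \<le>o |A|"
  shows "\<exists>M. Z \<subseteq> M \<and> M \<subseteq> E \<and> |M| \<le>o |A| \<and> (\<forall>x\<in>ends M. \<forall>y\<in>ends M. g x y \<subseteq> M)"
proof -
  define f where "f M = M \<union> (\<Union>x\<in>ends M. \<Union>y\<in>ends M. g x y)" for M
  define M where "M n = (f ^^ n) Z" for n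
  have ends_le: "|ends M| \<le>o |A|" if "|M| \<le>o |A|" for M
    unfolding ends_def
    by (intro card_of_Un_le A ordLeq_transitive[OF card_of_image that])
  have M: "M n \<subseteq> E \<and> |M n| \<le>o |A|" for n
  proof (induction n)
    case (Suc n)
    then have "|ends (M n)| \<le>o |A|" using ends_le by blast
    then have "|f (M n)| \<le>o |A|" unfolding f_def
      using A g(2) Suc by (intro card_of_Un_le card_of_UNION_ordLeq_infinite ballI) auto
    with Suc g(1) show ?case by (auto simp: M_def f_def)
  qed (use Z in \<open>simp add: M_def\<close>)
  have mono: "M m \<subseteq> M n" if "m \<le> n" for m n
    using that by (induction rule: dec_induct) (auto simp: M_def f_def)
  have "g x y \<subseteq> (\<Union>n. M n)" if xy: "x \<in> ends (\<Union>n. M n)" "y \<in> ends (\<Union>n. M n)" for x y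
  proof -
    obtain m n where "x \<in> ends (M m)" "y \<in> ends (M n)"
      using ends_Union[OF xy(1)] ends_Union[OF xy(2)] by blast
    then have "x \<in> ends (M (max m n))" "y \<in> ends (M (max m n))"
      using ends_mono[OF mono, of m "max m n"] ends_mono[OF mono, of n "max m n"] by auto
    then have "g x y \<subseteq> M (Suc (max m n))" unfolding M_def by (auto simp: f_def)
    then show ?thesis by blast
  qed
  moreover have "|\<Union>n. M n| \<le>o |A|"
    using A M by (intro card_of_UNION_ordLeq_infinite) (simp_all add: infinite_iff_card_of_nat)
  moreover have "Z \<subseteq> (\<Union>n. M n)" using UN_upper[of 0 UNIV M] by (simp add: M_def)
  moreover have "(\<Union>n. M n) \<subseteq> E" using M by blast
  ultimately show ?thesis by (intro exI[of _ "\<Union>n. M n"]) simp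
qed

text \<open>
  A cycle of pairs \<open>(x, y)\<close> with more arcs needed to separate \<open>x\<close> from \<open>y\<close> than \<open>y\<close> from \<open>x\<close>
  is impossible: the smallest of the cuts \<open>Y\<close> would be crossed by another pair.
\<close>

lemma connectivity_order:
  assumes \<Gamma>: "trans \<Gamma>" "irrefl \<Gamma>"
    and cuts: "\<forall>a b X. (a, b) \<in> \<Gamma> \<longrightarrow> a \<in> X \<longrightarrow> b \<notin> X \<longrightarrow> |E| \<le>o |out0 E X|"
  shows "\<exists>L. \<Gamma> \<subseteq> L \<and> trans L \<and> irrefl L \<and> (\<forall>x y. x \<noteq> y \<longrightarrow> (x, y) \<in> L \<or> (y, x) \<in> L) \<and>
    (\<forall>x y Y. y \<in> Y \<longrightarrow> x \<notin> Y \<longrightarrow> (\<forall>X. x \<in> X \<longrightarrow> y \<notin> X \<longrightarrow> |out0 E Y| <o |out0 E X| ) \<longrightarrow> (x, y) \<in> L)"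
proof -
  \<comment> \<open>\<open>Y\<close> witnesses that separating \<open>y\<close> from
    \<open>x\<close> is strictly cheaper than separating \<open>x\<close> from
    \<open>y\<close>.\<close>
  define wit where "wit x y Y \<longleftrightarrow> y \<in> Y \<and> x \<notin> Y \<and>
    (\<forall>X. x \<in> X \<longrightarrow> y \<notin> X \<longrightarrow> |out0 E Y| <o |out0 E X| )" for x y Y
  define G where "G = {(x, y). \<exists>Y. wit x y Y}"
  have noG: "(y, x) \<notin> (G \<union> \<Gamma>)\<^sup>*" if xy: "(x, y) \<in> G" for x y
  proof
    assume yx: "(y, x) \<in> (G \<union> \<Gamma>)\<^sup>*"
    define P where "P Y \<longleftrightarrow> (\<exists>x y. wit x y Y \<and> (y, x) \<in> (G \<union> \<Gamma>)\<^sup>*)" for Y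
    obtain Y0 where "P Y0" using xy yx unfolding G_def P_def by blast
    then obtain Y where "P Y" and min: "\<And>Z. P Z \<Longrightarrow> |out0 E Y| \<le>o |out0 E Z|"
      using exists_minimal_card[of P Y0 "out0 E"] by metis
    then obtain u w where w: "wit u w Y" "(w, u) \<in> (G \<union> \<Gamma>)\<^sup>*" unfolding P_def by blast
    have "w \<in> Y" "u \<notin> Y" using w(1) unfolding wit_def by blast+
    then obtain a b where ab: "(w, a) \<in> (G \<union> \<Gamma>)\<^sup>*" "(a, b) \<in> G \<union> \<Gamma>" "(b, u) \<in> (G \<union> \<Gamma>)\<^sup>*"
      "a \<in> Y" "b \<notin> Y" using rtrancl_leaves[OF w(2)] by metis
    have uw: "(u, w) \<in> G" using w(1) unfolding G_def by blast
    have ba: "(b, a) \<in> (G \<union> \<Gamma>)\<^sup>*"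
      using ab(3) uw ab(1) by (meson UnI1 rtrancl_into_rtrancl rtrancl_trans)
    show False
    proof (cases "(a, b) \<in> G")
      case True
      then obtain Z where Z: "wit a b Z" unfolding G_def by blast
      then have "P Z" using ba unfolding P_def by blast
      moreover have "|out0 E Z| <o |out0 E Y|" using Z ab(4,5) unfolding wit_def by blast
      ultimately show False using min by (simp add: card_of_less_iff)
    next
      case False
      \<comment> \<open>A pair of \<Gamma> leaving \<open>Y\<close> forces the full size
        \<open>|E|\<close> on this cut, while a witness cut is smaller than the cut of
        \<open>{u}\<close>, hence smaller than \<open>|E|\<close>.\<close>
      then have "|E| \<le>o |out0 E Y|" using ab cuts by blast
      moreover have "|out0 E Y| <o |out0 E {u}|"
        using w(1) \<open>w \<in> Y\<close> \<open>u \<notin> Y\<close> unfolding wit_def by blast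
      moreover have "|out0 E {u}| \<le>o |E|" by (rule card_of_mono1) (auto simp: out_def)
      ultimately have "|E| <o |E|"
        by (rule ordLeq_ordLess_trans[OF _ ordLess_ordLeq_trans])
      then show False using ordLess_irreflexive by blast
    qed
  qed
  have "(a, b) \<in> \<Gamma>\<^sup>+ \<or> (\<exists>(x, y)\<in>G. (a, x) \<in> (G \<union> \<Gamma>)\<^sup>* \<and> (y, b) \<in> (G \<union> \<Gamma>)\<^sup>*)"
    if "(a, b) \<in> (G \<union> \<Gamma>)\<^sup>+" for a b
    using that
  proof (induction rule: trancl_induct)
    case (base b)
    then show ?case by auto
  next
    case (step b c)
    then show ?case by (auto intro: rtrancl_into_rtrancl trancl_into_rtrancl trancl_into_trancl)
  qed
  moreover have "\<Gamma>\<^sup>+ = \<Gamma>" using \<Gamma>(1) by simp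
  ultimately have "(a, a) \<in> \<Gamma> \<or> (\<exists>(x, y)\<in>G. (a, x) \<in> (G \<union> \<Gamma>)\<^sup>* \<and> (y, a) \<in> (G \<union> \<Gamma>)\<^sup>*)"
    if "(a, a) \<in> (G \<union> \<Gamma>)\<^sup>+" for a using that by metis
  moreover have "\<not> (\<exists>(x, y)\<in>G. (a, x) \<in> (G \<union> \<Gamma>)\<^sup>* \<and> (y, a) \<in> (G \<union> \<Gamma>)\<^sup>*)" for a
    using noG rtrancl_trans[of _ a "G \<union> \<Gamma>"] by blast
  ultimately have "acyclic (G \<union> \<Gamma>)"
    unfolding acyclic_def using \<Gamma>(2) unfolding irrefl_def by blast
  then obtain L where L: "G \<union> \<Gamma> \<subseteq> L" "trans L" "irrefl L" "\<And>x y. x \<noteq> y \<Longrightarrow> (x, y) \<in> L \<or> (y, x) \<in> L"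
    using acyclic_linear_extension by blast
  have "(x, y) \<in> L" if "y \<in> Y" "x \<notin> Y" "\<forall>X. x \<in> X \<longrightarrow> y \<notin> X \<longrightarrow> |out0 E Y| <o |out0 E X|" for x y Y
  proof -
    have "(x, y) \<in> G" using that unfolding G_def wit_def by blast
    with L(1) show ?thesis by blast
  qed
  with L show ?thesis by (intro exI[of _ L]) auto
qed

section \<open>Decomposition into countable pieces\<close>

text \<open>Reachability and settledness are demanded within pieces only. As every cycle lies in one
  piece, its weight can be read off there, and disjoint pieces can be flipped independently of each
  other.\<close>

definition resolves :: "'v rel \<Rightarrow> 'e set \<Rightarrow> 'e set \<Rightarrow> 'e set set \<Rightarrow> bool" where
  "resolves lt E F \<Q> \<longleftrightarrow> \<Union>\<Q> = E \<and> disjoint \<Q> \<and>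
     (\<forall>q\<in>\<Q>. countable q \<and> below q F {} \<and> settled lt F q) \<and>
     (\<forall>p. set p \<subseteq> E \<longrightarrow> cyc F p \<longrightarrow> (\<exists>q\<in>\<Q>. set p \<subseteq> q))"

section \<open>Cycles that meet two parts\<close>

lemma cyc_rotate:
  assumes "cyc F (xs @ ys)"
  shows "cyc F (ys @ xs)"
proof -
  have eq: "ys @ xs = rotate (length xs) (xs @ ys)" by (simp add: rotate_append)
  have "map (fh F) (rotate (length xs) (xs @ ys)) = rotate (length xs) (rotate1 (map (ft F) (xs @ ys)))"
    using assms unfolding cyc_def by (simp only: rotate_map[symmetric])
  also have "\<dots> = rotate1 (map (ft F) (rotate (length xs) (xs @ ys)))"
    by (simp only: rotate_map[symmetric] rotate1_rotate_swap)
  finally have "map (fh F) (ys @ xs) = rotate1 (map (ft F) (ys @ xs))" unfolding eq .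
  moreover have "distinct (map (ft F) (ys @ xs))" using assms unfolding cyc_def by auto
  moreover have "ys @ xs \<noteq> []" using assms unfolding cyc_def by auto
  ultimately show ?thesis unfolding cyc_def by blast
qed

lemma walk_reach:
  assumes "xs \<noteq> []" "map (fh F) xs = tl (map (ft F) xs) @ [v]"
  shows "(ft F (hd xs), v) \<in> (adj F (set xs))\<^sup>*"
  using assms
proof (induction xs)
  case (Cons e xs)
  show ?case
  proof (cases xs)
    case Nil
    with Cons.prems show ?thesis using adjI[of e "{e}" F] by auto
  next
    case (Cons e' ys)
    with Cons.IH Cons.prems have "(ft F e', v) \<in> (adj F (set xs))\<^sup>*" by simp
    moreover have "adj F (set xs) \<subseteq> adj F (set (e # xs))" by (auto simp: adj_def)
    ultimately have "(ft F e', v) \<in> (adj F (set (e # xs)))\<^sup>*" using rtrancl_mono by blast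
    moreover have "fh F e = ft F e'" using Cons.prems Cons by simp
    moreover have "(ft F e, fh F e) \<in> adj F (set (e # xs))" by (simp add: adj_def)
    ultimately show ?thesis by (simp add: converse_rtrancl_into_rtrancl)
  qed
qed simp

lemma cyc_append:
  assumes "cyc F (xs @ ys)" "xs \<noteq> []" "ys \<noteq> []"
  shows "(ft F (hd xs), ft F (hd ys)) \<in> (adj F (set xs))\<^sup>*" and "fh F (last xs) = ft F (hd ys)"
proof -
  have "map (fh F) xs @ map (fh F) ys = rotate1 (map (ft F) xs @ map (ft F) ys)"
    using assms(1) unfolding cyc_def by simp
  also have "\<dots> = (tl (map (ft F) xs) @ [ft F (hd ys)]) @ (tl (map (ft F) ys) @ [ft F (hd xs)])"
    using assms(2,3) by (cases xs; cases ys) auto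
  finally have eq: "map (fh F) xs = tl (map (ft F) xs) @ [ft F (hd ys)]"
    using assms(2) by (subst (asm) append_eq_append_conv) auto
  then show "(ft F (hd xs), ft F (hd ys)) \<in> (adj F (set xs))\<^sup>*" using assms(2) by (rule walk_reach[rotated])
  show "fh F (last xs) = ft F (hd ys)"
    using arg_cong[OF eq, of last] assms(2) by (simp add: last_map)
qed

text \<open>
  A cycle that meets two parts can be rotated so that it ends with a maximal segment inside \<open>A\<close>,
  whose ends are distinct and lie on arcs of \<open>B\<close>.
\<close>

lemma cyc_two_parts:
  assumes p: "cyc F p" "set p \<subseteq> A \<union> B" and AB: "A \<inter> B = {}"
    and meet: "set p \<inter> A \<noteq> {}" "set p \<inter> B \<noteq> {}"
  obtains u w where "u \<in> ends B" "w \<in> ends B" "u \<noteq> w" "(u, w) \<in> (adj F A)\<^sup>*"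
    "(w, u) \<in> (adj F (A \<union> B))\<^sup>*"
proof -
  obtain b where "b \<in> set p" "b \<in> B" using meet(2) by blast
  then obtain ys zs where p0: "p = ys @ b # zs" by (auto simp: in_set_conv_decomp)
  define p1 where "p1 = b # zs @ ys"
  have c1: "cyc F p1" using p(1) cyc_rotate[of F ys "b # zs"] by (simp add: p0 p1_def)
  have s1: "set p1 = set p" by (auto simp: p0 p1_def)
  have "\<exists>x\<in>set p1. x \<in> A" using meet(1) s1 by blast
  then obtain us c vs where p1: "p1 = us @ c # vs" "c \<in> A" "\<forall>v\<in>set vs. v \<notin> A"
    by (rule split_list_last_propE)
  have us: "us \<noteq> []" using p1(1,2) \<open>b \<in> B\<close> AB by (cases us) (auto simp: p1_def)
  \<comment> \<open>Moving the arcs behind the last arc of \<open>A\<close> to the front makes the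
    list start in \<open>B\<close> and end in \<open>A\<close>; the arcs behind the last arc of
    \<open>B\<close> then form the wanted segment.\<close>
  define p2 where "p2 = vs @ us @ [c]"
  have c2: "cyc F p2" using c1 cyc_rotate[of F "us @ [c]" vs] by (simp add: p1 p2_def)
  have s2: "set p2 = set p" using s1 by (auto simp: p1 p2_def)
  have hd2: "hd p2 \<in> B"
  proof (cases vs)
    case Nil
    then show ?thesis using us p1(1) \<open>b \<in> B\<close> by (cases us) (auto simp: p1_def p2_def)
  next
    case (Cons v vs')
    then have "v \<in> set p2" by (simp add: p2_def)
    then have "v \<in> A \<union> B" using p(2) s2 by blast
    then show ?thesis using Cons p1(3) by (simp add: p2_def)
  qed
  have "\<exists>x\<in>set p2. x \<in> B" using meet(2) s2 by blast
  then obtain xs d rs where p2: "p2 = xs @ d # rs" "d \<in> B" "\<forall>v\<in>set rs. v \<notin> B"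
    by (rule split_list_last_propE)
  have rs: "rs \<noteq> []"
  proof
    assume "rs = []"
    then have "last p2 = d" using p2(1) by simp
    then show False using p2(2) p1(2) AB by (auto simp: p2_def)
  qed
  define ps where "ps = xs @ [d]"
  have p2': "p2 = ps @ rs" "ps \<noteq> []" by (simp_all add: p2 ps_def)
  have c3: "cyc F (ps @ rs)" using c2 p2' by simp
  have rsA: "set rs \<subseteq> A" using p2(3) p2'(1) s2 p(2) by auto
  have hds: "hd ps = hd p2" "hd ps \<in> set p2" using p2' by (auto simp: hd_append)
  show thesis
  proof (rule that)
    show "ft F (hd rs) \<in> ends B"
      using cyc_append(2)[OF c3 p2'(2) rs] fh_in_ends[OF p2(2), of F] by (simp add: ps_def)
    show "ft F (hd ps) \<in> ends B" using ft_in_ends[OF hd2] hds by simp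
    show "ft F (hd rs) \<noteq> ft F (hd ps)"
      using c3 p2'(2) rs unfolding cyc_def by (cases ps; cases rs) auto
    show "(ft F (hd rs), ft F (hd ps)) \<in> (adj F A)\<^sup>*"
      using cyc_append(1)[OF cyc_rotate[OF c3] rs p2'(2)] rtrancl_mono[OF adj_mono[OF rsA]] by blast
    have "set ps \<subseteq> A \<union> B" using p2'(1) s2 p(2) by auto
    then show "(ft F (hd ps), ft F (hd rs)) \<in> (adj F (A \<union> B))\<^sup>*"
      using cyc_append(1)[OF c3 p2'(2) rs] rtrancl_mono[OF adj_mono, of "set ps" "A \<union> B" F] by blast
  qed
qed

end

text \<open>
  One step of the chain: the arcs of \<open>M\<close> are split into those of \<open>B\<close>, which come from earlier
  pieces, and the new piece \<open>P\<close>.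
\<close>

locale chain_step = flips t h for t h :: "'e \<Rightarrow> 'v" +
  fixes F B P :: "'e set" and \<Gamma> \<Delta> :: "'v rel"
  assumes seg: "\<And>x y. x \<in> ends B \<Longrightarrow> y \<in> ends B \<Longrightarrow> x \<noteq> y \<Longrightarrow>
      (x, y) \<in> (adj F P \<union> \<Gamma>)\<^sup>* \<Longrightarrow> (x, y) \<in> \<Delta>"
    and old: "\<And>x y. (x, y) \<in> \<Delta> \<Longrightarrow> (y, x) \<notin> (adj F B \<union> \<Delta>)\<^sup>*"
    and new: "\<And>x y. (x, y) \<in> \<Gamma> \<Longrightarrow> (y, x) \<notin> (adj F P \<union> \<Gamma>)\<^sup>*"
begin

lemma adj_B: "adj F B \<subseteq> ends B \<times> ends B"
  using adj_ends by auto

text \<open>Joined across the pair \<open>(a, b)\<close>, the two outer segments of the walk lead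
  from \<open>v\<close> to \<open>u\<close> in the new part, so \<open>(v, u)\<close> is in
  \<Delta>. The middle goes from \<open>u\<close> to \<open>v\<close> in the old part with \<Delta>,
  against \<open>old\<close>. If \<open>u = v\<close>, or if the walk stays in the new part,
  \<open>new\<close> is violated.\<close>

lemma no_closed_walk:
  assumes "(a, b) \<in> \<Gamma>"
  shows "(b, a) \<notin> (adj F (B \<union> P) \<union> \<Gamma>)\<^sup>*"
proof
  assume "(b, a) \<in> (adj F (B \<union> P) \<union> \<Gamma>)\<^sup>*"
  then have "(b, a) \<in> (adj F B \<union> (adj F P \<union> \<Gamma>))\<^sup>*" by (simp add: adj_Un Un_assoc)
  from rtrancl_Un_segments[OF this adj_B seg]
  have "\<exists>u\<in>ends B. \<exists>v\<in>ends B. (b, u) \<in> (adj F P \<union> \<Gamma>)\<^sup>* \<and> (u, v) \<in> (adj F B \<union> \<Delta>)\<^sup>* \<and>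
      (v, a) \<in> (adj F P \<union> \<Gamma>)\<^sup>*"
    using new[OF assms] by blast
  then obtain u v where uv: "u \<in> ends B" "v \<in> ends B" "(b, u) \<in> (adj F P \<union> \<Gamma>)\<^sup>*"
    "(u, v) \<in> (adj F B \<union> \<Delta>)\<^sup>*" "(v, a) \<in> (adj F P \<union> \<Gamma>)\<^sup>*" by blast
  have ab: "(a, b) \<in> (adj F P \<union> \<Gamma>)\<^sup>*" using assms by blast
  have vu: "(v, u) \<in> (adj F P \<union> \<Gamma>)\<^sup>*" using rtrancl_trans[OF uv(5) rtrancl_trans[OF ab uv(3)]] .
  show False
  proof (cases "v = u")
    case True
    then show False using new[OF assms] rtrancl_trans[OF uv(3)] uv(5) by simp
  next
    case False
    then show False using old[OF seg[OF uv(2,1) False vu]] uv(4) by blast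
  qed
qed

text \<open>A segment in \<open>P\<close> between two old vertices yields a pair of \<Delta>. On the
  way back all further segments in \<open>P\<close> are replaced by pairs of \<Delta>, which gives a
  closed walk excluded by \<open>old\<close>.\<close>

lemma cyc_in_one_part:
  assumes p: "cyc F p" "set p \<subseteq> B \<union> P" and BP: "B \<inter> P = {}" "set p \<inter> P \<noteq> {}"
  shows "set p \<subseteq> P"
proof (rule ccontr)
  assume "\<not> set p \<subseteq> P"
  then have "set p \<inter> B \<noteq> {}" using p(2) by blast
  moreover have "set p \<subseteq> P \<union> B" "P \<inter> B = {}" using p(2) BP(1) by auto
  ultimately obtain u w where uw: "u \<in> ends B" "w \<in> ends B" "u \<noteq> w" "(u, w) \<in> (adj F P)\<^sup>*"
    "(w, u) \<in> (adj F (P \<union> B))\<^sup>*"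
    using cyc_two_parts[OF p(1) _ _ BP(2)] by metis
  have mono: "(adj F P)\<^sup>* \<subseteq> (adj F P \<union> \<Gamma>)\<^sup>*" by (intro rtrancl_mono) simp
  have d: "(u, w) \<in> \<Delta>" using seg[OF uw(1-3)] uw(4) mono by blast
  have "adj F (P \<union> B) \<subseteq> adj F B \<union> (adj F P \<union> \<Gamma>)" by (auto simp: adj_Un)
  from rtrancl_mono[OF this] uw(5) have "(w, u) \<in> (adj F B \<union> (adj F P \<union> \<Gamma>))\<^sup>*" by blast
  from rtrancl_Un_segments[OF this adj_B seg] have "(w, u) \<in> (adj F B \<union> \<Delta>)\<^sup>*"
  proof
    assume "(w, u) \<in> (adj F P \<union> \<Gamma>)\<^sup>*"
    then have "(w, u) \<in> \<Delta>" using seg[OF uw(2,1)] uw(3) by blast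
    then show ?thesis by blast
  next
    have shortcut: "(x, y) \<in> (adj F B \<union> \<Delta>)\<^sup>*"
      if "x \<in> ends B" "y \<in> ends B" "(x, y) \<in> (adj F P \<union> \<Gamma>)\<^sup>*" for x y
      using that seg[OF that(1,2)] by (cases "x = y") auto
    assume "\<exists>x\<in>ends B. \<exists>y\<in>ends B. (w, x) \<in> (adj F P \<union> \<Gamma>)\<^sup>* \<and> (x, y) \<in> (adj F B \<union> \<Delta>)\<^sup>* \<and>
      (y, u) \<in> (adj F P \<union> \<Gamma>)\<^sup>*"
    then obtain x y where xy: "x \<in> ends B" "y \<in> ends B" "(w, x) \<in> (adj F P \<union> \<Gamma>)\<^sup>*"
      "(x, y) \<in> (adj F B \<union> \<Delta>)\<^sup>*" "(y, u) \<in> (adj F P \<union> \<Gamma>)\<^sup>*" by blast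
    show ?thesis
      using rtrancl_trans[OF shortcut[OF uw(2) xy(1,3)] rtrancl_trans[OF xy(4) shortcut[OF xy(2) uw(1) xy(5)]]] .
  qed
  with old[OF d] show False by blast
qed

end

context flips
begin

text \<open>
  The chain \<open>M\<close> plays the role of an increasing sequence of elementary submodels: if a cut of
  size at most \<open>|underS r i|\<close> separates two vertices met before stage \<open>i\<close>, then such a cut lies in the
  earlier part, and any two vertices of \<open>M i\<close> that no such cut separates are equally hard to
  separate within the new part.
\<close>

definition is_chain :: "'e rel \<Rightarrow> 'e set \<Rightarrow> ('e \<Rightarrow> 'e set) \<Rightarrow> bool" where
  "is_chain r E M \<longleftrightarrow> (\<forall>i\<in>E. M i \<subseteq> E) \<and> (\<forall>i. finite (underS r i) \<longrightarrow> M i = {}) \<and>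
     (\<forall>i\<in>E. infinite (underS r i) \<longrightarrow>
        (\<Union>j\<in>underS r i. M j) \<union> under r i \<subseteq> M i \<and> |M i| \<le>o |underS r i| ) \<and>
     (\<forall>i\<in>E. \<forall>x\<in>ends (\<Union>j\<in>underS r i. M j). \<forall>y\<in>ends (\<Union>j\<in>underS r i. M j). \<forall>X.
        x \<in> X \<longrightarrow> y \<notin> X \<longrightarrow> |out0 E X| \<le>o |underS r i| \<longrightarrow>
        (\<exists>X. x \<in> X \<and> y \<notin> X \<and> |out0 E X| \<le>o |underS r i| \<and> out0 E X \<subseteq> (\<Union>j\<in>underS r i. M j))) \<and>
     (\<forall>i\<in>E. infinite (underS r i) \<longrightarrow> (\<forall>x\<in>ends (M i). \<forall>y\<in>ends (M i). x \<noteq> y \<longrightarrow>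
        (\<forall>X. x \<in> X \<longrightarrow> y \<notin> X \<longrightarrow> |underS r i| <o |out0 E X| ) \<longrightarrow>
        (\<forall>X. x \<in> X \<longrightarrow> y \<notin> X \<longrightarrow> |underS r i| \<le>o |out0 (M i - (\<Union>j\<in>underS r i. M j)) X| )))"

text \<open>Recursion along the cardinal well-order of \<open>E\<close>. Minimum cuts and the
  numberings of their arcs are chosen once, independently of the stage, so that a cut started at one
  stage is continued at the later ones.\<close>

lemma chain_exists:
  fixes E :: "'e set"
  assumes "uncountable E"
  shows "\<exists>M. is_chain ( |E| ) E M"
proof -
  define r where "r = |E|"
  have wo: "Well_order r" unfolding r_def by (rule card_of_Well_order)
  have fld: "Field r = E" unfolding r_def by (simp add: Field_card_of)
  have refl: "(i, i) \<in> r" if "i \<in> E" for i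
    using that wo fld unfolding order_on_defs refl_on_def by simp
  have total: "i \<noteq> j \<Longrightarrow> (i, j) \<in> r \<or> (j, i) \<in> r" if "i \<in> E" "j \<in> E" for i j
    using that wo fld unfolding order_on_defs total_on_def by simp
  have underS_E: "underS r i \<subseteq> E" "under r i \<subseteq> E" for i
    using fld unfolding underS_def under_def Field_def by auto
  have underS_mono: "underS r j \<subseteq> underS r i" if "(j, i) \<in> r" for i j
    using that wo unfolding order_on_defs by (intro underS_incr) auto
  have wf: "wf (r - Id)" using wo unfolding order_on_defs by simp
  have "\<forall>x y. x \<noteq> y \<longrightarrow> (\<exists>X. x \<in> X \<and> y \<notin> X \<and> (\<forall>Z. x \<in> Z \<longrightarrow> y \<notin> Z \<longrightarrow> |out0 E X| \<le>o |out0 E Z| ))"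
  proof (intro allI impI)
    fix x y :: 'v assume "x \<noteq> y"
    then obtain X where "x \<in> X \<and> y \<notin> X" "\<And>Z. x \<in> Z \<and> y \<notin> Z \<Longrightarrow> |out0 E X| \<le>o |out0 E Z|"
      using exists_minimal_card[of "\<lambda>X. x \<in> X \<and> y \<notin> X" "{x}" "out0 E"] by auto
    then show "\<exists>X. x \<in> X \<and> y \<notin> X \<and> (\<forall>Z. x \<in> Z \<longrightarrow> y \<notin> Z \<longrightarrow> |out0 E X| \<le>o |out0 E Z| )" by blast
  qed
  then obtain mc where mc: "\<And>x y. x \<noteq> y \<Longrightarrow> x \<in> mc x y \<and> y \<notin> mc x y \<and>
      (\<forall>Z. x \<in> Z \<longrightarrow> y \<notin> Z \<longrightarrow> |out0 E (mc x y)| \<le>o |out0 E Z| )"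
    by metis
  have "\<forall>X. \<exists>g. inj_on g (out0 E X) \<and> (\<forall>i\<in>E. |out0 E X| \<le>o |underS r i| \<longrightarrow> g ` out0 E X \<subseteq> underS r i)"
  proof
    fix X
    have "out0 E X \<subseteq> E" by (auto simp: out_def)
    from initial_enumeration[OF this]
    show "\<exists>g. inj_on g (out0 E X) \<and> (\<forall>i\<in>E. |out0 E X| \<le>o |underS r i| \<longrightarrow> g ` out0 E X \<subseteq> underS r i)"
      unfolding r_def by blast
  qed
  then obtain g where g: "\<And>X. inj_on (g X) (out0 E X)"
    "\<And>X i. i \<in> E \<Longrightarrow> |out0 E X| \<le>o |underS r i| \<Longrightarrow> g X ` out0 E X \<subseteq> underS r i"
    by metis
  define far where "far i x y \<longleftrightarrow> x \<noteq> y \<and> (\<forall>X. x \<in> X \<longrightarrow> y \<notin> X \<longrightarrow> |underS r i| <o |out0 E X| )" for i x y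
  define sep where "sep B i x y W \<longleftrightarrow> (infinite (underS r i) \<and> |B| \<le>o |underS r i| \<and> far i x y \<longrightarrow>
      W \<subseteq> E - B \<and> |W| \<le>o |underS r i| \<and> (\<forall>X. x \<in> X \<longrightarrow> y \<notin> X \<longrightarrow> |underS r i| \<le>o |out0 W X| ))" for B i x y W
  define W where "W B i x y = (SOME W. sep B i x y W)" for B i x y
  have "\<exists>W. sep B i x y W" for B i x y
    using many_disjoint_paths[of "underS r i" B x y E] unfolding sep_def far_def by blast
  then have "sep B i x y (W B i x y)" for B i x y
    unfolding W_def by (rule someI_ex)
  then have W: "infinite (underS r i) \<and> |B| \<le>o |underS r i| \<and> far i x y \<longrightarrow>
      W B i x y \<subseteq> E - B \<and> |W B i x y| \<le>o |underS r i| \<and>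
      (\<forall>X. x \<in> X \<longrightarrow> y \<notin> X \<longrightarrow> |underS r i| \<le>o |out0 (W B i x y) X| )" for B i x y
    unfolding sep_def .
  \<comment> \<open>Of a minimum cut, stage \<open>i\<close> receives only the arcs numbered up to
    \<open>i\<close>, since the whole cut may be too large. If it has size at most
    \<open>|underS r i|\<close>, all its numbers are below \<open>i\<close>, so it is complete
    before stage \<open>i\<close>.\<close>
  define C where "C B i x y = (if x = y then {} else {w \<in> out0 E (mc x y). g (mc x y) w \<in> under r i}) \<union>
      (if far i x y then W B i x y else {})" for B i x y
  define good where "good i B M \<longleftrightarrow> B \<union> under r i \<subseteq> M \<and> M \<subseteq> E \<and> |M| \<le>o |underS r i| \<and>
      (\<forall>x\<in>ends M. \<forall>y\<in>ends M. C B i x y \<subseteq> M)" for i B M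
  have good_ex: "\<exists>M. good i B M" if i: "i \<in> E" "infinite (underS r i)" and B: "B \<subseteq> E" "|B| \<le>o |underS r i|" for i B
  proof -
    have "under r i = insert i (underS r i)" using refl[OF i(1)] by (auto simp: under_def underS_def)
    then have "under r i = {i} \<union> underS r i" by simp
    then have under_le: "|under r i| \<le>o |underS r i|"
      using i(2) by (simp only:) (intro card_of_Un_le finite_le_infinite card_of_mono1, auto)
    have "C B i x y \<subseteq> E" for x y
      using W[of i B x y] i(2) B(2) unfolding C_def out_def by auto
    moreover have "|C B i x y| \<le>o |underS r i|" for x y
    proof -
      have "|{w \<in> out0 E (mc x y). g (mc x y) w \<in> under r i}| \<le>o |under r i|"
        by (intro iffD1[OF card_of_ordLeq] exI[of _ "g (mc x y)"])
          (auto intro: inj_on_subset[OF g(1)])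
      then have "|{w \<in> out0 E (mc x y). g (mc x y) w \<in> under r i}| \<le>o |underS r i|"
        using under_le by (rule ordLeq_transitive)
      then show ?thesis
        unfolding C_def using W[of i B x y] i(2) B(2)
        by (intro card_of_Un_le) (auto simp: card_of_empty)
    qed
    moreover have "|B \<union> under r i| \<le>o |underS r i|" using i(2) B(2) under_le by (rule card_of_Un_le)
    moreover have "B \<union> under r i \<subseteq> E" using B(1) underS_E by blast
    ultimately show ?thesis using ends_closure[OF i(2), of "C B i" E "B \<union> under r i"] unfolding good_def by blast
  qed
  define St where "St i B = (SOME M. good i B M)" for i B
  \<comment> \<open>Stages with finitely many predecessors are left empty, because the closure needs
    an infinite bound.\<close>
  define M where "M = wfrec (r - Id) (\<lambda>f i. if finite (underS r i) then {} else St i (\<Union>j\<in>underS r i. f j))"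
  have M_eq: "M i = (if finite (underS r i) then {} else St i (\<Union>j\<in>underS r i. M j))" for i
  proof -
    have "(\<Union>j\<in>underS r i. cut M (r - Id) i j) = (\<Union>j\<in>underS r i. M j)"
      by (intro SUP_cong refl) (auto simp: cut_def underS_def)
    then show ?thesis
      by (subst M_def, subst wfrec[OF wf]) (simp add: M_def[symmetric])
  qed
  define B where "B i = (\<Union>j\<in>underS r i. M j)" for i
  have good: "infinite (underS r i) \<longrightarrow> B i \<subseteq> E \<and> |B i| \<le>o |underS r i| \<and> good i (B i) (M i)" if "i \<in> E" for i
    using wf that
  proof (induction i rule: wf_induct_rule)
    case (less i)
    show ?case
    proof
      assume inf: "infinite (underS r i)"
      have *: "M j \<subseteq> E \<and> |M j| \<le>o |underS r i|" if j: "j \<in> underS r i" for j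
      proof (cases "finite (underS r j)")
        case True
        then show ?thesis using M_eq[of j] by (simp add: card_of_empty)
      next
        case False
        have ji: "(j, i) \<in> r - Id" "j \<in> E" using j underS_E unfolding underS_def by auto
        then have "good j (B j) (M j)" using less False by blast
        then have "M j \<subseteq> E" "|M j| \<le>o |underS r j|" unfolding good_def by blast+
        moreover have "|underS r j| \<le>o |underS r i|" using ji by (intro card_of_mono1 underS_mono) simp
        ultimately show ?thesis using ordLeq_transitive by blast
      qed
      have "B i \<subseteq> E" using * unfolding B_def by blast
      moreover have "|B i| \<le>o |underS r i|" unfolding B_def
        using inf * by (intro card_of_UNION_ordLeq_infinite) (simp_all add: card_of_mono1)
      moreover from calculation have "good i (B i) (St i (B i))"
        unfolding St_def using good_ex[OF less.prems inf] by (intro someI_ex[of "good i (B i)"]) blast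
      moreover have "M i = St i (B i)" using M_eq[of i] inf by (simp add: B_def)
      ultimately show "B i \<subseteq> E \<and> |B i| \<le>o |underS r i| \<and> good i (B i) (M i)" by simp
    qed
  qed
  have fin: "M i = {}" if "finite (underS r i)" for i using M_eq[of i] that by simp
  have inc: "M j \<subseteq> M i" if "i \<in> E" "(j, i) \<in> r" for i j
  proof (cases "finite (underS r j) \<or> j = i")
    case False
    then have "infinite (underS r i)" using underS_mono[OF that(2)] finite_subset by blast
    then have "B i \<subseteq> M i" using good[OF that(1)] unfolding good_def by blast
    moreover have "M j \<subseteq> B i" using that False unfolding B_def underS_def by blast
    ultimately show ?thesis by blast
  qed (use fin in auto)
  show ?thesis
    unfolding r_def[symmetric] is_chain_def
  proof (intro exI[of _ M] conjI ballI allI impI)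
    show "M i = {}" if "finite (underS r i)" for i using that by (rule fin)
    show "M i \<subseteq> E" if "i \<in> E" for i
      using good[OF that] fin[of i] unfolding good_def by (cases "finite (underS r i)") auto
    show "(\<Union>j\<in>underS r i. M j) \<union> under r i \<subseteq> M i" "|M i| \<le>o |underS r i|"
      if "i \<in> E" "infinite (underS r i)" for i
      using good[OF that(1)] that(2) unfolding good_def B_def by blast+
    show "|underS r i| \<le>o |out0 (M i - (\<Union>j\<in>underS r i. M j)) X|"
      if i: "i \<in> E" "infinite (underS r i)" and xy: "x \<in> ends (M i)" "y \<in> ends (M i)" "x \<noteq> y"
        and cuts: "\<forall>X. x \<in> X \<longrightarrow> y \<notin> X \<longrightarrow> |underS r i| <o |out0 E X|" and X: "x \<in> X" "y \<notin> X" for i x y X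
    proof -
      have far: "far i x y" using xy(3) cuts unfolding far_def by blast
      have gd: "|B i| \<le>o |underS r i|" "good i (B i) (M i)" using good[OF i(1)] i(2) by blast+
      have "C (B i) i x y \<subseteq> M i" using gd(2) xy unfolding good_def by blast
      then have "W (B i) i x y \<subseteq> M i" using far unfolding C_def by auto
      moreover have W': "W (B i) i x y \<subseteq> E - B i" "|underS r i| \<le>o |out0 (W (B i) i x y) X|"
        using W[of i "B i" x y] i(2) gd(1) far X by blast+
      ultimately have "W (B i) i x y \<subseteq> M i - B i" by blast
      then have "|out0 (W (B i) i x y) X| \<le>o |out0 (M i - B i) X|" by (intro card_of_mono1 out_mono)
      with W'(2) show ?thesis unfolding B_def by (rule ordLeq_transitive)
    qed
    show "\<exists>X. x \<in> X \<and> y \<notin> X \<and> |out0 E X| \<le>o |underS r i| \<and> out0 E X \<subseteq> (\<Union>j\<in>underS r i. M j)"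
      if i: "i \<in> E" and xy: "x \<in> ends (\<Union>j\<in>underS r i. M j)" "y \<in> ends (\<Union>j\<in>underS r i. M j)"
        and X: "x \<in> X" "y \<notin> X" "|out0 E X| \<le>o |underS r i|" for i x y X
    proof -
      have ne: "x \<noteq> y" using X by blast
      note m = mc[OF ne]
      have le: "|out0 E (mc x y)| \<le>o |underS r i|" using m X ordLeq_transitive by blast
      obtain j1 j2 where j: "j1 \<in> underS r i" "x \<in> ends (M j1)" "j2 \<in> underS r i" "y \<in> ends (M j2)"
        using ends_Union[OF xy(1)] ends_Union[OF xy(2)] by blast
      have "w \<in> (\<Union>j\<in>underS r i. M j)" if w: "w \<in> out0 E (mc x y)" for w
      proof -
        let ?k = "g (mc x y) w"
        have k: "?k \<in> underS r i" using g(2)[OF i le] w by blast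
        \<comment> \<open>Applied twice, this gives a stage \<open>d\<close> before \<open>i\<close>
          that is not before \<open>j1\<close>, \<open>j2\<close> or the number of \<open>w\<close>.
          There \<open>x\<close> and \<open>y\<close> are present and \<open>w\<close> is among the
          arcs added.\<close>
        have max2: "\<exists>c\<in>underS r i. (a, c) \<in> r \<and> (b, c) \<in> r" if "a \<in> underS r i" "b \<in> underS r i" for a b
          using that total[of a b] refl[of a] refl[of b] underS_E(1)[of i] by (cases "a = b") blast+
        obtain c where c: "c \<in> underS r i" "(j1, c) \<in> r" "(j2, c) \<in> r" using max2[OF j(1,3)] by blast
        obtain d where d: "d \<in> underS r i" "(c, d) \<in> r" "(?k, d) \<in> r" using max2[OF c(1) k] by blast
        have dE: "d \<in> E" "c \<in> E" using d(1) c(1) underS_E(1) by blast+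
        have xd: "x \<in> ends (M d)" "y \<in> ends (M d)"
          using j(2,4) ends_mono[OF inc[OF dE(2) c(2)]] ends_mono[OF inc[OF dE(2) c(3)]]
            ends_mono[OF inc[OF dE(1) d(2)]] by blast+
        then have "infinite (underS r d)" using fin[of d] by (auto simp: ends_def)
        then have "good d (B d) (M d)" using good[OF dE(1)] by blast
        then have "C (B d) d x y \<subseteq> M d" using xd unfolding good_def by blast
        moreover have "w \<in> C (B d) d x y" using w d(3) ne unfolding C_def under_def by simp
        ultimately show ?thesis using d(1) by blast
      qed
      with m le show ?thesis by blast
    qed
  qed
qed

section \<open>Assembling the orientation along the chain\<close>

lemma resolves_cong:
  assumes "F \<inter> E = F' \<inter> E" "resolves lt E F \<Q>"
  shows "resolves lt E F' \<Q>"
proof -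
  have Q1: "\<Union>\<Q> = E" and Q2: "disjoint \<Q>"
    using assms(2) by (simp_all add: resolves_def)
  have Q3: "\<forall>q\<in>\<Q>. countable q \<and> below q F {} \<and> settled lt F q"
    using assms(2) unfolding resolves_def by (elim conjE)
  have Q4: "\<forall>p. set p \<subseteq> E \<longrightarrow> cyc F p \<longrightarrow> (\<exists>q\<in>\<Q>. set p \<subseteq> q)"
    using assms(2) unfolding resolves_def by (elim conjE)
  have "countable q \<and> below q F' {} \<and> settled lt F' q" if q: "q \<in> \<Q>" for q
  proof -
    have "F \<inter> q = F' \<inter> q" using q Q1 assms(1) by blast
    then have "below q F {} = below q F' {}" "settled lt F q = settled lt F' q"
      by (intro below_cong settled_cong; simp)+
    with bspec[OF Q3 q] show ?thesis by simp
  qed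
  moreover have "\<exists>q\<in>\<Q>. set p \<subseteq> q" if p: "set p \<subseteq> E" "cyc F' p" for p
  proof -
    have "F \<inter> set p = F' \<inter> set p" using p(1) assms(1) by blast
    then have "cyc F p" using cyc_cong[of F p F'] p(2) by simp
    then show ?thesis using Q4 p(1) by blast
  qed
  ultimately show ?thesis unfolding resolves_def using Q1 Q2 by (intro conjI ballI allI impI) auto
qed

lemma resolve_countable:
  assumes "countable E" "trans \<Gamma>" "irrefl \<Gamma>"
    and "\<And>a b X. (a, b) \<in> \<Gamma> \<Longrightarrow> a \<in> X \<Longrightarrow> b \<notin> X \<Longrightarrow> infinite (out0 E X)"
  shows "\<exists>F \<Q>. F \<subseteq> E \<and> resolves lt E F \<Q> \<and> (\<forall>(a, b)\<in>\<Gamma>. (b, a) \<notin> (adj F E \<union> \<Gamma>)\<^sup>*)"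
proof -
  have "\<exists>F. below E F {} \<and> settled lt F E \<and> (\<forall>(a, b)\<in>\<Gamma>. (b, a) \<notin> (adj F E \<union> \<Gamma>)\<^sup>*)"
    by (rule countable_settled[OF assms(1-3)]) (rule assms(4))
  then obtain F where F: "below E F {}" "settled lt F E" "\<forall>(a, b)\<in>\<Gamma>. (b, a) \<notin> (adj F E \<union> \<Gamma>)\<^sup>*"
    by blast
  have eq: "F \<inter> E = (F \<inter> E) \<inter> E" by blast
  have "resolves lt E F {E}" unfolding resolves_def using F(1,2) assms(1) by auto
  then have "resolves lt E (F \<inter> E) {E}" by (rule resolves_cong[OF eq])
  with F(3) show ?thesis
    by (intro exI[of _ "F \<inter> E"] exI[of _ "{E}"]) (simp add: adj_cong[OF eq, symmetric])
qed

text \<open>Two vertices may be hard to separate in both directions, and a later part could join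
  them either way. The linear order \<open>L\<close> decides for all stages at once which way is
  allowed. \<open>G i\<close> holds the allowed pairs at stage \<open>i\<close> and is the \<Gamma>
  prescribed for the new part \<open>P i\<close>; \<open>\<Delta> i\<close> holds those between
  vertices of earlier parts.\<close>

lemma resolve_uncountable:
  assumes unc: "uncountable E" and \<Gamma>: "trans \<Gamma>" "irrefl \<Gamma>"
    and cuts: "\<And>a b X. (a, b) \<in> \<Gamma> \<Longrightarrow> a \<in> X \<Longrightarrow> b \<notin> X \<Longrightarrow> infinite (out0 E X) \<and> |E| \<le>o |out0 E X|"
    and IH: "\<And>E' \<Gamma>'. |E'| <o |E| \<Longrightarrow> trans \<Gamma>' \<Longrightarrow> irrefl \<Gamma>' \<Longrightarrow>
      (\<And>a b X. (a, b) \<in> \<Gamma>' \<Longrightarrow> a \<in> X \<Longrightarrow> b \<notin> X \<Longrightarrow> infinite (out0 E' X) \<and> |E'| \<le>o |out0 E' X| ) \<Longrightarrow>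
      \<exists>F \<Q>. F \<subseteq> E' \<and> resolves lt E' F \<Q> \<and> (\<forall>(a, b)\<in>\<Gamma>'. (b, a) \<notin> (adj F E' \<union> \<Gamma>')\<^sup>*)"
  shows "\<exists>F \<Q>. F \<subseteq> E \<and> resolves lt E F \<Q> \<and> (\<forall>(a, b)\<in>\<Gamma>. (b, a) \<notin> (adj F E \<union> \<Gamma>)\<^sup>*)"
proof -
  define r where "r = |E|"
  have wo: "Well_order r" unfolding r_def by (rule card_of_Well_order)
  have fld: "Field r = E" unfolding r_def by (simp add: Field_card_of)
  have total: "i \<noteq> j \<Longrightarrow> (i, j) \<in> r \<or> (j, i) \<in> r" if "i \<in> E" "j \<in> E" for i j
    using that wo fld unfolding order_on_defs total_on_def by simp
  have underS_E: "underS r i \<subseteq> E" for i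
    using fld unfolding underS_def Field_def by auto
  have underS_mono: "underS r j \<subseteq> underS r i" if "(j, i) \<in> r" for i j
    using that wo unfolding order_on_defs by (intro underS_incr) auto
  have wf: "wf (r - Id)" using wo unfolding order_on_defs by simp
  have small: "|underS r i| <o |E|" if "i \<in> E" for i
    using card_of_underS[of r i] that fld by (simp add: r_def card_of_card_order_on Field_card_of)
  obtain M where M: "is_chain r E M" using chain_exists[OF unc] unfolding r_def by blast
  have M1: "\<forall>i\<in>E. M i \<subseteq> E"
    using M unfolding is_chain_def by (elim conjE)
  have M2: "\<forall>i. finite (underS r i) \<longrightarrow> M i = {}"
    using M unfolding is_chain_def by (elim conjE)
  have M3: "\<forall>i\<in>E. infinite (underS r i) \<longrightarrow>
      (\<Union>j\<in>underS r i. M j) \<union> under r i \<subseteq> M i \<and> |M i| \<le>o |underS r i|"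
    using M unfolding is_chain_def by (elim conjE)
  have M_sub: "M i \<subseteq> E" if "i \<in> E" for i
    using M1 that by (rule bspec)
  have M_fin: "M i = {}" if "finite (underS r i)" for i
    using M2[rule_format, OF that] .
  have M_inf: "(\<Union>j\<in>underS r i. M j) \<union> under r i \<subseteq> M i \<and> |M i| \<le>o |underS r i|"
    if "i \<in> E" "infinite (underS r i)" for i
    using bspec[OF M3 that(1), THEN mp, OF that(2)] .
  have M4: "\<forall>i\<in>E. \<forall>x\<in>ends (\<Union>j\<in>underS r i. M j). \<forall>y\<in>ends (\<Union>j\<in>underS r i. M j). \<forall>X.
      x \<in> X \<longrightarrow> y \<notin> X \<longrightarrow> |out0 E X| \<le>o |underS r i| \<longrightarrow>
      (\<exists>X. x \<in> X \<and> y \<notin> X \<and> |out0 E X| \<le>o |underS r i| \<and> out0 E X \<subseteq> (\<Union>j\<in>underS r i. M j))"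
    using M unfolding is_chain_def by (elim conjE)
  have M_sep: "\<exists>X. x \<in> X \<and> y \<notin> X \<and> |out0 E X| \<le>o |underS r i| \<and> out0 E X \<subseteq> (\<Union>j\<in>underS r i. M j)"
    if "i \<in> E" "x \<in> ends (\<Union>j\<in>underS r i. M j)" "y \<in> ends (\<Union>j\<in>underS r i. M j)"
       "x \<in> X" "y \<notin> X" "|out0 E X| \<le>o |underS r i|" for i x y X
    by (rule M4[rule_format, OF that])
  have M5: "\<forall>i\<in>E. infinite (underS r i) \<longrightarrow> (\<forall>x\<in>ends (M i). \<forall>y\<in>ends (M i). x \<noteq> y \<longrightarrow>
        (\<forall>X. x \<in> X \<longrightarrow> y \<notin> X \<longrightarrow> |underS r i| <o |out0 E X| ) \<longrightarrow>
        (\<forall>X. x \<in> X \<longrightarrow> y \<notin> X \<longrightarrow> |underS r i| \<le>o |out0 (M i - (\<Union>j\<in>underS r i. M j)) X| ))"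
    using M unfolding is_chain_def by (elim conjE)
  have M_conn: "|underS r i| \<le>o |out0 (M i - (\<Union>j\<in>underS r i. M j)) X|"
    if "i \<in> E" "infinite (underS r i)" "x \<in> ends (M i)" "y \<in> ends (M i)" "x \<noteq> y"
       "\<forall>X. x \<in> X \<longrightarrow> y \<notin> X \<longrightarrow> |underS r i| <o |out0 E X|" "x \<in> X" "y \<notin> X" for i x y X
    using bspec[OF bspec[OF bspec[OF M5 that(1), THEN mp, OF that(2)] that(3)] that(4), THEN mp, OF that(5),
      THEN mp, OF that(6), THEN spec, THEN mp, OF that(7), THEN mp, OF that(8)] .
  have cuts': "\<forall>a b X. (a, b) \<in> \<Gamma> \<longrightarrow> a \<in> X \<longrightarrow> b \<notin> X \<longrightarrow> |E| \<le>o |out0 E X|"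
    using cuts by blast
  from connectivity_order[OF \<Gamma> cuts']
  obtain L where L: "\<Gamma> \<subseteq> L" "trans L" "irrefl L" "\<forall>x y. x \<noteq> y \<longrightarrow> (x, y) \<in> L \<or> (y, x) \<in> L"
    and L': "\<forall>x y Y. y \<in> Y \<longrightarrow> x \<notin> Y \<longrightarrow>
      (\<forall>X. x \<in> X \<longrightarrow> y \<notin> X \<longrightarrow> |out0 E Y| <o |out0 E X| ) \<longrightarrow> (x, y) \<in> L"
    by (elim exE conjE)
  have L_conn: "(x, y) \<in> L" if "y \<in> Y" "x \<notin> Y" "\<forall>X. x \<in> X \<longrightarrow> y \<notin> X \<longrightarrow> |out0 E Y| <o |out0 E X|" for x y Y
    using L' that by blast
  define B where "B i = (\<Union>j\<in>underS r i. M j)" for i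
  define P where "P i = M i - B i" for i
  define far where "far i x y \<longleftrightarrow> (\<forall>X. x \<in> X \<longrightarrow> y \<notin> X \<longrightarrow> |underS r i| <o |out0 E X| )" for i x y
  define G where "G i = {(x, y). x \<in> ends (M i) \<and> y \<in> ends (M i) \<and> (x, y) \<in> L \<and> far i x y}" for i
  define \<Delta> where "\<Delta> i = {(x, y). x \<in> ends (B i) \<and> y \<in> ends (B i) \<and> (x, y) \<in> L \<and> far i x y}" for i
  have L_irr: "(x, y) \<in> L \<Longrightarrow> x \<noteq> y" for x y using L(3) by (auto simp: irrefl_def)
  have L_asym: "(x, y) \<in> L \<Longrightarrow> (y, x) \<notin> L" for x y
    using transD[OF L(2), of x y x] L_irr[of x x] by blast
  have M_mono: "M i \<subseteq> M j" if "(i, j) \<in> r" "j \<in> E" for i j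
  proof (cases "i = j \<or> finite (underS r i)")
    case False
    then have "infinite (underS r j)" using underS_mono[OF that(1)] finite_subset by blast
    then have "B j \<subseteq> M j" using M_inf[OF that(2)] unfolding B_def by blast
    moreover have "M i \<subseteq> B j" using that(1) False unfolding B_def underS_def by blast
    ultimately show ?thesis by blast
  qed (use M_fin in auto)
  have M_chain: "M i \<subseteq> M j \<or> M j \<subseteq> M i" if "i \<in> E" "j \<in> E" for i j
    using total[OF that] M_mono[of i j] M_mono[of j i] that by blast
  have BP: "M i = B i \<union> P i" "B i \<inter> P i = {}" if "i \<in> E" for i
  proof -
    have "B i \<subseteq> M i"
    proof (cases "finite (underS r i)")
      case True
      then have "M j = {}" if "j \<in> underS r i" for j
        using that underS_mono[of j i] M_fin[of j] finite_subset unfolding underS_def by blast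
      then show ?thesis by (auto simp: B_def)
    qed (use M_inf[OF that] in \<open>auto simp: B_def\<close>)
    then show "M i = B i \<union> P i" "B i \<inter> P i = {}" by (auto simp: P_def)
  qed
  have P_le: "|P i| \<le>o |underS r i|" if "i \<in> E" for i
  proof (cases "finite (underS r i)")
    case True
    then show ?thesis using M_fin[OF True] by (simp add: P_def card_of_empty)
  next
    case False
    have "|P i| \<le>o |M i|" by (rule card_of_mono1) (auto simp: P_def)
    also have "|M i| \<le>o |underS r i|" using M_inf[OF that False] by blast
    finally show ?thesis .
  qed
  have P_disj: "P i \<inter> P j = {}" if "i \<in> E" "j \<in> E" "i \<noteq> j" for i j
  proof -
    have "P i \<subseteq> B j \<or> P j \<subseteq> B i" using total[OF that(1,2)] that(3) by (auto simp: P_def B_def underS_def)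
    then show ?thesis by (auto simp: P_def)
  qed
  have cover: "\<exists>i\<in>E. e \<in> M i" if e: "e \<in> E" for e
  proof (cases "finite (underS r e)")
    case False
    have "e \<in> under r e" using e wo fld unfolding under_def order_on_defs refl_on_def by simp
    then show ?thesis using M_inf[OF e False] e by blast
  next
    case True
    obtain i where i: "i \<in> E" "infinite (underS r i)" using ex_infinite_underS[OF unc] unfolding r_def by blast
    have "(i, e) \<notin> r" using underS_mono[of i e] True i(2) finite_subset by blast
    then have "e \<in> under r i" using total[OF i(1) e] True i(2) unfolding under_def by blast
    then show ?thesis using M_inf[OF i] i(1) by blast
  qed
  have coverP: "\<exists>i\<in>E. e \<in> P i" if e: "e \<in> E" for e
  proof -
    obtain i0 where "i0 \<in> {i \<in> E. e \<in> M i}" using cover[OF e] by blast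
    then obtain i where i: "i \<in> {i \<in> E. e \<in> M i}" and min: "\<And>j. (j, i) \<in> r - Id \<Longrightarrow> j \<notin> {i \<in> E. e \<in> M i}"
      by (rule wfE_min[OF wf]) (rule that)
    have "e \<notin> B i" using min underS_E[of i] unfolding B_def underS_def by blast
    with i show ?thesis by (auto simp: P_def)
  qed
  have G_trans: "trans (G i)" for i
  proof (rule transI)
    fix x y z assume xyz: "(x, y) \<in> G i" "(y, z) \<in> G i"
    then have "(x, y) \<in> L" "(y, z) \<in> L" "far i x z" unfolding G_def far_def by blast+
    with xyz transD[OF L(2), of x y z] show "(x, z) \<in> G i" unfolding G_def by simp
  qed
  have G_irr: "irrefl (G i)" for i using L_irr unfolding irrefl_def G_def by blast
  have "\<exists>F \<Q>. F \<subseteq> P i \<and> resolves lt (P i) F \<Q> \<and> (\<forall>(a, b)\<in>G i. (b, a) \<notin> (adj F (P i) \<union> G i)\<^sup>*)"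
    if i: "i \<in> E" for i
  proof (rule IH[OF _ G_trans G_irr])
    show "|P i| <o |E|" using P_le[OF i] small[OF i] by (rule ordLeq_ordLess_trans)
    fix a b X assume ab: "(a, b) \<in> G i" and X: "a \<in> X" "b \<notin> X"
    have inf: "infinite (underS r i)" using ab M_fin[of i] by (auto simp: G_def ends_def)
    have le: "|underS r i| \<le>o |out0 (P i) X|"
      unfolding P_def B_def
      by (rule M_conn[OF i inf _ _ _ _ X]) (use ab L_irr in \<open>auto simp: G_def far_def\<close>)
    show "infinite (out0 (P i) X) \<and> |P i| \<le>o |out0 (P i) X|"
      using card_of_ordLeq_infinite[OF le inf] ordLeq_transitive[OF P_le[OF i] le] by blast
  qed
  then have "\<forall>i\<in>E. \<exists>FQ. fst FQ \<subseteq> P i \<and> resolves lt (P i) (fst FQ) (snd FQ) \<and>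
      (\<forall>(a, b)\<in>G i. (b, a) \<notin> (adj (fst FQ) (P i) \<union> G i)\<^sup>*)" by simp
  from bchoice[OF this] obtain FQ where FQ: "\<forall>i\<in>E. fst (FQ i) \<subseteq> P i \<and> resolves lt (P i) (fst (FQ i)) (snd (FQ i)) \<and>
      (\<forall>(a, b)\<in>G i. (b, a) \<notin> (adj (fst (FQ i)) (P i) \<union> G i)\<^sup>*)" by blast
  have FQ1: "fst (FQ i) \<subseteq> P i" and FQ2: "resolves lt (P i) (fst (FQ i)) (snd (FQ i))"
    and FQ3: "\<forall>(a, b)\<in>G i. (b, a) \<notin> (adj (fst (FQ i)) (P i) \<union> G i)\<^sup>*" if "i \<in> E" for i
    using bspec[OF FQ that] by simp_all
  define F where "F = (\<Union>i\<in>E. fst (FQ i))"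
  define \<Q> where "\<Q> = (\<Union>i\<in>E. snd (FQ i))"
  have F_P: "fst (FQ i) \<inter> P i = F \<inter> P i" if i: "i \<in> E" for i
  proof
    show "fst (FQ i) \<inter> P i \<subseteq> F \<inter> P i" using i by (auto simp: F_def)
    show "F \<inter> P i \<subseteq> fst (FQ i) \<inter> P i"
    proof
      fix e assume e: "e \<in> F \<inter> P i"
      then obtain j where j: "j \<in> E" "e \<in> fst (FQ j)" by (auto simp: F_def)
      then have "e \<in> P j" using FQ1 by blast
      then have "j = i" using P_disj[OF j(1) i] e by blast
      with j e show "e \<in> fst (FQ i) \<inter> P i" by blast
    qed
  qed
  have res: "resolves lt (P i) F (snd (FQ i))" if i: "i \<in> E" for i
    by (rule resolves_cong[OF F_P[OF i] FQ2[OF i]])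
  have new: "(b, a) \<notin> (adj F (P i) \<union> G i)\<^sup>*" if i: "i \<in> E" and "(a, b) \<in> G i" for i a b
    using FQ3[OF i] that(2) unfolding adj_cong[OF F_P[OF i]] by blast
  \<comment> \<open>Each piece is below its initial orientation, so a cut that no arc of
    \<open>P i\<close> left originally is left by none under \<open>F\<close>.\<close>
  have closed: "out F (P i) X = {}" if i: "i \<in> E" and X: "out0 (P i) X = {}" for i X
  proof -
    have "out F q X = {}" if q: "q \<in> snd (FQ i)" for q
    proof -
      have qP: "q \<subseteq> P i" "below q F {}" using q res[OF i] unfolding resolves_def by blast+
      then have "out0 q X = {}" using X out_mono[OF qP(1), of "{}" X] by blast
      then show ?thesis by (rule below_out_empty[OF qP(2)])
    qed
    moreover have "P i = \<Union>(snd (FQ i))" using res[OF i] unfolding resolves_def by blast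
    ultimately show ?thesis unfolding out_def by blast
  qed
  have seg: "(x, y) \<in> \<Delta> i"
    if i: "i \<in> E" and xy: "x \<in> ends (B i)" "y \<in> ends (B i)" "x \<noteq> y" "(x, y) \<in> (adj F (P i) \<union> G i)\<^sup>*" for i x y
  proof -
    have far: "far i x y"
    proof (rule ccontr)
      assume "\<not> far i x y"
      then obtain X where X: "x \<in> X" "y \<notin> X" "|out0 E X| \<le>o |underS r i|"
        unfolding far_def card_of_less_iff by blast
      \<comment> \<open>By the closure of the chain a small cut can be found inside
        \<open>B i\<close>. No arc of \<open>P i\<close> leaves it, and a pair of \<open>G i\<close>
        leaving it would require a larger cut.\<close>
      then obtain Z where Z: "x \<in> Z" "y \<notin> Z" "|out0 E Z| \<le>o |underS r i|" "out0 E Z \<subseteq> B i"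
        using M_sep[OF i xy(1,2)[unfolded B_def] X] unfolding B_def by (elim exE conjE)
      obtain a b where ab: "(a, b) \<in> adj F (P i) \<union> G i" "a \<in> Z" "b \<notin> Z"
        by (rule rtrancl_leaves[OF xy(4) Z(1,2)]) (rule that)
      have "P i \<subseteq> E" using M_sub[OF i] by (auto simp: P_def)
      then have "out0 (P i) Z \<subseteq> out0 E Z" by (rule out_mono)
      then have "out0 (P i) Z \<subseteq> B i" using Z(4) by blast
      then have "out0 (P i) Z = {}" using BP(2)[OF i] by (auto simp: out_def)
      then have "out F (P i) Z = {}" by (rule closed[OF i])
      then have "(a, b) \<notin> adj F (P i)" using ab by (auto simp: adj_def out_def)
      then have "far i a b" using ab by (auto simp: G_def)
      then show False using ab Z(3) unfolding far_def by (auto simp: card_of_less_iff)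
    qed
    have "(x, y) \<in> L"
    proof (rule ccontr)
      assume n: "(x, y) \<notin> L"
      \<comment> \<open>Suppose \<open>L\<close> allows the opposite direction. Then
        \<open>(y, x)\<close> must be hard to separate too, for otherwise the comparison of
        connectivities puts \<open>(x, y)\<close> into \<open>L\<close>. So \<open>(y, x)\<close> is
        in \<open>G i\<close>, and the walk from \<open>x\<close> to \<open>y\<close> closes
        it.\<close>
      then have yx: "(y, x) \<in> L" using L(4) xy(3) by blast
      have "far i y x"
        unfolding far_def
      proof (intro allI impI, rule ccontr)
        fix Y assume Y: "y \<in> Y" "x \<notin> Y" "\<not> |underS r i| <o |out0 E Y|"
        then have le: "|out0 E Y| \<le>o |underS r i|" by (simp add: card_of_less_iff)
        have "(x, y) \<in> L"
        proof (rule L_conn[OF Y(1,2)], intro allI impI)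
          fix X assume "x \<in> X" "y \<notin> X"
          then have "|underS r i| <o |out0 E X|" using far unfolding far_def by blast
          with le show "|out0 E Y| <o |out0 E X|" by (rule ordLeq_ordLess_trans)
        qed
        with n show False by blast
      qed
      moreover have "ends (B i) \<subseteq> ends (M i)" by (rule ends_mono) (use BP(1)[OF i] in blast)
      ultimately have "(y, x) \<in> G i" using yx xy unfolding G_def by blast
      with new[OF i] xy(4) show False by blast
    qed
    with far xy show ?thesis unfolding \<Delta>_def by blast
  qed
  \<comment> \<open>A walk is finite, so it lies in a single \<open>M j\<close> of the chain, where
    the pairs of \<open>D\<close> belong to \<open>G j\<close>. This is used for the earlier stages
    with \<open>\<Delta> i\<close>, and for all of \<open>E\<close> with \<Gamma>.\<close>
  have old: "(y, x) \<notin> (adj F (\<Union>j\<in>J. M j) \<union> D)\<^sup>*"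
    if J: "J \<subseteq> E" and Q: "\<And>j a b. j \<in> J \<Longrightarrow> (a, b) \<in> G j \<Longrightarrow> (b, a) \<notin> (adj F (M j) \<union> G j)\<^sup>*"
      and D: "\<And>j a b. j \<in> J \<Longrightarrow> (a, b) \<in> D \<Longrightarrow> a \<in> ends (M j) \<Longrightarrow> b \<in> ends (M j) \<Longrightarrow> (a, b) \<in> G j"
      "D \<subseteq> ends (\<Union>j\<in>J. M j) \<times> ends (\<Union>j\<in>J. M j)" and xy: "(x, y) \<in> D" "x \<noteq> y" for J D x y
  proof
    assume yx: "(y, x) \<in> (adj F (\<Union>j\<in>J. M j) \<union> D)\<^sup>*"
    define R where "R j = adj F (M j) \<union> (D \<inter> ends (M j) \<times> ends (M j))" for j
    have chainJ: "M j \<subseteq> M k \<or> M k \<subseteq> M j" if "j \<in> J" "k \<in> J" for j k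
      using M_chain J that by blast
    have "D \<subseteq> (\<Union>j\<in>J. R j)"
    proof
      fix ab assume ab: "ab \<in> D"
      obtain a b where ab': "ab = (a, b)" by fastforce
      obtain j where j: "j \<in> J" "a \<in> ends (M j)" using ab ab' D(2) ends_Union[of a M J] by blast
      obtain k where k: "k \<in> J" "b \<in> ends (M k)" using ab ab' D(2) ends_Union[of b M J] by blast
      have "\<exists>l\<in>J. a \<in> ends (M l) \<and> b \<in> ends (M l)"
        using chainJ[OF j(1) k(1)] j k ends_mono[of "M j" "M k"] ends_mono[of "M k" "M j"] by blast
      then show "ab \<in> (\<Union>j\<in>J. R j)" using ab ab' unfolding R_def by blast
    qed
    moreover have "adj F (\<Union>j\<in>J. M j) \<subseteq> (\<Union>j\<in>J. R j)" unfolding R_def adj_def by blast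
    ultimately have "(adj F (\<Union>j\<in>J. M j) \<union> D)\<^sup>* \<subseteq> (\<Union>j\<in>J. R j)\<^sup>*" by (intro rtrancl_mono) simp
    then have yx': "(y, x) \<in> (\<Union>j\<in>J. R j)\<^sup>*" using yx by blast
    have "\<exists>j\<in>J. (y, x) \<in> (R j)\<^sup>*"
    proof (rule rtrancl_chain_Union[OF yx'])
      fix j k assume jk: "j \<in> J" "k \<in> J"
      have "R j \<subseteq> R k" if "M j \<subseteq> M k" for j k
        using adj_mono[OF that, of F] ends_mono[OF that] unfolding R_def by blast
      then show "R j \<subseteq> R k \<or> R k \<subseteq> R j" using chainJ[OF jk] by blast
    qed (use xy in simp)
    then obtain j where j: "j \<in> J" "(y, x) \<in> (R j)\<^sup>*" by blast
    have R_ends: "a \<in> ends (M j) \<and> b \<in> ends (M j)" if "(a, b) \<in> R j" for a b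
      using that adj_ends unfolding R_def by blast
    have "x \<in> ends (M j)" using j(2) xy(2) R_ends by (metis rtranclE)
    moreover have "y \<in> ends (M j)" using j(2) xy(2) R_ends by (metis converse_rtranclE)
    ultimately have "(x, y) \<in> G j" using D(1)[OF j(1) xy(1)] by blast
    moreover have "R j \<subseteq> adj F (M j) \<union> G j" using D(1)[OF j(1)] unfolding R_def by auto
    then have "(y, x) \<in> (adj F (M j) \<union> G j)\<^sup>*" using j(2) rtrancl_mono by blast
    ultimately show False using Q[OF j(1)] by blast
  qed
  \<comment> \<open>Earlier stages have smaller thresholds, hence pairs of \<open>\<Delta> i\<close>
    belong to \<open>G j\<close> at every earlier stage that contains both vertices.\<close>
  have far_mono: "far j a b" if "far i a b" "(j, i) \<in> r" for i j a b
    using that(1) ordLeq_ordLess_trans[OF card_of_mono1[OF underS_mono[OF that(2)]]] unfolding far_def by blast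
  have step: "chain_step t h F (B i) (P i) (G i) (\<Delta> i)"
    if i: "i \<in> E" and less: "\<And>j a b. j \<in> underS r i \<Longrightarrow> (a, b) \<in> G j \<Longrightarrow> (b, a) \<notin> (adj F (M j) \<union> G j)\<^sup>*" for i
  proof
    show "(x, y) \<in> \<Delta> i" if "x \<in> ends (B i)" "y \<in> ends (B i)" "x \<noteq> y" "(x, y) \<in> (adj F (P i) \<union> G i)\<^sup>*" for x y
      using seg[OF i that] .
    show "(y, x) \<notin> (adj F (P i) \<union> G i)\<^sup>*" if "(x, y) \<in> G i" for x y
      using new[OF i that] .
    show "(y, x) \<notin> (adj F (B i) \<union> \<Delta> i)\<^sup>*" if xy: "(x, y) \<in> \<Delta> i" for x y
      unfolding B_def
    proof (rule old[OF underS_E less])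
      show "(a, b) \<in> G j" if "j \<in> underS r i" "(a, b) \<in> \<Delta> i" "a \<in> ends (M j)" "b \<in> ends (M j)" for j a b
        using that far_mono[of i a b j] unfolding G_def \<Delta>_def underS_def by blast
      show "\<Delta> i \<subseteq> ends (\<Union>j\<in>underS r i. M j) \<times> ends (\<Union>j\<in>underS r i. M j)"
        unfolding \<Delta>_def B_def by blast
      show "x \<noteq> y" using xy L_irr unfolding \<Delta>_def by blast
    qed (use xy in auto)
  qed
  have closed_M: "(b, a) \<notin> (adj F (M i) \<union> G i)\<^sup>*" if "i \<in> E" "(a, b) \<in> G i" for i a b
    using wf that
  proof (induction i arbitrary: a b rule: wf_induct_rule)
    case (less i)
    have "chain_step t h F (B i) (P i) (G i) (\<Delta> i)"
    proof (rule step[OF less.prems(1)])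
      fix j a b assume "j \<in> underS r i" "(a, b) \<in> G j"
      then show "(b, a) \<notin> (adj F (M j) \<union> G j)\<^sup>*"
        using underS_E[of i] by (intro less.IH) (auto simp: underS_def)
    qed
    from chain_step.no_closed_walk[OF this less.prems(2)] show ?case
      unfolding BP(1)[OF less.prems(1)] .
  qed
  have chain_step: "chain_step t h F (B i) (P i) (G i) (\<Delta> i)" if "i \<in> E" for i
  proof (rule step[OF that])
    fix j a b assume "j \<in> underS r i" "(a, b) \<in> G j"
    then show "(b, a) \<notin> (adj F (M j) \<union> G j)\<^sup>*" using underS_E[of i] by (intro closed_M) auto
  qed
  have cyc_piece: "\<exists>q\<in>\<Q>. set p \<subseteq> q" if p: "set p \<subseteq> E" "cyc F p" for p
  proof -
    have ne: "p \<noteq> []" using p(2) by (simp add: cyc_def)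
    have chainM: "subset.chain UNIV (M ` J)" if "J \<subseteq> E" for J
      using M_chain that by (auto simp: subset_chain_def)
    have in_one: "\<exists>j\<in>J. set p \<subseteq> M j" if J: "J \<subseteq> E" "set p \<subseteq> (\<Union>j\<in>J. M j)" for J
    proof -
      have neJ: "M ` J \<noteq> {}" using J(2) ne by auto
      obtain C where "C \<in> M ` J" "set p \<subseteq> C"
        by (rule finite_subset_Union_chain[OF List.finite_set J(2) neJ chainM[OF J(1)]]) (rule that)
      then show ?thesis by blast
    qed
    have "set p \<subseteq> (\<Union>i\<in>E. M i)" using cover p(1) by blast
    then obtain i0 where "i0 \<in> {i \<in> E. set p \<subseteq> M i}" using in_one[of E] by blast
    then obtain i where i: "i \<in> {i \<in> E. set p \<subseteq> M i}"
      and min: "\<And>j. (j, i) \<in> r - Id \<Longrightarrow> j \<notin> {i \<in> E. set p \<subseteq> M i}"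
      by (rule wfE_min[OF wf]) (rule that)
    have iE: "i \<in> E" "set p \<subseteq> B i \<union> P i" using i BP(1)[of i] by auto
    \<comment> \<open>A cycle inside the earlier stages would, being finite, lie in one of them,
      although \<open>i\<close> is the first stage that contains it.\<close>
    have "set p \<inter> P i \<noteq> {}"
    proof
      assume "set p \<inter> P i = {}"
      then have "set p \<subseteq> (\<Union>j\<in>underS r i. M j)" using iE(2) unfolding B_def by blast
      then obtain j where "j \<in> underS r i" "set p \<subseteq> M j" using in_one[OF underS_E] by blast
      then show False using min[of j] underS_E[of i] unfolding underS_def by blast
    qed
    then have "set p \<subseteq> P i"
      by (rule chain_step.cyc_in_one_part[OF chain_step[OF iE(1)] p(2) iE(2) BP(2)[OF iE(1)]])
    then obtain q where "q \<in> snd (FQ i)" "set p \<subseteq> q"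
      using res[OF iE(1)] p(2) unfolding resolves_def by blast
    then show ?thesis using iE(1) unfolding \<Q>_def by blast
  qed
  have "resolves lt E F \<Q>"
    unfolding resolves_def
  proof (intro conjI ballI allI impI)
    have UP: "\<Union>(snd (FQ i)) = P i" "disjoint (snd (FQ i))" if "i \<in> E" for i
      using res[OF that] by (simp_all add: resolves_def)
    show "\<Union>\<Q> = E"
    proof
      show "\<Union>\<Q> \<subseteq> E"
      proof
        fix e assume "e \<in> \<Union>\<Q>"
        then obtain i where i: "i \<in> E" "e \<in> \<Union>(snd (FQ i))" unfolding \<Q>_def by blast
        then have "e \<in> M i" unfolding UP(1)[OF i(1)] P_def by simp
        then show "e \<in> E" using M_sub[OF i(1)] by blast
      qed
      show "E \<subseteq> \<Union>\<Q>"
      proof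
        fix e assume "e \<in> E"
        then obtain i where i: "i \<in> E" "e \<in> P i" using coverP by blast
        then have "e \<in> \<Union>(snd (FQ i))" using UP(1)[OF i(1)] by simp
        then show "e \<in> \<Union>\<Q>" using i(1) unfolding \<Q>_def by blast
      qed
    qed
    show "disjoint \<Q>"
    proof (rule disjointI)
      fix q q' assume "q \<in> \<Q>" "q' \<in> \<Q>" and neq: "q \<noteq> q'"
      then obtain i j where ij: "i \<in> E" "j \<in> E" "q \<in> snd (FQ i)" "q' \<in> snd (FQ j)" unfolding \<Q>_def by blast
      show "q \<inter> q' = {}"
      proof (cases "i = j")
        case True
        then show ?thesis using disjointD[OF UP(2)[OF ij(2)], of q q'] ij neq by simp
      next
        case False
        then have "P i \<inter> P j = {}" by (rule P_disj[OF ij(1,2)])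
        moreover have "q \<subseteq> P i" "q' \<subseteq> P j" using UP(1) ij by blast+
        ultimately show ?thesis by blast
      qed
    qed
    fix q assume "q \<in> \<Q>"
    then obtain i where "i \<in> E" "q \<in> snd (FQ i)" unfolding \<Q>_def by blast
    then have "countable q \<and> below q F {} \<and> settled lt F q" using res[of i] by (simp add: resolves_def)
    then show "countable q" "below q F {}" "settled lt F q" by simp_all
  qed (rule cyc_piece)
  moreover have "F \<subseteq> E" using FQ1 M_sub unfolding F_def P_def by blast
  moreover have "(b, a) \<notin> (adj F E \<union> \<Gamma>)\<^sup>*" if ab: "(a, b) \<in> \<Gamma>" for a b
  proof -
    have EM: "E = (\<Union>j\<in>E. M j)" using cover M_sub by blast
    have ne: "a \<noteq> b" if "(a, b) \<in> \<Gamma>" for a b using that \<Gamma>(2) by (auto simp: irrefl_def)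
    have "(b, a) \<notin> (adj F (\<Union>j\<in>E. M j) \<union> \<Gamma>)\<^sup>*"
    proof (rule old[OF order_refl closed_M])
      show "(a, b) \<in> G j" if j: "j \<in> E" and ab: "(a, b) \<in> \<Gamma>" "a \<in> ends (M j)" "b \<in> ends (M j)" for j a b
      proof -
        have "far j a b" unfolding far_def
          using cuts[OF ab(1)] ordLess_ordLeq_trans[OF small[OF j]] by blast
        with ab L(1) show ?thesis unfolding G_def by blast
      qed
      show "\<Gamma> \<subseteq> ends (\<Union>j\<in>E. M j) \<times> ends (\<Union>j\<in>E. M j)"
        unfolding EM[symmetric]
      proof clarify
        fix a b assume ab: "(a, b) \<in> \<Gamma>"
        have "out0 E {a} \<noteq> {}" using cuts[OF ab, of "{a}"] ne[OF ab] by auto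
        moreover have "out0 E (UNIV - {b}) \<noteq> {}" using cuts[OF ab, of "UNIV - {b}"] ne[OF ab] by auto
        ultimately obtain e e' where "e \<in> E" "ft {} e = a" "e' \<in> E" "fh {} e' = b"
          by (auto simp: out_def)
        then show "a \<in> ends E \<and> b \<in> ends E" using ft_in_ends fh_in_ends by blast
      qed
    qed (use ab ne in auto)
    then show ?thesis unfolding EM[symmetric] .
  qed
  ultimately show ?thesis by blast
qed

text \<open>Prescribing \<Gamma> strengthens the claim enough for induction on \<open>|E|\<close>,
  as the parts of smaller size come with pairs of their own. The countable case rests on cuts being
  infinite, the uncountable one on their having full size.\<close>

lemma resolve:
  assumes "trans \<Gamma>" "irrefl \<Gamma>"
    and "\<And>a b X. (a, b) \<in> \<Gamma> \<Longrightarrow> a \<in> X \<Longrightarrow> b \<notin> X \<Longrightarrow> infinite (out0 E X) \<and> |E| \<le>o |out0 E X|"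
  shows "\<exists>F \<Q>. F \<subseteq> E \<and> resolves lt E F \<Q> \<and> (\<forall>(a, b)\<in>\<Gamma>. (b, a) \<notin> (adj F E \<union> \<Gamma>)\<^sup>*)"
  using wf_inv_image[OF wf_ordLess, of card_of] assms
proof (induction E arbitrary: \<Gamma> rule: wf_induct_rule)
  case (less E)
  show ?case
  proof (cases "countable E")
    case True
    show ?thesis by (rule resolve_countable[OF True less.prems(1,2)]) (use less.prems(3) in blast)
  next
    case False
    show ?thesis
    proof (rule resolve_uncountable[OF False less.prems])
      fix E' \<Gamma>' assume *: "|E'| <o |E|" "trans \<Gamma>'" "irrefl \<Gamma>'"
        "\<And>a b X. (a, b) \<in> \<Gamma>' \<Longrightarrow> a \<in> X \<Longrightarrow> b \<notin> X \<Longrightarrow> infinite (out0 E' X) \<and> |E'| \<le>o |out0 E' X|"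
      show "\<exists>F \<Q>. F \<subseteq> E' \<and> resolves lt E' F \<Q> \<and> (\<forall>(a, b)\<in>\<Gamma>'. (b, a) \<notin> (adj F E' \<union> \<Gamma>')\<^sup>*)"
        by (rule less.IH[OF _ *(2,3,4)]) (use *(1) in \<open>simp add: in_inv_image\<close>)
    qed
  qed
qed

section \<open>Two colours\<close>

primrec walk :: "'e set \<Rightarrow> 'v \<Rightarrow> 'e list \<Rightarrow> 'v \<Rightarrow> bool" where
  "walk F x [] y \<longleftrightarrow> x = y"
| "walk F x (e # p) y \<longleftrightarrow> ft F e = x \<and> walk F (fh F e) p y"

lemma walk_append: "walk F x (p @ q) z \<longleftrightarrow> (\<exists>y. walk F x p y \<and> walk F y q z)"
  by (induction p arbitrary: x) auto

lemma walk_vertices: "walk F x p y \<Longrightarrow> x # map (fh F) p = map (ft F) p @ [y]"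
  by (induction p arbitrary: x) auto

lemma walk_of_reach:
  assumes "(x, y) \<in> (adj F E)\<^sup>*"
  shows "\<exists>p. set p \<subseteq> E \<and> walk F x p y"
  using assms
proof (induction rule: converse_rtrancl_induct)
  case base
  show ?case by (rule exI[of _ "[]"]) simp
next
  case (step x z)
  then obtain p e where "set p \<subseteq> E" "walk F z p y" "e \<in> E" "ft F e = x" "fh F e = z"
    by (auto simp: adj_def)
  then show ?case by (intro exI[of _ "e # p"]) simp
qed

lemma reach_of_walk: "walk F x p y \<Longrightarrow> set p \<subseteq> E \<Longrightarrow> (x, y) \<in> (adj F E)\<^sup>*"
proof (induction p arbitrary: x)
  case (Cons e p)
  then have "(fh F e, y) \<in> (adj F E)\<^sup>*" "(x, fh F e) \<in> adj F E" by (auto simp: adj_def)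
  then show ?case by (simp add: converse_rtrancl_into_rtrancl)
qed simp

lemma wt_append: "wt lt F (p @ q) = wt lt F p + wt lt F q"
  by (simp add: wt_def)

text \<open>A repeated tail splits the closed walk into two shorter ones whose weights add up;
  without repetition it is empty or a cycle.\<close>

lemma closed_walk_nonneg:
  assumes cyc: "\<And>p. set p \<subseteq> E \<Longrightarrow> cyc F p \<Longrightarrow> 0 \<le> wt lt F p"
  shows "walk F x p x \<Longrightarrow> set p \<subseteq> E \<Longrightarrow> 0 \<le> wt lt F p"
proof (induction p arbitrary: x rule: length_induct)
  case (1 p)
  show ?case
  proof (cases "distinct (map (ft F) p)")
    case True
    show ?thesis
    proof (cases p)
      case Nil
      then show ?thesis by (simp add: wt_def)
    next
      case (Cons e q)
      have "x # map (fh F) p = map (ft F) p @ [x]" using 1(2) by (rule walk_vertices)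
      moreover have "ft F e = x" using 1(2) Cons by simp
      ultimately have "cyc F p" using True Cons by (simp add: cyc_def)
      then show ?thesis using cyc 1(3) by blast
    qed
  next
    case False
    then obtain xs ys zs v where "map (ft F) p = xs @ [v] @ ys @ [v] @ zs"
      using not_distinct_decomp by blast
    then have "map (ft F) p = xs @ v # ys @ v # zs" by simp
    then obtain p1 r1 where r1: "p = p1 @ r1" "map (ft F) r1 = v # ys @ v # zs"
      by (auto simp: map_eq_append_conv)
    from r1(2) obtain e r2 where r2: "r1 = e # r2" "ft F e = v" "map (ft F) r2 = ys @ v # zs" by auto
    from r2(3) obtain p2 r3 where r3: "r2 = p2 @ r3" "map (ft F) r3 = v # zs"
      by (auto simp: map_eq_append_conv)
    from r3(2) obtain e' p3 where r4: "r3 = e' # p3" "ft F e' = v" by auto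
    have p: "p = p1 @ e # p2 @ e' # p3" and v: "ft F e = v" "ft F e' = v"
      using r1 r2 r3 r4 by simp_all
    have w: "walk F x p1 v" "walk F v (e # p2) v" "walk F v (e' # p3) x"
      using 1(2) v unfolding p by (auto simp: walk_append)
    have "0 \<le> wt lt F (e # p2)"
      by (rule 1(1)[rule_format, OF _ w(2)]) (use 1(3) in \<open>auto simp: p\<close>)
    moreover have "0 \<le> wt lt F (p1 @ e' # p3)"
      by (rule 1(1)[rule_format, of _ x]) (use 1(3) w in \<open>auto simp: p walk_append\<close>)
    moreover have "wt lt F p = wt lt F (e # p2) + wt lt F (p1 @ e' # p3)"
      by (simp add: p wt_def)
    ultimately show ?thesis by simp
  qed
qed

lemma int_has_least:
  assumes "k \<in> S" "\<And>k. k \<in> S \<Longrightarrow> b \<le> (k :: int)"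
  shows "\<exists>m\<in>S. \<forall>k\<in>S. m \<le> k"
proof -
  obtain m where m: "m \<in> S" "\<And>k. k \<in> S \<Longrightarrow> nat (m - b) \<le> nat (k - b)"
    using ex_has_least_nat[of "\<lambda>k. k \<in> S" k "\<lambda>k. nat (k - b)"] assms(1) by blast
  have "m \<le> k" if "k \<in> S" for k
    using m(2)[OF that] assms(2)[OF that] assms(2)[OF m(1)] by simp
  with m(1) show ?thesis by blast
qed

text \<open>
  The weight of a lightest walk from a root of the strong component: along an arc of the
  component it grows by at most the weight of the arc.
\<close>

lemma potential:
  assumes cyc: "\<And>p. set p \<subseteq> E \<Longrightarrow> cyc F p \<Longrightarrow> 0 \<le> wt lt F p"
  shows "\<exists>\<pi> :: 'v \<Rightarrow> int. \<forall>e\<in>E. (fh F e, ft F e) \<in> (adj F E)\<^sup>* \<longrightarrow>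
    \<pi> (fh F e) - \<pi> (ft F e) \<le> sg lt (ft F e) (fh F e)"
proof -
  define cls where "cls x = {y. (x, y) \<in> (adj F E)\<^sup>* \<and> (y, x) \<in> (adj F E)\<^sup>*}" for x
  \<comment> \<open>The choice depends on \<open>cls x\<close> only, so a strong component has a
    single root.\<close>
  define root where "root x = (SOME y. y \<in> cls x)" for x
  have root: "root x \<in> cls x" for x
    unfolding root_def by (rule someI[of _ x]) (simp add: cls_def)
  define W where "W x = {wt lt F p |p. set p \<subseteq> E \<and> walk F (root x) p x}" for x
  have "\<exists>m\<in>W x. \<forall>k\<in>W x. m \<le> k" for x
  proof -
    have r: "(root x, x) \<in> (adj F E)\<^sup>*" "(x, root x) \<in> (adj F E)\<^sup>*" using root[of x] by (auto simp: cls_def)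
    obtain p where p: "set p \<subseteq> E" "walk F (root x) p x" using walk_of_reach[OF r(1)] by blast
    obtain q where q: "set q \<subseteq> E" "walk F x q (root x)" using walk_of_reach[OF r(2)] by blast
    show ?thesis
    proof (rule int_has_least)
      show "wt lt F p \<in> W x" using p by (auto simp: W_def)
      fix k assume "k \<in> W x"
      then obtain p' where p': "k = wt lt F p'" "set p' \<subseteq> E" "walk F (root x) p' x" by (auto simp: W_def)
      have "walk F (root x) (p' @ q) (root x)" using p'(3) q(2) by (auto simp: walk_append)
      then have "0 \<le> wt lt F (p' @ q)" using closed_walk_nonneg[OF cyc] p'(2) q(1) by simp
      \<comment> \<open>One fixed walk back to the root bounds all weights from below, since closing
        up gives a nonnegative closed walk.\<close>
      then show "- wt lt F q \<le> k" by (simp add: wt_append p'(1))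
    qed
  qed
  then obtain \<pi> where \<pi>: "\<And>x. \<pi> x \<in> W x" "\<And>x k. k \<in> W x \<Longrightarrow> \<pi> x \<le> k" by metis
  have "\<pi> (fh F e) - \<pi> (ft F e) \<le> sg lt (ft F e) (fh F e)"
    if e: "e \<in> E" "(fh F e, ft F e) \<in> (adj F E)\<^sup>*" for e
  proof -
    have fwd: "(ft F e, fh F e) \<in> (adj F E)\<^sup>*" using adjI[OF e(1)] by blast
    have "(ft F e, y) \<in> (adj F E)\<^sup>* \<longleftrightarrow> (fh F e, y) \<in> (adj F E)\<^sup>*"
      "(y, ft F e) \<in> (adj F E)\<^sup>* \<longleftrightarrow> (y, fh F e) \<in> (adj F E)\<^sup>*" for y
      using rtrancl_trans[OF fwd, of y] rtrancl_trans[OF e(2), of y]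
        rtrancl_trans[OF _ fwd, of y] rtrancl_trans[OF _ e(2), of y] by blast+
    then have "cls (ft F e) = cls (fh F e)" by (simp add: cls_def)
    then have root_eq: "root (ft F e) = root (fh F e)" by (simp add: root_def)
    obtain p where p: "\<pi> (ft F e) = wt lt F p" "set p \<subseteq> E" "walk F (root (ft F e)) p (ft F e)"
      using \<pi>(1)[of "ft F e"] by (auto simp: W_def)
    then have "walk F (root (fh F e)) (p @ [e]) (fh F e)" by (auto simp: walk_append root_eq)
    moreover have "set (p @ [e]) \<subseteq> E" using p(2) e(1) by simp
    ultimately have "wt lt F (p @ [e]) \<in> W (fh F e)" unfolding W_def by blast
    from \<pi>(2)[OF this] show ?thesis by (simp add: wt_append p(1) wt_def)
  qed
  then show ?thesis by blast
qed

lemma cyc_arc_returns: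
  assumes "cyc F p" "e \<in> set p"
  shows "(fh F e, ft F e) \<in> (adj F (set p))\<^sup>*"
proof -
  obtain ys zs where p: "p = ys @ e # zs" using assms(2) by (auto simp: in_set_conv_decomp)
  have c: "cyc F ([e] @ (zs @ ys))" using cyc_rotate[of F ys "e # zs"] assms(1) by (simp add: p)
  show ?thesis
  proof (cases "zs @ ys = []")
    case True
    then show ?thesis using assms(1) by (simp add: p cyc_def)
  next
    case False
    have "fh F e = ft F (hd (zs @ ys))" using cyc_append(2)[OF c _ False] by simp
    moreover have "(ft F (hd (zs @ ys)), ft F e) \<in> (adj F (set (zs @ ys)))\<^sup>*"
      using cyc_append(1)[OF cyc_rotate[OF c] False] by simp
    moreover have "adj F (set (zs @ ys)) \<subseteq> adj F (set p)" by (rule adj_mono) (auto simp: p)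
    ultimately show ?thesis using rtrancl_mono by (metis subsetD)
  qed
qed

text \<open>On a monochromatic cycle the potential changes along each arc by an even amount that is
  at most 1. So it never rises, and on a cycle it must be constant. Then each arc has nonnegative
  sign and goes forward in \<open>lt\<close>, which cannot happen on a cycle.\<close>

lemma two_colours:
  assumes cyc: "\<And>p. set p \<subseteq> E \<Longrightarrow> cyc F p \<Longrightarrow> 0 \<le> wt lt F p"
    and lt: "trans lt" "irrefl lt" "\<And>x y. x \<noteq> y \<Longrightarrow> (x, y) \<in> lt \<or> (y, x) \<in> lt"
    and loopfree: "\<And>e. e \<in> E \<Longrightarrow> t e \<noteq> h e"
  shows "\<exists>c :: 'v \<Rightarrow> bool. \<forall>p b. set p \<subseteq> E \<longrightarrow> cyc F p \<longrightarrow> \<not> (\<forall>e\<in>set p. c (ft F e) = b)"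
proof -
  have "\<exists>\<pi> :: 'v \<Rightarrow> int. \<forall>e\<in>E. (fh F e, ft F e) \<in> (adj F E)\<^sup>* \<longrightarrow>
      \<pi> (fh F e) - \<pi> (ft F e) \<le> sg lt (ft F e) (fh F e)"
    by (rule potential) (rule cyc)
  then obtain \<pi> :: "'v \<Rightarrow> int" where \<pi>: "\<forall>e\<in>E. (fh F e, ft F e) \<in> (adj F E)\<^sup>* \<longrightarrow>
      \<pi> (fh F e) - \<pi> (ft F e) \<le> sg lt (ft F e) (fh F e)" ..
  have "\<not> (\<forall>e\<in>set p. even (\<pi> (ft F e)) = b)" if p: "set p \<subseteq> E" "cyc F p" for p b
  proof
    assume mono: "\<forall>e\<in>set p. even (\<pi> (ft F e)) = b"
    have fh_ft: "fh F ` set p = ft F ` set p"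
      using p(2) unfolding cyc_def by (metis list.set_map set_rotate1)
    have le: "\<pi> (fh F e) - \<pi> (ft F e) \<le> 0 \<and>
        (\<pi> (fh F e) - \<pi> (ft F e) = 0 \<longrightarrow> 0 \<le> sg lt (ft F e) (fh F e))" if e: "e \<in> set p" for e
    proof -
      have "(fh F e, ft F e) \<in> (adj F E)\<^sup>*"
        using cyc_arc_returns[OF p(2) e] rtrancl_mono[OF adj_mono[OF p(1)]] by blast
      then have "\<pi> (fh F e) - \<pi> (ft F e) \<le> sg lt (ft F e) (fh F e)" using \<pi> e p(1) by blast
      moreover have "sg lt (ft F e) (fh F e) \<le> 1" by (simp add: sg_def)
      moreover have "even (\<pi> (fh F e) - \<pi> (ft F e))"
      proof -
        have "fh F e \<in> ft F ` set p" using e fh_ft by blast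
        then obtain e' where "e' \<in> set p" "fh F e = ft F e'" by blast
        then show ?thesis using mono e by simp
      qed
      then have "\<pi> (fh F e) - \<pi> (ft F e) \<noteq> 1" using odd_one by metis
      ultimately show ?thesis by linarith
    qed
    have "(\<Sum>e\<in>set p. \<pi> (fh F e) - \<pi> (ft F e)) = 0" by (rule sum_cyc[OF p(2)])
    then have "(\<Sum>e\<in>set p. \<pi> (ft F e) - \<pi> (fh F e)) = 0" by (simp add: sum_subtractf)
    then have "\<forall>e\<in>set p. \<pi> (ft F e) - \<pi> (fh F e) = 0"
      by (subst (asm) sum_nonneg_eq_0_iff) (use le in auto)
    then have zero: "\<pi> (fh F e) - \<pi> (ft F e) = 0" if "e \<in> set p" for e
      using that by auto
    have fwd: "(ft F e, fh F e) \<in> lt" if e: "e \<in> set p" for e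
    proof -
      have "0 \<le> sg lt (ft F e) (fh F e)" using le[OF e] zero[OF e] by blast
      moreover have "ft F e \<noteq> fh F e" using loopfree[of e] e p(1) by (auto simp: ft_def fh_def)
      then have "(ft F e, fh F e) \<in> lt \<or> (fh F e, ft F e) \<in> lt" by (rule lt(3))
      ultimately show ?thesis by (auto simp: sg_def of_bool_def split: if_splits)
    qed
    \<comment> \<open>The rank among the vertices of the cycle grows along each arc, yet its
      increments sum to zero.\<close>
    define g where "g x = int (card {y \<in> ft F ` set p. (y, x) \<in> lt})" for x
    have "0 < g (fh F e) - g (ft F e)" if e: "e \<in> set p" for e
    proof -
      have "{y \<in> ft F ` set p. (y, ft F e) \<in> lt} \<subseteq> {y \<in> ft F ` set p. (y, fh F e) \<in> lt}"
        using fwd[OF e] transD[OF lt(1), of _ "ft F e" "fh F e"] by blast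
      moreover have "ft F e \<in> {y \<in> ft F ` set p. (y, fh F e) \<in> lt}" using fwd[OF e] e by blast
      moreover have "ft F e \<notin> {y \<in> ft F ` set p. (y, ft F e) \<in> lt}" using lt(2) by (auto simp: irrefl_def)
      ultimately have "card {y \<in> ft F ` set p. (y, ft F e) \<in> lt} < card {y \<in> ft F ` set p. (y, fh F e) \<in> lt}"
        by (intro psubset_card_mono) auto
      then show ?thesis by (simp add: g_def)
    qed
    then have "0 < (\<Sum>e\<in>set p. g (fh F e) - g (ft F e))"
      using p(2) by (intro sum_pos) (auto simp: cyc_def)
    with sum_cyc[OF p(2), of g] show False by simp
  qed
  then show ?thesis by (intro exI[of _ "\<lambda>x. even (\<pi> x)"]) blast
qed

section \<open>Finite local edge-connectivity\<close>

text \<open>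
  Close a path \<open>p\<close> from \<open>u\<close> to \<open>v\<close> by a fixed path from \<open>v\<close> to \<open>u\<close> at the first vertex \<open>w\<close> where
  they meet again. The resulting cycle uses the last arc of the fixed path, so its piece does
  not depend on \<open>p\<close>, and there finitely many arcs separate \<open>u\<close> from \<open>w\<close>.
\<close>

lemma finite_hitting_set:
  assumes res: "resolves lt E F \<Q>" and vu: "(v, u) \<in> (adj F E)\<^sup>*" "u \<noteq> v"
  shows "\<exists>S. finite S \<and>
    (\<forall>p. set p \<subseteq> E \<longrightarrow> walk F u p v \<longrightarrow> distinct (u # map (fh F) p) \<longrightarrow> set p \<inter> S \<noteq> {})"
proof -
  obtain xs q where q: "xs \<noteq> []" "hd xs = v" "last xs = u" "distinct xs" "set q \<subseteq> E"
    "map (ft F) q = butlast xs" "map (fh F) q = tl xs"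
    using path_arcs[OF vu(1)] by metis
  define V where "V = set (map (ft F) q)"
  have xs: "xs = map (ft F) q @ [u]" using q(1,3,6) by (metis append_butlast_last_id)
  have uV: "u \<notin> V" using q(4) unfolding V_def xs by auto
  have vV: "v \<in> V" using q(2) vu(2) unfolding V_def xs by (cases q) auto
  have qne: "q \<noteq> []" using vV by (auto simp: V_def)
  have "last q \<in> E" using q(5) qne by auto
  then obtain k where k: "k \<in> \<Q>" "last q \<in> k" using res by (auto simp: resolves_def)
  have set_k: "settled lt F k" using res k(1) by (simp add: resolves_def)
  \<comment> \<open>Candidates for the meeting vertex: those on the fixed path from which
    \<open>u\<close> is reached inside \<open>k\<close>. For each of them \<open>settled\<close>
    supplies a finite cut, and \<open>S\<close> unites these finitely many cuts.\<close>
  define W where "W = {w \<in> V. (w, u) \<in> (adj F k)\<^sup>*}"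
  have "\<exists>X. u \<in> X \<and> w \<notin> X \<and> finite (out F k X)" if "w \<in> W" for w
  proof -
    have "u \<noteq> w" "(w, u) \<in> (adj F k)\<^sup>*" using that uV by (auto simp: W_def)
    then show ?thesis using set_k unfolding settled_def by blast
  qed
  then obtain X where X: "\<And>w. w \<in> W \<Longrightarrow> u \<in> X w \<and> w \<notin> X w \<and> finite (out F k (X w))" by metis
  define S where "S = (\<Union>w\<in>W. out F k (X w))"
  have "finite W" by (simp add: W_def V_def)
  then have "finite S" unfolding S_def using X by blast
  moreover have "set p \<inter> S \<noteq> {}"
    if p: "set p \<subseteq> E" "walk F u p v" "distinct (u # map (fh F) p)" for p
  proof -
    have pv: "u # map (fh F) p = map (ft F) p @ [v]" using p(2) by (rule walk_vertices)
    then have "v \<in> fh F ` set p" using vu(2)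
      by (metis append_is_Nil_conv last.simps last_in_set last_snoc list.set_map list.simps(3) map_is_Nil_conv)
    then have "\<exists>e\<in>set p. fh F e \<in> V" using vV by auto
    then obtain ys e zs where sp: "p = ys @ e # zs" "fh F e \<in> V" "\<forall>y\<in>set ys. fh F y \<notin> V"
      by (rule split_list_first_propE)
    define w where "w = fh F e"
    have "w \<in> ft F ` set q" using sp(2) by (simp add: w_def V_def)
    then obtain f where "f \<in> set q" "ft F f = w" by blast
    then obtain q1 q2 where sq: "q = q1 @ f # q2" "ft F f = w" by (meson split_list)
    have wy: "walk F u (ys @ [e]) w" using p(2) unfolding sp(1) by (auto simp: walk_append w_def)
    have eq1: "map (ft F) (ys @ [e]) = u # map (fh F) ys"
      using walk_vertices[OF wy] by (simp add: w_def)
    have eq2: "map (fh F) q2' = tl (map (ft F) q2') @ [u]" if "q = q1' @ q2'" "q2' \<noteq> []" for q1' q2'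
    proof -
      have "map (fh F) q1' @ map (fh F) q2' = tl (map (ft F) q1' @ map (ft F) q2' @ [u])"
        using q(7) unfolding xs that(1) by simp
      also have "\<dots> = (if q1' = [] then [] else tl (map (ft F) q1') @ [ft F (hd q2')]) @ tl (map (ft F) q2') @ [u]"
        using that(2) by (cases q1'; cases q2') auto
      finally show ?thesis
        using that(2) by (subst (asm) append_eq_append_conv) auto
    qed
    have c: "cyc F ((ys @ [e]) @ (f # q2))"
      unfolding cyc_def
    proof (intro conjI)
      have "distinct (u # map (fh F) ys)" using p(3) by (auto simp: sp(1))
      moreover have "distinct (map (ft F) (f # q2))" using q(4) unfolding xs sq(1) by auto
      moreover have "set (u # map (fh F) ys) \<inter> set (map (ft F) (f # q2)) = {}"
      proof -
        have "set (map (ft F) (f # q2)) \<subseteq> V" unfolding V_def sq(1) by auto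
        then show ?thesis using uV sp(3) by auto
      qed
      ultimately show "distinct (map (ft F) ((ys @ [e]) @ f # q2))"
        unfolding map_append[of _ "ys @ [e]"] eq1 distinct_append by blast
      have m1: "map (ft F) ((ys @ [e]) @ f # q2) = u # map (fh F) ys @ w # map (ft F) q2"
        unfolding map_append[of _ "ys @ [e]"] eq1 using sq(2) by simp
      have m2: "map (fh F) (f # q2) = map (ft F) q2 @ [u]" using eq2[OF sq(1)] by simp
      have "map (fh F) ((ys @ [e]) @ f # q2) = map (fh F) ys @ [w] @ map (fh F) (f # q2)"
        by (simp add: w_def)
      also have "\<dots> = rotate1 (map (ft F) ((ys @ [e]) @ f # q2))"
        unfolding m1 m2 by simp
      finally show "map (fh F) ((ys @ [e]) @ f # q2) = rotate1 (map (ft F) ((ys @ [e]) @ f # q2))" .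
    qed simp
    have "set ((ys @ [e]) @ f # q2) \<subseteq> E" using p(1) q(5) unfolding sp(1) sq(1) by auto
    moreover have "\<forall>p. set p \<subseteq> E \<longrightarrow> cyc F p \<longrightarrow> (\<exists>q\<in>\<Q>. set p \<subseteq> q)"
      using res by (simp add: resolves_def)
    ultimately obtain k' where k': "k' \<in> \<Q>" "set ((ys @ [e]) @ f # q2) \<subseteq> k'"
      using c by blast
    have "last q \<in> set (f # q2)" unfolding sq(1) by simp
    then have "last q \<in> k \<inter> k'" using k(2) k'(2) by auto
    moreover have "disjoint \<Q>" using res by (simp add: resolves_def)
    ultimately have kk: "k' = k" using disjointD[of \<Q> k k'] k(1) k'(1) by blast
    have "(ft F (hd (f # q2)), u) \<in> (adj F (set (f # q2)))\<^sup>*"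
      using eq2[OF sq(1)] by (intro walk_reach) simp_all
    then have wu: "(w, u) \<in> (adj F (set (f # q2)))\<^sup>*" by (simp add: sq(2))
    have "set (f # q2) \<subseteq> k" using k'(2) kk by auto
    from subsetD[OF rtrancl_mono[OF adj_mono[OF this]] wu] have "(w, u) \<in> (adj F k)\<^sup>*" .
    then have wW: "w \<in> W" using sp(2) by (simp add: W_def w_def)
    \<comment> \<open>The initial part of \<open>p\<close> leads from \<open>u\<close> inside
      \<open>X w\<close> to \<open>w\<close> outside it and lies in \<open>k\<close>, so it contains
      an arc of the chosen cut.\<close>
    have "(u, w) \<in> (adj F (set (ys @ [e])))\<^sup>*" using wy by (rule reach_of_walk) simp
    then have "out F (set (ys @ [e])) (X w) \<noteq> {}" using X[OF wW] by (intro out_nonempty) auto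
    then obtain a where a: "a \<in> set (ys @ [e])" "a \<in> out F (set (ys @ [e])) (X w)"
      by (auto simp: out_def)
    then have "a \<in> out F k (X w)" using k'(2) kk by (auto simp: out_def)
    then have "a \<in> S" using wW by (auto simp: S_def)
    moreover have "a \<in> set p" using a(1) by (auto simp: sp(1))
    ultimately show ?thesis by blast
  qed
  ultimately show ?thesis by blast
qed

end

section \<open>Reversion sequences\<close>

text \<open>Since \<open>card\<close> is 0 on infinite sets, this is meaningful only for arcs that
  occur finitely often; that finiteness accompanies it below.\<close>

definition flipped :: "('i \<Rightarrow> 'e list) \<Rightarrow> 'i set \<Rightarrow> 'e set" where
  "flipped C I = {e. odd (card {i \<in> I. e \<in> set (C i)})}"

lemma reverse_arcs_sym_diff: "reverse_arcs A (reverse_arcs F D) = reverse_arcs (sym_diff F A) D"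
  by (auto simp: reverse_arcs_def fun_eq_iff)

lemma reverse_arcs_empty: "reverse_arcs {} D = D"
  by (simp add: reverse_arcs_def)

text \<open>Used at limits: beyond the finitely many steps that contain an arc, its direction no
  longer changes.\<close>

lemma finite_strict_bound:
  assumes wo: "Well_order r" and I: "I \<subseteq> Field r" "I \<noteq> {}" "\<forall>i\<in>I. \<exists>j\<in>I. j \<noteq> i \<and> (i, j) \<in> r"
    and S: "finite S" "S \<subseteq> I"
  shows "\<exists>i\<in>I. S \<subseteq> underS r i"
  using S
proof (induction S)
  case empty
  then show ?case using I(2) by blast
next
  case (insert k S)
  then obtain i where i: "i \<in> I" "S \<subseteq> underS r i" by blast
  obtain j where j: "j \<in> I" "j \<noteq> k" "(k, j) \<in> r" using I(3) insert.prems by blast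
  have ij: "i \<in> Field r" "j \<in> Field r" using i(1) j(1) I(1) by blast+
  have "i = j \<or> (i, j) \<in> r \<or> (j, i) \<in> r"
    using wo ij unfolding order_on_defs total_on_def by (cases "i = j") simp_all
  then consider "i = j \<or> (i, j) \<in> r" | "(j, i) \<in> r" by blast
  then show ?case
  proof cases
    case 1
    have "underS r i \<subseteq> underS r j" if "(i, j) \<in> r"
      using that wo unfolding order_on_defs by (intro underS_incr) auto
    then have "underS r i \<subseteq> underS r j" using 1 by blast
    moreover have "k \<in> underS r j" using j by (simp add: underS_def)
    ultimately show ?thesis using i(2) j(1) by blast
  next
    case 2
    then have "underS r j \<subseteq> underS r i" using wo unfolding order_on_defs by (intro underS_incr) auto
    moreover have "k \<in> underS r j" using j by (simp add: underS_def)
    ultimately show ?thesis using i by blast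
  qed
qed

text \<open>An initial segment is empty, has a last index or has none, matching the three rules for
  \<open>reorients\<close>. In the last case limits exist because each arc occurs finitely
  often.\<close>

lemma reorients_flipped:
  fixes D :: "('v, 'e) pre_digraph"
  assumes wo: "Well_order r"
    and cyc: "\<And>i. i \<in> Field r \<Longrightarrow> pre_digraph.cycle (reverse_arcs (flipped C (underS r i)) D) (C i)"
    and fin: "\<And>e. finite {i \<in> Field r. e \<in> set (C i)}"
  shows "reorients D r C (Field r) (reverse_arcs (flipped C (Field r)) D)"
proof -
  have refl: "(i, i) \<in> r" if "i \<in> Field r" for i
    using that wo unfolding order_on_defs refl_on_def by simp
  have total: "i = j \<or> (i, j) \<in> r \<or> (j, i) \<in> r" if "i \<in> Field r" "j \<in> Field r" for i j
    using that wo unfolding order_on_defs total_on_def by (cases "i = j") simp_all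
  have fld: "underS r i \<subseteq> Field r" for i unfolding underS_def Field_def by auto
  have step: "reorients D r C I (reverse_arcs (flipped C I) D)"
    if I: "Order_Relation.ofilter r I"
      and IH: "\<And>i. i \<in> I \<Longrightarrow> reorients D r C (underS r i) (reverse_arcs (flipped C (underS r i)) D)" for I
  proof -
    have sub: "I \<subseteq> Field r" and down: "\<And>i. i \<in> I \<Longrightarrow> under r i \<subseteq> I"
      using I unfolding Order_Relation.ofilter_def by blast+
    consider "I = {}" | i where "i \<in> I" "\<forall>j\<in>I. (j, i) \<in> r"
      | "I \<noteq> {}" "\<forall>i\<in>I. \<exists>j\<in>I. j \<noteq> i \<and> (i, j) \<in> r"
    proof (cases "\<exists>i\<in>I. \<forall>j\<in>I. (j, i) \<in> r")
      case True
      then obtain i where "i \<in> I" "\<forall>j\<in>I. (j, i) \<in> r" by blast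
      then show thesis by (rule that(2))
    next
      case False
      have lim: "\<forall>i\<in>I. \<exists>j\<in>I. j \<noteq> i \<and> (i, j) \<in> r"
      proof
        fix i assume i: "i \<in> I"
        then obtain j where j: "j \<in> I" "(j, i) \<notin> r" using False by blast
        then have "j \<noteq> i" "(i, j) \<in> r" using total[of i j] refl[of i] i sub by auto
        with j(1) show "\<exists>j\<in>I. j \<noteq> i \<and> (i, j) \<in> r" by blast
      qed
      show thesis
      proof (cases "I = {}")
        case True
        then show thesis by (rule that(1))
      next
        case False
        then show thesis using lim by (rule that(3))
      qed
    qed
    then show ?thesis
    proof cases
      case 1
      have "reorients D r C {} D" by (rule reorients.zero)
      moreover have "flipped C {} = {}" by (simp add: flipped_def)
      ultimately show ?thesis by (simp add: 1 reverse_arcs_empty)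
    next
      case 2
      have iF: "i \<in> Field r" using 2(1) sub by blast
      have Iu: "I = under r i" using 2 down[OF 2(1)] by (auto simp: under_def)
      have eq: "flipped C I = sym_diff (flipped C (underS r i)) (set (C i))"
      proof -
        have ins: "I = insert i (underS r i)" "i \<notin> underS r i"
          using Iu refl[OF iF] by (auto simp: under_def underS_def)
        have "card {j \<in> I. e \<in> set (C j)} =
            card {j \<in> underS r i. e \<in> set (C j)} + of_bool (e \<in> set (C i))" for e
        proof -
          have "{j \<in> I. e \<in> set (C j)} = (if e \<in> set (C i) then insert i {j \<in> underS r i. e \<in> set (C j)}
              else {j \<in> underS r i. e \<in> set (C j)})" unfolding ins(1) by auto
          moreover have "finite {j \<in> underS r i. e \<in> set (C j)}"
            by (rule finite_subset[OF _ fin[of e]]) (use fld in blast)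
          ultimately show ?thesis using ins(2) by simp
        qed
        then show ?thesis by (auto simp: flipped_def)
      qed
      have "reorients D r C (under r i) (reverse_arcs (set (C i)) (reverse_arcs (flipped C (underS r i)) D))"
        by (rule reorients.successor[OF iF IH[OF 2(1)] cyc[OF iF]])
      then show ?thesis unfolding reverse_arcs_sym_diff eq[symmetric] Iu[symmetric] .
    next
      case 3
      show ?thesis
      proof (rule reorients.limit[OF I 3 IH])
        show "is_limit_orientation D r I (\<lambda>i. reverse_arcs (flipped C (underS r i)) D)
          (reverse_arcs (flipped C I) D)"
          unfolding is_limit_orientation_def
        proof (intro conjI allI)
          fix e
          have "finite {i \<in> I. e \<in> set (C i)}"
            by (rule finite_subset[OF _ fin[of e]]) (use sub in blast)
          then obtain i where i: "i \<in> I" "{i \<in> I. e \<in> set (C i)} \<subseteq> underS r i"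
            using finite_strict_bound[OF wo sub 3, of "{i \<in> I. e \<in> set (C i)}"] by auto
          have "e \<in> flipped C (underS r j) \<longleftrightarrow> e \<in> flipped C I" if j: "j \<in> I" "(i, j) \<in> r" for j
          proof -
            have "underS r i \<subseteq> underS r j" using wo j(2) unfolding order_on_defs by (intro underS_incr) auto
            moreover have "underS r j \<subseteq> I" using down[OF j(1)] by (auto simp: under_def underS_def)
            ultimately have "{i \<in> underS r j. e \<in> set (C i)} = {i \<in> I. e \<in> set (C i)}" using i(2) by blast
            then show ?thesis by (simp add: flipped_def)
          qed
          then show "\<exists>i\<in>I. \<forall>j\<in>I. (i, j) \<in> r \<longrightarrow>
            tail (reverse_arcs (flipped C (underS r j)) D) e = tail (reverse_arcs (flipped C I) D) e \<and>
            head (reverse_arcs (flipped C (underS r j)) D) e = head (reverse_arcs (flipped C I) D) e"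
            using i(1) by (intro bexI[of _ i] ballI impI) (simp_all add: reverse_arcs_def)
        qed (simp_all add: reverse_arcs_def)
      qed
    qed
  qed
  have filt: "Order_Relation.ofilter r (underS r i)" for i
    unfolding Order_Relation.ofilter_def
  proof (intro conjI ballI fld subsetI)
    fix a b assume a: "a \<in> underS r i" and b: "b \<in> under r a"
    have "(a, i) \<in> r" using a by (simp add: underS_def)
    then have "underS r a \<subseteq> underS r i" using wo unfolding order_on_defs by (intro underS_incr) auto
    moreover have "b = a \<or> b \<in> underS r a" using b by (auto simp: under_def underS_def)
    ultimately show "b \<in> underS r i" using a by blast
  qed
  have wf: "wf (r - Id)" using wo unfolding order_on_defs by simp
  have "reorients D r C (underS r i) (reverse_arcs (flipped C (underS r i)) D)" for i
    using wf
  proof (induction i rule: wf_induct_rule)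
    case (less i)
    show ?case by (rule step[OF filt less]) (simp add: underS_def)
  qed
  moreover have "Order_Relation.ofilter r (Field r)"
    unfolding Order_Relation.ofilter_def under_def Field_def by auto
  ultimately show ?thesis by (rule step[rotated])
qed

text \<open>The pieces are processed one after the other, and each of them in at most \<open>\<omega>\<close> steps.\<close>

lemma Well_order_lex:
  fixes J :: "('e \<times> nat) set"
  assumes r0: "Well_order r0" "Field r0 = UNIV"
  defines "r \<equiv> {(x, y). x \<in> J \<and> y \<in> J \<and> ((fst x, fst y) \<in> r0 - Id \<or> fst x = fst y \<and> snd x \<le> snd y)}"
  shows "Well_order r" "Field r = J"
proof -
  show fld: "Field r = J"
  proof
    show "Field r \<subseteq> J" unfolding r_def Field_def by auto
    show "J \<subseteq> Field r"
    proof
      fix x assume "x \<in> J"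
      then have "(x, x) \<in> r" by (simp add: r_def)
      then show "x \<in> Field r" by (rule FieldI1)
    qed
  qed
  have r0': "trans r0" "antisym r0" "total_on UNIV r0" "wf (r0 - Id)"
    using r0 unfolding order_on_defs by simp_all
  have tr: "(x, z) \<in> r0 - Id" if "(x, y) \<in> r0 - Id" "(y, z) \<in> r0 - Id" for x y z
    using that transD[OF r0'(1), of x y z] antisymD[OF r0'(2), of x y] by blast
  have asym: "(y, x) \<notin> r0 - Id" if "(x, y) \<in> r0 - Id" for x y
    using that antisymD[OF r0'(2), of x y] by blast
  have "refl_on J r" unfolding refl_on_def r_def by auto
  moreover have "r \<subseteq> J \<times> J" unfolding r_def by auto
  moreover have "trans r"
  proof (rule transI)
    fix x y z assume "(x, y) \<in> r" "(y, z) \<in> r"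
    then show "(x, z) \<in> r" using tr[of "fst x" "fst y" "fst z"] unfolding r_def by auto
  qed
  moreover have "antisym r"
  proof (rule antisymI)
    fix x y assume "(x, y) \<in> r" "(y, x) \<in> r"
    then have xy: "(fst x, fst y) \<in> r0 - Id \<or> fst x = fst y \<and> snd x \<le> snd y"
      "(fst y, fst x) \<in> r0 - Id \<or> fst y = fst x \<and> snd y \<le> snd x" unfolding r_def by simp_all
    have eq: "fst x = fst y"
    proof (rule ccontr)
      assume "fst x \<noteq> fst y"
      then have "(fst x, fst y) \<in> r0 - Id" "(fst y, fst x) \<in> r0 - Id" using xy by simp_all
      then show False using asym[of "fst x" "fst y"] by simp
    qed
    moreover have "snd x = snd y" using xy by (simp add: eq)
    ultimately show "x = y" by (rule prod_eqI)
  qed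
  moreover have "total_on J r"
    unfolding total_on_def
  proof (intro ballI impI)
    fix x y assume xy: "x \<in> J" "y \<in> J"
    show "(x, y) \<in> r \<or> (y, x) \<in> r"
    proof (cases "fst x = fst y")
      case True
      with xy show ?thesis by (auto simp: r_def)
    next
      case False
      then have "(fst x, fst y) \<in> r0 \<or> (fst y, fst x) \<in> r0"
        using r0'(3) by (simp add: total_on_def)
      with xy False show ?thesis by (auto simp: r_def)
    qed
  qed
  moreover have "wf (r - Id)"
  proof (rule wf_subset)
    show "wf ((r0 - Id) <*lex*> less_than)" using r0'(4) by (intro wf_lex_prod) auto
    show "r - Id \<subseteq> (r0 - Id) <*lex*> less_than"
      unfolding r_def by (auto simp: prod_eq_iff)
  qed
  ultimately show "Well_order r" unfolding fld order_on_defs by (intro conjI)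
qed

context flips
begin

text \<open>Each nonempty piece is represented by one of its arcs, so pairs of an arc and a number
  index all steps. As the pieces are disjoint, an arc is touched only by the steps of its own piece
  and inherits the bound 2 from there.\<close>

lemma piece_sequence:
  assumes res: "resolves lt E F \<Q>" and FE: "F \<subseteq> E"
  obtains r :: "('e \<times> nat) rel" and C :: "'e \<times> nat \<Rightarrow> 'e list" where
    "Well_order r" "\<And>i. i \<in> Field r \<Longrightarrow> cyc (flipped C (underS r i)) (C i) \<and> set (C i) \<subseteq> E"
    "\<And>e. finite {i \<in> Field r. e \<in> set (C i)}" "\<And>e. card {i \<in> Field r. e \<in> set (C i)} \<le> 2"
    "flipped C (Field r) = F"
proof -
  have Q: "\<Union>\<Q> = E" "disjoint \<Q>" "\<And>q. q \<in> \<Q> \<Longrightarrow> countable q \<and> below q F {}"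
    using res by (simp_all add: resolves_def)
  define good where "good q C \<longleftrightarrow>
      (\<forall>n. C n \<noteq> [] \<longrightarrow> cyc {e. odd (card {m. m < n \<and> e \<in> set (C m)})} (C n)) \<and>
      (\<forall>n. set (C n) \<subseteq> q) \<and> (\<forall>e. finite {m. e \<in> set (C m)}) \<and> (\<forall>e. card {m. e \<in> set (C m)} \<le> 2) \<and>
      (\<forall>e. odd (card {m. e \<in> set (C m)}) \<longleftrightarrow> e \<in> F \<inter> q)" for q and C :: "nat \<Rightarrow> 'e list"
  have ex: "\<exists>C. good q C" if q: "q \<in> \<Q>" for q
  proof -
    have "below q (F \<inter> q) {} = below q F {}" by (rule below_cong) auto
    then have b: "below q (F \<inter> q) {}" "countable q" using Q(3)[OF q] by simp_all
    show ?thesis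
    proof (rule countable_flip_sequence[OF b(2) _ b(1)])
      fix C :: "nat \<Rightarrow> 'e list"
      assume c: "\<And>n. C n \<noteq> [] \<Longrightarrow> cyc {e. odd (card {m. m < n \<and> e \<in> set (C m)})} (C n)"
        "\<And>n. set (C n) \<subseteq> q" "\<And>e. finite {m. e \<in> set (C m)}" "\<And>e. card {m. e \<in> set (C m)} \<le> 2"
        "\<And>e. odd (card {m. e \<in> set (C m)}) \<longleftrightarrow> e \<in> F \<inter> q"
      show "\<exists>C. good q C" unfolding good_def by (rule exI[of _ C]) (intro conjI allI impI c)
    qed simp
  qed
  define Cq where "Cq q = (SOME C. good q C)" for q
  have g: "good q (Cq q)" if "q \<in> \<Q>" for q
    unfolding Cq_def by (rule someI_ex[OF ex[OF that]])
  have Cq: "Cq q n \<noteq> [] \<Longrightarrow> cyc {e. odd (card {m. m < n \<and> e \<in> set (Cq q m)})} (Cq q n)"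
    "set (Cq q n) \<subseteq> q" "finite {m. e \<in> set (Cq q m)}" "card {m. e \<in> set (Cq q m)} \<le> 2"
    "odd (card {m. e \<in> set (Cq q m)}) \<longleftrightarrow> e \<in> F \<inter> q" if "q \<in> \<Q>" for q n e
    using g[OF that] unfolding good_def by simp_all
  define pc where "pc e = (SOME q. q \<in> \<Q> \<and> e \<in> q)" for e
  define rep where "rep q = (SOME e. e \<in> q)" for q :: "'e set"
  have pc: "pc e \<in> \<Q> \<and> e \<in> pc e" if "e \<in> E" for e
    unfolding pc_def by (rule someI_ex) (use that Q(1) in blast)
  have pc_eq: "pc e = q" if "q \<in> \<Q>" "e \<in> q" for e q
  proof -
    have "e \<in> E" using that Q(1) by blast
    from pc[OF this] show ?thesis using disjointD[OF Q(2), of "pc e" q] that by blast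
  qed
  have rep: "rep q \<in> q" if "e \<in> q" for e q
    unfolding rep_def by (rule someI[of _ e]) (rule that)
  define C where "C i = Cq (pc (fst i)) (snd i)" for i
  \<comment> \<open>Stages with an empty list are dropped, because only cycles may occur in a
    reversion sequence.\<close>
  define J where "J = {i. fst i \<in> E \<and> rep (pc (fst i)) = fst i \<and> C i \<noteq> []}"
  obtain r0 :: "'e rel" where r0: "Well_order r0" "Field r0 = UNIV"
    by (rule exE[OF well_ordering]) (elim conjE)
  define r where "r = {(x, y). x \<in> J \<and> y \<in> J \<and> ((fst x, fst y) \<in> r0 - Id \<or> fst x = fst y \<and> snd x \<le> snd y)}"
  have wo: "Well_order r" and fld: "Field r = J"
    unfolding r_def by (rule Well_order_lex[OF r0])+
  have sub: "set (C i) \<subseteq> pc (fst i)" "pc (fst i) \<in> \<Q>" if "i \<in> J" for i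
  proof -
    have "fst i \<in> E" using that by (simp add: J_def)
    then show q: "pc (fst i) \<in> \<Q>" using pc by blast
    show "set (C i) \<subseteq> pc (fst i)" unfolding C_def by (rule Cq(2)[OF q])
  qed
  have in_set: "fst i = rep (pc e) \<and> e \<in> set (Cq (pc e) (snd i)) \<and> e \<in> E"
    if i: "i \<in> J" and e: "e \<in> set (C i)" for i e
  proof -
    have "e \<in> pc (fst i)" using sub(1)[OF i] e by blast
    then have "pc e = pc (fst i)" by (rule pc_eq[OF sub(2)[OF i]])
    moreover have "e \<in> E" using \<open>e \<in> pc (fst i)\<close> sub(2)[OF i] Q(1) by blast
    moreover have "rep (pc (fst i)) = fst i" using i by (simp add: J_def)
    ultimately show ?thesis using e by (simp add: C_def)
  qed
  have J_mem: "(rep (pc e), m) \<in> J \<and> C (rep (pc e), m) = Cq (pc e) m" if "e \<in> E" "e \<in> set (Cq (pc e) m)" for e m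
  proof -
    have p: "pc e \<in> \<Q>" "e \<in> pc e" using pc[OF that(1)] by blast+
    have rp: "rep (pc e) \<in> pc e" by (rule rep[OF p(2)])
    then have "pc (rep (pc e)) = pc e" by (intro pc_eq p(1))
    moreover have "rep (pc e) \<in> E" using rp p(1) Q(1) by blast
    ultimately show ?thesis using that(2) by (auto simp: J_def C_def)
  qed
  have all_e: "{i \<in> J. e \<in> set (C i)} = Pair (rep (pc e)) ` {m. e \<in> set (Cq (pc e) m)}" if "e \<in> E" for e
  proof
    show "{i \<in> J. e \<in> set (C i)} \<subseteq> Pair (rep (pc e)) ` {m. e \<in> set (Cq (pc e) m)}"
    proof
      fix i assume "i \<in> {i \<in> J. e \<in> set (C i)}"
      then have "fst i = rep (pc e)" "e \<in> set (Cq (pc e) (snd i))" using in_set[of i e] by simp_all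
      then show "i \<in> Pair (rep (pc e)) ` {m. e \<in> set (Cq (pc e) m)}" by (cases i) simp
    qed
    show "Pair (rep (pc e)) ` {m. e \<in> set (Cq (pc e) m)} \<subseteq> {i \<in> J. e \<in> set (C i)}"
      using J_mem[OF that] by auto
  qed
  have no_e: "{i \<in> J. e \<in> set (C i)} = {}" if "e \<notin> E" for e
  proof -
    have "e \<notin> set (C i)" if "i \<in> J" for i
      using in_set[OF that, of e] \<open>e \<notin> E\<close> by argo
    then show ?thesis by simp
  qed
  have card_e: "card {i \<in> J. e \<in> set (C i)} = card {m. e \<in> set (Cq (pc e) m)}" if "e \<in> E" for e
    unfolding all_e[OF that] by (intro card_image inj_onI) simp
  show thesis
  proof (rule that[OF wo])
    show "finite {i \<in> Field r. e \<in> set (C i)}" for e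
    proof (cases "e \<in> E")
      case True
      then show ?thesis unfolding fld all_e[OF True] using Cq(3) pc[OF True] by simp
    next
      case False
      then show ?thesis unfolding fld no_e[OF False] by simp
    qed
    show "card {i \<in> Field r. e \<in> set (C i)} \<le> 2" for e
    proof (cases "e \<in> E")
      case True
      then show ?thesis unfolding fld card_e[OF True] using Cq(4) pc[OF True] by simp
    next
      case False
      then show ?thesis unfolding fld no_e[OF False] by simp
    qed
    show "flipped C (Field r) = F"
    proof (intro set_eqI)
      fix e
      show "e \<in> flipped C (Field r) \<longleftrightarrow> e \<in> F"
      proof (cases "e \<in> E")
        case True
        have "e \<in> flipped C (Field r) \<longleftrightarrow> odd (card {m. e \<in> set (Cq (pc e) m)})"
          by (simp add: flipped_def fld card_e[OF True])
        also have "\<dots> \<longleftrightarrow> e \<in> F \<inter> pc e" using pc[OF True] by (intro Cq(5)) blast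
        finally show ?thesis using pc[OF True] by blast
      next
        case False
        then have "e \<notin> F" using FE by blast
        moreover have "e \<notin> flipped C (Field r)" unfolding flipped_def fld by (simp add: no_e[OF False])
        ultimately show ?thesis by blast
      qed
    qed
    fix i assume "i \<in> Field r"
    then have iJ: "i \<in> J" by (simp add: fld)
    have q: "pc (fst i) \<in> \<Q>" and Ci: "C i = Cq (pc (fst i)) (snd i)" "C i \<noteq> []" "rep (pc (fst i)) = fst i"
      using iJ sub(2)[OF iJ] by (simp_all add: J_def C_def)
    let ?G = "{e. odd (card {m. m < snd i \<and> e \<in> set (Cq (pc (fst i)) m)})}"
    \<comment> \<open>Of the steps before \<open>i\<close>, only those of the same piece with a
      smaller number can contain an arc of \<open>C i\<close>. So the state met by
      \<open>C i\<close> agrees on its arcs with the one in the sequence of that piece.\<close>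
    have "e \<in> flipped C (underS r i) \<longleftrightarrow> e \<in> ?G" if e: "e \<in> set (C i)" for e
    proof -
      have pe: "pc e = pc (fst i)" using sub[OF iJ] e by (intro pc_eq) auto
      have eE: "e \<in> E" using sub[OF iJ] e Q(1) by blast
      have "{k \<in> underS r i. e \<in> set (C k)} =
          Pair (fst i) ` {m. m < snd i \<and> e \<in> set (Cq (pc (fst i)) m)}"
      proof
        show "{k \<in> underS r i. e \<in> set (C k)} \<subseteq> Pair (fst i) ` {m. m < snd i \<and> e \<in> set (Cq (pc (fst i)) m)}"
        proof
          fix k assume k: "k \<in> {k \<in> underS r i. e \<in> set (C k)}"
          then have kr: "k \<in> J" "(k, i) \<in> r" "k \<noteq> i" "e \<in> set (C k)"
            by (simp_all add: underS_def r_def)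
          have k': "fst k = fst i" "e \<in> set (Cq (pc (fst i)) (snd k))"
            using in_set[OF kr(1,4)] pe Ci(3) by simp_all
          moreover have "snd k < snd i" using kr(2,3) k'(1) by (auto simp: r_def prod_eq_iff)
          ultimately show "k \<in> Pair (fst i) ` {m. m < snd i \<and> e \<in> set (Cq (pc (fst i)) m)}" by (cases k) simp
        qed
        show "Pair (fst i) ` {m. m < snd i \<and> e \<in> set (Cq (pc (fst i)) m)} \<subseteq> {k \<in> underS r i. e \<in> set (C k)}"
        proof
          fix k assume "k \<in> Pair (fst i) ` {m. m < snd i \<and> e \<in> set (Cq (pc (fst i)) m)}"
          then obtain m where m: "k = (fst i, m)" "m < snd i" "e \<in> set (Cq (pc (fst i)) m)" by blast
          have "k \<in> J" "e \<in> set (C k)" using J_mem[OF eE, of m] m pe Ci(3) by simp_all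
          moreover have "k \<noteq> i" using m(1,2) by (metis snd_conv less_irrefl)
          moreover have "(k, i) \<in> r" unfolding r_def using m(1,2) iJ \<open>k \<in> J\<close> by simp
          ultimately show "k \<in> {k \<in> underS r i. e \<in> set (C k)}"
            by (simp add: underS_def)
        qed
      qed
      then have "card {k \<in> underS r i. e \<in> set (C k)} = card {m. m < snd i \<and> e \<in> set (Cq (pc (fst i)) m)}"
        by (simp add: card_image inj_on_def)
      then show ?thesis by (simp add: flipped_def)
    qed
    then have "flipped C (underS r i) \<inter> set (C i) = ?G \<inter> set (C i)" by blast
    then have "cyc (flipped C (underS r i)) (C i) \<longleftrightarrow> cyc ?G (C i)" by (rule cyc_cong)
    then have "cyc (flipped C (underS r i)) (C i)" using Cq(1)[OF q, of "snd i"] Ci(1,2) by simp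
    moreover have "set (C i) \<subseteq> E" using sub[OF iJ] Q(1) by blast
    ultimately show "cyc (flipped C (underS r i)) (C i) \<and> set (C i) \<subseteq> E" by blast
  qed
qed

lemma walk_iff: "walk F x p y \<longleftrightarrow> x # map (fh F) p = map (ft F) p @ [y]"
proof (induction p arbitrary: x)
  case (Cons e p)
  show ?case unfolding walk.simps Cons.IH by auto
qed auto

end

section \<open>Transfer to digraphs\<close>

context oriented_graph
begin

interpretation fl: flips "tail G" "head G" .

lemma reverse_arcs_simps:
  "tail (reverse_arcs F G) e = fl.ft F e" "head (reverse_arcs F G) e = fl.fh F e"
  "arcs (reverse_arcs F G) = arcs G" "verts (reverse_arcs F G) = verts G"
  by (simp_all add: reverse_arcs_def fl.ft_def fl.fh_def)

lemma ft_fh_in_verts: "e \<in> arcs G \<Longrightarrow> fl.ft F e \<in> verts G \<and> fl.fh F e \<in> verts G"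
  unfolding verts_eq_ends fl.ft_def fl.fh_def by auto

lemma cas_reverse_arcs: "pre_digraph.cas (reverse_arcs F G) u p v \<longleftrightarrow> fl.walk F u p v"
  by (induction p arbitrary: u) (auto simp: pre_digraph.cas.simps reverse_arcs_simps)

lemma awalk_verts_reverse_arcs:
  "fl.walk F u p v \<Longrightarrow> pre_digraph.awalk_verts (reverse_arcs F G) u p = u # map (fl.fh F) p"
proof (induction p arbitrary: u)
  case (Cons e p)
  then show ?case by (simp add: pre_digraph.awalk_verts.simps reverse_arcs_simps)
qed (simp add: pre_digraph.awalk_verts.simps)

text \<open>\<open>pre_digraph.cycle\<close> asks for distinct heads along a closed walk,
  \<open>cyc\<close> for distinct tails; the two lists are rotations of each other.\<close>

lemma cycle_reverse_arcs:
  "pre_digraph.cycle (reverse_arcs F G) p \<longleftrightarrow> set p \<subseteq> arcs G \<and> fl.cyc F p"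
proof
  assume "pre_digraph.cycle (reverse_arcs F G) p"
  then obtain u where u: "set p \<subseteq> arcs G" "fl.walk F u p u" "p \<noteq> []"
    "distinct (tl (pre_digraph.awalk_verts (reverse_arcs F G) u p))"
    unfolding pre_digraph.cycle_def pre_digraph.awalk_def cas_reverse_arcs reverse_arcs_simps by blast
  have d: "distinct (map (fl.fh F) p)" using u(4) by (simp add: awalk_verts_reverse_arcs[OF u(2)])
  have "map (fl.fh F) p = rotate1 (map (fl.ft F) p)"
    using fl.walk_vertices[OF u(2)] u(3) by (cases p) auto
  with d u(1,3) show "set p \<subseteq> arcs G \<and> fl.cyc F p"
    unfolding fl.cyc_def using distinct1_rotate[of "map (fl.ft F) p"] by (metis distinct1_rotate)
next
  assume p: "set p \<subseteq> arcs G \<and> fl.cyc F p"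
  then obtain e q where eq: "p = e # q" unfolding fl.cyc_def by (cases p) auto
  let ?u = "fl.ft F e"
  have "?u # map (fl.fh F) p = map (fl.ft F) p @ [?u]" using p eq unfolding fl.cyc_def by simp
  then have w: "fl.walk F ?u p ?u" by (simp only: fl.walk_iff)
  have "distinct (map (fl.fh F) p)" using p unfolding fl.cyc_def by (metis distinct1_rotate)
  then have "distinct (tl (pre_digraph.awalk_verts (reverse_arcs F G) ?u p))"
    by (simp add: awalk_verts_reverse_arcs[OF w])
  moreover have "?u \<in> verts G" using p eq ft_fh_in_verts by simp
  ultimately show "pre_digraph.cycle (reverse_arcs F G) p"
    unfolding pre_digraph.cycle_def pre_digraph.awalk_def cas_reverse_arcs reverse_arcs_simps
    using p w eq by blast
qed

lemma loopfree_reverse_arcs: "loopfree_digraph (reverse_arcs F G)"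
proof
  fix e assume "e \<in> arcs (reverse_arcs F G)"
  then have e: "e \<in> arcs G" by (simp add: reverse_arcs_simps)
  show "tail (reverse_arcs F G) e \<in> verts (reverse_arcs F G)"
    "head (reverse_arcs F G) e \<in> verts (reverse_arcs F G)"
    using ft_fh_in_verts[OF e] by (simp_all add: reverse_arcs_simps)
  show "tail (reverse_arcs F G) e \<noteq> head (reverse_arcs F G) e"
    using no_loops[OF e] by (auto simp: reverse_arcs_def)
qed

lemma dichromatic_number_reverse_arcs:
  assumes c: "\<forall>p b. set p \<subseteq> arcs G \<longrightarrow> fl.cyc F p \<longrightarrow> \<not> (\<forall>e\<in>set p. c (fl.ft F e) = (b :: bool))"
  shows "dichromatic_number (reverse_arcs F G) \<le>o ctwo"
proof (rule loopfree_digraph.dichromatic_number_le[OF loopfree_reverse_arcs Card_order_ctwo])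
  show "dicolourable (reverse_arcs F G) ctwo"
    unfolding dicolourable_def cycle_reverse_arcs reverse_arcs_simps
    using c by (intro exI[of _ c]) (simp add: ctwo_def Field_card_of)
qed

text \<open>Every path meets the finite hitting set, and disjoint paths meet it in different arcs;
  this bounds the attained maximum.\<close>

lemma local_edge_connectivity_reverse_arcs:
  assumes res: "fl.resolves lt (arcs G) F \<Q>"
    and S: "S \<in> pre_digraph.sccs_verts (reverse_arcs F G)" "u \<in> S" "v \<in> S" "u \<noteq> v"
  shows "local_edge_connectivity (reverse_arcs F G) u v <o natLeq"
proof -
  let ?H = "reverse_arcs F G"
  have "v \<rightarrow>\<^sup>*\<^bsub>?H\<^esub> u" using S unfolding pre_digraph.sccs_verts_def by blast
  then have "(v, u) \<in> (arcs_ends ?H)\<^sup>*" by (rule reachable_rtranclI)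
  moreover have "arcs_ends ?H = fl.adj F (arcs G)"
    unfolding arcs_ends_def arc_to_ends_def fl.adj_def by (simp add: reverse_arcs_simps)
  ultimately have "(v, u) \<in> (fl.adj F (arcs G))\<^sup>*" by simp
  from fl.finite_hitting_set[OF res this S(4)] obtain T where T: "finite T"
    "\<forall>p. set p \<subseteq> arcs G \<longrightarrow> fl.walk F u p v \<longrightarrow> distinct (u # map (fl.fh F) p) \<longrightarrow> set p \<inter> T \<noteq> {}"
    by blast
  obtain P where P: "edge_disjoint_paths ?H u v P" "|P| =o local_edge_connectivity ?H u v"
    using local_edge_connectivity_max[OF S(4), of ?H] by blast
  have "set p \<inter> T \<noteq> {}" if "p \<in> P" for p
  proof -
    have "pre_digraph.apath ?H u p v" using P(1) that unfolding edge_disjoint_paths_def by blast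
    then have p: "set p \<subseteq> arcs G" "fl.walk F u p v" "distinct (pre_digraph.awalk_verts ?H u p)"
      unfolding pre_digraph.apath_def pre_digraph.awalk_def cas_reverse_arcs reverse_arcs_simps by blast+
    have "distinct (u # map (fl.fh F) p)" using p(3) unfolding awalk_verts_reverse_arcs[OF p(2)] .
    with T(2) p(1,2) show ?thesis by blast
  qed
  then have "|P| \<le>o |T|" by (rule edge_disjoint_paths_hit[OF P(1)])
  then have "finite P" using T(1) by (rule card_of_ordLeq_finite)
  then have "|P| <o natLeq" by (simp add: finite_iff_ordLess_natLeq)
  with ordIso_symmetric[OF P(2)] show ?thesis by (rule ordIso_ordLess_trans)
qed

lemma reversion_sequence_exists:
  "\<exists>(r :: ('b \<times> nat) rel) (C :: 'b \<times> nat \<Rightarrow> 'b list).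
    reversion_sequence G r C \<and>
    dichromatic_number (reorientation G r C) \<le>o ctwo \<and>
    (\<forall>S\<in>pre_digraph.sccs_verts (reorientation G r C). \<forall>u\<in>S. \<forall>v\<in>S. u \<noteq> v \<longrightarrow>
       local_edge_connectivity (reorientation G r C) u v <o natLeq) \<and>
    (\<forall>e\<in>arcs G. finite {i \<in> Field r. e \<in> set (C i)} \<and> card {i \<in> Field r. e \<in> set (C i)} \<le> 2)"
proof -
  obtain L :: "'a rel" where lt: "trans L" "irrefl L" "\<And>x y. x \<noteq> y \<Longrightarrow> (x, y) \<in> L \<or> (y, x) \<in> L"
    using acyclic_linear_extension[of "{}"] by (auto simp: acyclic_def)
  \<comment> \<open>At the top level no pairs are prescribed, and any strict linear order of the
    vertices will do.\<close>
  have "\<exists>F \<Q>. F \<subseteq> arcs G \<and> fl.resolves L (arcs G) F \<Q> \<and>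
      (\<forall>(a, b)\<in>{}. (b, a) \<notin> (fl.adj F (arcs G) \<union> {})\<^sup>*)"
    by (rule fl.resolve) (simp_all add: trans_def irrefl_def)
  then obtain F \<Q> where F: "F \<subseteq> arcs G" "fl.resolves L (arcs G) F \<Q>" by blast
  have nonneg: "0 \<le> fl.wt L F p" if p: "set p \<subseteq> arcs G" "fl.cyc F p" for p
  proof -
    have "\<exists>q\<in>\<Q>. set p \<subseteq> q" using F(2) p by (simp add: fl.resolves_def)
    then obtain q where q: "q \<in> \<Q>" "set p \<subseteq> q" by blast
    have "fl.settled L F q" using F(2) q(1) by (simp add: fl.resolves_def)
    then show ?thesis using q(2) p(2) unfolding fl.settled_def by blast
  qed
  have "\<exists>c :: 'a \<Rightarrow> bool. \<forall>p b. set p \<subseteq> arcs G \<longrightarrow> fl.cyc F p \<longrightarrow> \<not> (\<forall>e\<in>set p. c (fl.ft F e) = b)"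
    by (rule fl.two_colours[OF nonneg lt no_loops])
  then obtain c :: "'a \<Rightarrow> bool" where
    c: "\<forall>p b. set p \<subseteq> arcs G \<longrightarrow> fl.cyc F p \<longrightarrow> \<not> (\<forall>e\<in>set p. c (fl.ft F e) = b)" ..
  show ?thesis
  proof (rule fl.piece_sequence[OF F(2,1)])
    fix r :: "('b \<times> nat) rel" and C :: "'b \<times> nat \<Rightarrow> 'b list"
    assume wo: "Well_order r"
      and cyc: "\<And>i. i \<in> Field r \<Longrightarrow> fl.cyc (flipped C (underS r i)) (C i) \<and> set (C i) \<subseteq> arcs G"
      and fin: "\<And>e. finite {i \<in> Field r. e \<in> set (C i)}"
      and le: "\<And>e. card {i \<in> Field r. e \<in> set (C i)} \<le> 2"
      and fl: "flipped C (Field r) = F"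
    have re: "reorients G r C (Field r) (reverse_arcs F G)"
      using reorients_flipped[OF wo _ fin, of G] cyc unfolding fl cycle_reverse_arcs by simp
    then have eq: "reorientation G r C = reverse_arcs F G" by (rule reorientation_eq[OF wo])
    have "reversion_sequence G r C" using wo re unfolding reversion_sequence_def by blast
    then show ?thesis
      using dichromatic_number_reverse_arcs[OF c] local_edge_connectivity_reverse_arcs[OF F(2)] fin le
      by (intro exI[of _ r] exI[of _ C]) (simp add: eq)
  qed
qed

end

theorem mainTheorem1:
  fixes D :: "('v, 'e) pre_digraph"
  assumes "oriented_graph D"
  shows "\<exists>(r :: ('e \<times> nat) rel) (C :: 'e \<times> nat \<Rightarrow> 'e list).
    reversion_sequence D r C \<and>
    dichromatic_number (reorientation D r C) \<le>o ctwo \<and>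
    (\<forall>S\<in>pre_digraph.sccs_verts (reorientation D r C). \<forall>u\<in>S. \<forall>v\<in>S. u \<noteq> v \<longrightarrow>
       local_edge_connectivity (reorientation D r C) u v <o natLeq) \<and>
    (\<forall>e\<in>arcs D. finite {i \<in> Field r. e \<in> set (C i)} \<and> card {i \<in> Field r. e \<in> set (C i)} \<le> 2)"
  using assms by (rule oriented_graph.reversion_sequence_exists)

end
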